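(* Let $i\in\{1,2\}$ and let $j\ge 2i$ be an integer. Then for every $n$, $$g_{DP}(i,j,n)\ \ge\ \frac{(2i+1)n+j-i+1}{i+1},$$ that is, every $n$-vertex $(i,j)$-critical simple graph has at least $\frac{(2i+1)n+j-i+1}{i+1}$ edges. Moreover, this is sharp: for each such pair $(i,j)$ there are infinitely many positive integers $n$ for which $g_{DP}(i,j,n)=\frac{(2i+1)n+j-i+1}{i+1}$, i.e. for which there exists an $n$-vertex $(i,j)$-critical simple graph with exactly $\frac{(2i+1)n+j-i+1}{i+1}$ edges.
   Context: All graphs are finite. Let $G$ be a simple graph. A ($2$-fold) cover of $G$ is a pair $\mathscr{H}=(L,H)$ where $H$ is a graph and $L:V(G)\to 2^{V(H)}$ satisfies: (1) the sets $L(u)$, $u\in V(G)$, partition $V(H)$, and $|L(u)|=2$ for every $u$; (2) $H[L(u)]$ is complete for every $u\in V(G)$; (3) if there is an edge of $H$ between $L(u)$ and $L(v)$, then $u=v$ or $uv\in E(G)$; (4) for every $uv\in E(G)$, the edges of $H$ between $L(u)$ and $L(v)$ form a (possibly empty) matching. For each $u\in V(G)$ the two elements of $L(u)$ are labelled $L(u)=\{p(u),r(u)\}$, where $p(u)$ is called the poor node and $r(u)$ the rich node; the labelling is part of the cover. An $\mathscr{H}$-map is a function $\varphi:V(G)\to V(H)$ with $\varphi(v)\in L(v)$ for every $v\in V(G)$; $H_\varphi$ denotes the subgraph of $H$ induced by $\varphi(V(G))$. For integers $0\le i\le j$, an $\mathscr{H}$-map $\varphi$ is an $(i,j,\mathscr{H})$-coloring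 of $G$ if every poor node in $H_\varphi$ has degree at most $i$ in $H_\varphi$ and every rich node in $H_\varphi$ has degree at most $j$ in $H_\varphi$. $G$ is $(i,j)$-colorable if it has an $(i,j,\mathscr{H})$-coloring for every $2$-fold cover $\mathscr{H}$ of $G$. $G$ is $(i,j)$-critical if $G$ is not $(i,j)$-colorable but every proper subgraph of $G$ is $(i,j)$-colorable. $g_{DP}(i,j,n)$ denotes the minimum number of edges in an $n$-vertex $(i,j)$-critical simple graph (interpreted as $+\infty$ if there is no such graph). *)

theory Defs
  imports Main "HOL-Library.Disjoint_Sets" "HOL-Library.Extended_Real"
begin

datatype 'a graph = Graph (verts: "'a set") (edges: "'a set set")

definition simple_graph :: "'a graph \<Rightarrow> bool" where
  "simple_graph G \<longleftrightarrow>
     finite (verts G) \<and> (\<forall>e\<in>edges G. e \<subseteq> verts G \<and> card e = 2)"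

definition subgraph :: "'a graph \<Rightarrow> 'a graph \<Rightarrow> bool" where
  "subgraph G' G \<longleftrightarrow>
     simple_graph G' \<and> simple_graph G \<and> verts G' \<subseteq> verts G \<and> edges G' \<subseteq> edges G"

definition induced_subgraph :: "'a graph \<Rightarrow> 'a set \<Rightarrow> 'a graph" where
  "induced_subgraph G X = Graph (verts G \<inter> X) {e \<in> edges G. e \<subseteq> X}"

definition degree :: "'a graph \<Rightarrow> 'a \<Rightarrow> nat" where
  "degree G v = card {e \<in> edges G. v \<in> e}"

definition complete_graph :: "'a graph \<Rightarrow> bool" where
  "complete_graph G \<longleftrightarrow>
     (\<forall>x\<in>verts G. \<forall>y\<in>verts G. x \<noteq> y \<longrightarrow> {x, y} \<in> edges G)"

definition edges_between :: "'a graph \<Rightarrow> 'a set \<Rightarrow> 'a set \<Rightarrow> 'a set set" where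
  "edges_between G A B = {e \<in> edges G. \<exists>x\<in>A. \<exists>y\<in>B. e = {x, y}}"

text \<open>The labelling of each list by a poor and a rich node is part of the cover.\<close>

record ('a, 'b) cover =
  nodes :: "'a \<Rightarrow> 'b set"
  cover_graph :: "'b graph"
  poor :: "'a \<Rightarrow> 'b"
  rich :: "'a \<Rightarrow> 'b"

text \<open>Only the values of \<open>nodes\<close>, \<open>poor\<close> and \<open>rich\<close> on the vertices of \<open>G\<close> matter.
  As \<open>edges_between\<close> is a set of 2-element sets, it is a matching
  iff its members are pairwise disjoint (\<open>disjoint\<close>).\<close>

definition cover_of :: "'a graph \<Rightarrow> ('a, 'b) cover \<Rightarrow> bool" where
  "cover_of G \<H> \<longleftrightarrow>
     simple_graph (cover_graph \<H>) \<and>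
     (\<Union>u\<in>verts G. nodes \<H> u) = verts (cover_graph \<H>) \<and>
     disjoint_family_on (nodes \<H>) (verts G) \<and>
     (\<forall>u\<in>verts G. card (nodes \<H> u) = 2) \<and>
     (\<forall>u\<in>verts G. complete_graph (induced_subgraph (cover_graph \<H>) (nodes \<H> u))) \<and>
     (\<forall>u\<in>verts G. \<forall>v\<in>verts G.
        edges_between (cover_graph \<H>) (nodes \<H> u) (nodes \<H> v) \<noteq> {} \<longrightarrow>
        u = v \<or> {u, v} \<in> edges G) \<and>
     (\<forall>u\<in>verts G. \<forall>v\<in>verts G. {u, v} \<in> edges G \<longrightarrow>
        disjoint (edges_between (cover_graph \<H>) (nodes \<H> u) (nodes \<H> v))) \<and>
     (\<forall>u\<in>verts G. nodes \<H> u = {poor \<H> u, rich \<H> u})"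

definition cover_map :: "'a graph \<Rightarrow> ('a, 'b) cover \<Rightarrow> ('a \<Rightarrow> 'b) \<Rightarrow> bool" where
  "cover_map G \<H> \<phi> \<longleftrightarrow> (\<forall>v\<in>verts G. \<phi> v \<in> nodes \<H> v)"

definition map_graph :: "'a graph \<Rightarrow> ('a, 'b) cover \<Rightarrow> ('a \<Rightarrow> 'b) \<Rightarrow> 'b graph" where
  "map_graph G \<H> \<phi> = induced_subgraph (cover_graph \<H>) (\<phi> ` verts G)"

definition cover_coloring ::
    "nat \<Rightarrow> nat \<Rightarrow> 'a graph \<Rightarrow> ('a, 'b) cover \<Rightarrow> ('a \<Rightarrow> 'b) \<Rightarrow> bool" where
  "cover_coloring i j G \<H> \<phi> \<longleftrightarrow>
     cover_map G \<H> \<phi> \<and>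
     (\<forall>x \<in> verts (map_graph G \<H> \<phi>) \<inter> poor \<H> ` verts G. degree (map_graph G \<H> \<phi>) x \<le> i) \<and>
     (\<forall>x \<in> verts (map_graph G \<H> \<phi>) \<inter> rich \<H> ` verts G. degree (map_graph G \<H> \<phi>) x \<le> j)"

text \<open>Covers range over graphs with nodes in \<^typ>\<open>nat\<close>. This loses nothing: the cover
  graph is finite, so every cover is isomorphic to one of this form.\<close>

definition colorable :: "nat \<Rightarrow> nat \<Rightarrow> 'a graph \<Rightarrow> bool" where
  "colorable i j G \<longleftrightarrow>
     (\<forall>\<H> :: ('a, nat) cover. cover_of G \<H> \<longrightarrow> (\<exists>\<phi>. cover_coloring i j G \<H> \<phi>))"

definition critical :: "nat \<Rightarrow> nat \<Rightarrow> 'a graph \<Rightarrow> bool" where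
  "critical i j G \<longleftrightarrow>
     simple_graph G \<and> \<not> colorable i j G \<and>
     (\<forall>G'. subgraph G' G \<and> G' \<noteq> G \<longrightarrow> colorable i j G')"

text \<open>Likewise the minimum is taken over graphs with vertices in \<^typ>\<open>nat\<close>; the infimum
  of the empty set in \<^typ>\<open>enat\<close> is \<open>\<infinity>\<close>, and a nonempty infimum is attained.\<close>

definition g_DP :: "nat \<Rightarrow> nat \<Rightarrow> nat \<Rightarrow> enat" where
  "g_DP i j n =
     (INF G \<in> {G :: nat graph. critical i j G \<and> card (verts G) = n}. enat (card (edges G)))"

definition edge_bound :: "nat \<Rightarrow> nat \<Rightarrow> nat \<Rightarrow> real" where
  "edge_bound i j n = ((2 * real i + 1) * real n + real j - real i + 1) / (real i + 1)"

end

theory Submission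
  imports Defs
begin

text \<open>Keep a 2-fold cover as a sign for every edge (parallel or crossing matching) and allow, besides the
  edges of the graph, half-edges, whose clash is charged to only one of their ends, and arbitrary
  capacities of the two nodes of a vertex. Weighting a vertex by its capacities, an edge by \<open>i + 1\<close> and
  a half-edge by 1 gives a submodular potential, and the heart of the proof is that a configuration
  is colourable if every nonempty set of vertices has potential at least \<open>i - j\<close>. In a
  minimal counterexample, contracting a coloured set shows that proper sets have larger potential
  than the whole, so there is room to delete a vertex and to pay for extra capacity at its
  neighbours; this excludes vertices of small degree. On the other hand, a colouring with the fewest
  clashes yields a set of vertices of small average degree, and discharging from its exceptional
  vertices (the set \<open>Qs\<close>) gives a contradiction.

  Applied to the signed graph of a critical graph, contraction of a set of minimum potential
  shows that this set is everything, which is the edge bound. For sharpness, stars with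
  \<open>i\<close> or \<open>i + 1\<close> leaves are joined completely to a common root, and further stars
  in a chain, each to the centre of the preceding one.\<close>

text \<open>The class of signed graphs with capacities \<open>i\<close> and \<open>j\<close> is not
  closed under the reductions: fixing colours around a vertex uses up capacity, and a suppressed
  vertex of degree two becomes a constraint that only one of its neighbours has to absorb. Arbitrary
  capacities and half-edges make the class closed, so that induction applies. Submodularity turns
  the spare potential around a vertex into a function of sets of its neighbours, to which uncrossing
  applies. It decides which clashes can be reserved simultaneously at the neighbours of a deleted
  vertex, and this excludes vertices with many half-edges. The exceptional set comes from
  \<open>i = 2\<close>: a vertex with full capacities, three full edges and no half-edge weighs 5,
  so twice its weight exceeds the \<open>3 * 3\<close> units that its edges account for, and the
  reductions do not exclude it. It is harmless because a violation at it can be repaired locally.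
  Hence its neighbours need no reserves for it, and they can take over its surplus.\<close>

text \<open>\<open>ces\<close> and \<open>csg\<close> are the edges with their signs, \<open>chs\<close>, \<open>che\<close> and \<open>chsg\<close> the half-edges (indexed, as
  they may be parallel) with their ends and signs, and \<open>ccp v b\<close> is the number of clashes that the rich
  (\<open>b = True\<close>) or poor node of \<open>v\<close> tolerates; capacity \<open>-1\<close> forbids the node. An edge of sign
  \<open>True\<close> joins nodes of the same kind.\<close>

record 'a config =
  cvs :: "'a set"
  ces :: "'a set set"
  csg :: "'a set \<Rightarrow> bool"
  chs :: "nat set"
  che :: "nat \<Rightarrow> 'a set"
  chsg :: "nat \<Rightarrow> bool"
  ccp :: "'a \<Rightarrow> bool \<Rightarrow> int"

text \<open>\<open>\<phi> v\<close> is \<open>True\<close> when the rich node of \<open>v\<close> is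
  chosen. Edges are sets, so equality of the two colours is expressed without naming the
  ends.\<close>

definition clash :: "('a \<Rightarrow> bool) \<Rightarrow> bool \<Rightarrow> 'a set \<Rightarrow> bool" where
  "clash \<phi> s e \<longleftrightarrow> (\<forall>u\<in>e. \<forall>v\<in>e. \<phi> u = \<phi> v) = s"

definition full_clashes :: "'a config \<Rightarrow> ('a \<Rightarrow> bool) \<Rightarrow> 'a \<Rightarrow> 'a set set" where
  "full_clashes C \<phi> v = {e \<in> ces C. v \<in> e \<and> clash \<phi> (csg C e) e}"

definition half_clashes :: "'a config \<Rightarrow> ('a \<Rightarrow> bool) \<Rightarrow> 'a \<Rightarrow> nat set" where
  "half_clashes C \<phi> v = {k \<in> chs C. v \<in> che C k \<and> clash \<phi> (chsg C k) (che C k)}"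

definition half_hits :: "'a config \<Rightarrow> ('a \<Rightarrow> bool) \<Rightarrow> (nat \<Rightarrow> 'a) \<Rightarrow> 'a \<Rightarrow> nat set" where
  "half_hits C \<phi> \<omega> v = {k \<in> chs C. \<omega> k = v \<and> clash \<phi> (chsg C k) (che C k)}"

text \<open>\<open>\<omega> k\<close> is the end to which a clash of the half-edge \<open>k\<close> is charged; the capacities at \<open>Q\<close> are
  ignored.\<close>

definition col :: "'a set \<Rightarrow> 'a config \<Rightarrow> ('a \<Rightarrow> bool) \<Rightarrow> (nat \<Rightarrow> 'a) \<Rightarrow> bool" where
  "col Q C \<phi> \<omega> \<longleftrightarrow> (\<forall>k\<in>chs C. \<omega> k \<in> che C k) \<and>
     (\<forall>v\<in>cvs C - Q. int (card (full_clashes C \<phi> v) + card (half_hits C \<phi> \<omega> v)) \<le> ccp C v (\<phi> v))"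

definition conf_colorable :: "'a config \<Rightarrow> bool" where
  "conf_colorable C \<longleftrightarrow> (\<exists>\<phi> \<omega>. col {} C \<phi> \<omega>)"

definition fulls :: "'a config \<Rightarrow> 'a \<Rightarrow> 'a set set" where
  "fulls C v = {e \<in> ces C. v \<in> e}"

definition halves :: "'a config \<Rightarrow> 'a \<Rightarrow> nat set" where
  "halves C v = {k \<in> chs C. v \<in> che C k}"

definition restr :: "'a config \<Rightarrow> 'a set \<Rightarrow> 'a config" where
  "restr C S = C\<lparr>cvs := S, ces := {e \<in> ces C. e \<subseteq> S}, chs := {k \<in> chs C. che C k \<subseteq> S}\<rparr>"

text \<open>The common form of all reductions. \<open>\<mu>\<close> reserves clashes for what is put
  back later. Truncation at \<open>-1\<close> keeps the configuration well formed and allows nothing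
  new, since every negative capacity forbids its node.\<close>

definition modify ::
  "'a config \<Rightarrow> 'a set \<Rightarrow> 'a set set \<Rightarrow> nat set \<Rightarrow> ('a \<Rightarrow> bool \<Rightarrow> nat) \<Rightarrow> nat set \<Rightarrow> (nat \<Rightarrow> 'a set)
     \<Rightarrow> (nat \<Rightarrow> bool) \<Rightarrow> 'a config" where
  "modify C X Rf Rh \<mu> K hn hg =
     \<lparr>cvs = cvs C - X, ces = {e \<in> ces C - Rf. e \<inter> X = {}}, csg = csg C,
      chs = {k \<in> chs C - Rh. che C k \<inter> X = {}} \<union> K,
      che = (\<lambda>k. if k \<in> K then hn k else che C k),
      chsg = (\<lambda>k. if k \<in> K then hg k else chsg C k),
      ccp = (\<lambda>v b. max (-1) (ccp C v b - int (\<mu> v b)))\<rparr>"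

definition conf_wf :: "nat \<Rightarrow> nat \<Rightarrow> 'a config \<Rightarrow> bool" where
  "conf_wf i j C \<longleftrightarrow> finite (cvs C) \<and> finite (chs C) \<and>
     (\<forall>e\<in>ces C. e \<subseteq> cvs C \<and> card e = 2) \<and> (\<forall>k\<in>chs C. che C k \<subseteq> cvs C \<and> card (che C k) = 2) \<and>
     (\<forall>v\<in>cvs C. - 1 \<le> ccp C v False \<and> ccp C v False \<le> int i \<and> - 1 \<le> ccp C v True \<and> ccp C v True \<le> int j)"

text \<open>Normalised so that capacities \<open>i\<close> and \<open>j\<close> give
  \<open>2 * i + 1\<close>, the coefficient of the number of vertices in the edge bound, and so that
  a single vertex passes the test in \<open>sparse\<close> unless both of its nodes are
  forbidden.\<close>

definition wgt :: "nat \<Rightarrow> nat \<Rightarrow> 'a config \<Rightarrow> 'a \<Rightarrow> int" where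
  "wgt i j C v = int i - int j + 1 + ccp C v False + ccp C v True"

definition pot :: "nat \<Rightarrow> nat \<Rightarrow> 'a config \<Rightarrow> 'a set \<Rightarrow> int" where
  "pot i j C A = (\<Sum>v\<in>A. wgt i j C v) - (int i + 1) * int (card {e \<in> ces C. e \<subseteq> A})
     - int (card {k \<in> chs C. che C k \<subseteq> A})"

definition sparse :: "nat \<Rightarrow> nat \<Rightarrow> 'a config \<Rightarrow> bool" where
  "sparse i j C \<longleftrightarrow> (\<forall>A. A \<subseteq> cvs C \<longrightarrow> A \<noteq> {} \<longrightarrow> int i - int j \<le> pot i j C A)"

section \<open>Elementary facts on clashes and on the potential\<close>

lemma clash_flip:
  assumes "card e = 2" "x \<in> e"
  shows "clash (\<phi>(x := b)) s e \<longleftrightarrow> \<not> clash (\<phi>(x := \<not> b)) s e"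
proof -
  obtain u v where "e = {u, v}" "u \<noteq> v"
    using assms(1) by (meson card_2_iff)
  then show ?thesis
    using assms(2) by (auto simp: clash_def)
qed

lemma clash_cong:
  assumes "\<And>v. v \<in> e \<Longrightarrow> \<phi> v = \<psi> v"
  shows "clash \<phi> s e = clash \<psi> s e"
proof -
  have "(\<forall>u\<in>e. \<forall>v\<in>e. \<phi> u = \<phi> v) = (\<forall>u\<in>e. \<forall>v\<in>e. \<psi> u = \<psi> v)"
    by (metis assms)
  then show ?thesis unfolding clash_def by simp
qed

lemma clash_upd_notin [simp]: "x \<notin> e \<Longrightarrow> clash (\<phi>(x := b)) s e = clash \<phi> s e"
  by (rule clash_cong) auto

lemma clash_insert:
  "x \<noteq> y \<Longrightarrow> clash \<phi> s {x, y} \<longleftrightarrow> (\<phi> x = \<phi> y) = s"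
  by (auto simp: clash_def)

lemma card2_other:
  assumes "card e = 2" "x \<in> e"
  obtains y where "y \<noteq> x" "e = {x, y}"
proof -
  obtain u v where "e = {u, v}" "u \<noteq> v"
    using assms(1) by (meson card_2_iff)
  moreover have "x = u \<or> x = v"
    using calculation(1) assms(2) by simp
  ultimately have "(x = u \<and> v \<noteq> x \<and> e = {x, v}) \<or> (x = v \<and> u \<noteq> x \<and> e = {x, u})"
    by (metis insert_commute)
  then show ?thesis
    using that by blast
qed

lemma wf_finite_es: "conf_wf i j C \<Longrightarrow> finite (ces C)"
  unfolding conf_wf_def by (meson PowI finite_Pow_iff finite_subset subsetI)

lemma wf_D:
  assumes "conf_wf i j C"
  shows "finite (cvs C)" "finite (chs C)" "finite (ces C)"
    and "e \<in> ces C \<Longrightarrow> e \<subseteq> cvs C" "e \<in> ces C \<Longrightarrow> card e = 2"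
    and "k \<in> chs C \<Longrightarrow> che C k \<subseteq> cvs C" "k \<in> chs C \<Longrightarrow> card (che C k) = 2"
    and "v \<in> cvs C \<Longrightarrow> - 1 \<le> ccp C v b"
    and "v \<in> cvs C \<Longrightarrow> ccp C v False \<le> int i" "v \<in> cvs C \<Longrightarrow> ccp C v True \<le> int j"
  using assms wf_finite_es[OF assms] unfolding conf_wf_def by (cases b; auto)+

lemma restr_simps [simp]:
  "cvs (restr C S) = S" "ces (restr C S) = {e \<in> ces C. e \<subseteq> S}" "csg (restr C S) = csg C"
  "chs (restr C S) = {k \<in> chs C. che C k \<subseteq> S}" "che (restr C S) = che C"
  "chsg (restr C S) = chsg C" "ccp (restr C S) = ccp C"
  by (auto simp: restr_def)

lemma modify_simps [simp]:
  "cvs (modify C X Rf Rh \<mu> K hn hg) = cvs C - X"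
  "ces (modify C X Rf Rh \<mu> K hn hg) = {e \<in> ces C - Rf. e \<inter> X = {}}"
  "csg (modify C X Rf Rh \<mu> K hn hg) = csg C"
  "chs (modify C X Rf Rh \<mu> K hn hg) = {k \<in> chs C - Rh. che C k \<inter> X = {}} \<union> K"
  "che (modify C X Rf Rh \<mu> K hn hg) = (\<lambda>k. if k \<in> K then hn k else che C k)"
  "chsg (modify C X Rf Rh \<mu> K hn hg) = (\<lambda>k. if k \<in> K then hg k else chsg C k)"
  "ccp (modify C X Rf Rh \<mu> K hn hg) = (\<lambda>v b. max (-1) (ccp C v b - int (\<mu> v b)))"
  by (auto simp: modify_def)

lemma wf_restr: "conf_wf i j C \<Longrightarrow> S \<subseteq> cvs C \<Longrightarrow> conf_wf i j (restr C S)"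
  unfolding conf_wf_def by (auto intro: finite_subset)

lemma pot_restr: "A \<subseteq> S \<Longrightarrow> pot i j (restr C S) A = pot i j C A"
proof -
  assume "A \<subseteq> S"
  then have "{e \<in> ces (restr C S). e \<subseteq> A} = {e \<in> ces C. e \<subseteq> A}"
    "{k \<in> chs (restr C S). che (restr C S) k \<subseteq> A} = {k \<in> chs C. che C k \<subseteq> A}"
    by auto
  then show ?thesis
    unfolding pot_def wgt_def by simp
qed

lemma sparse_restr: "sparse i j C \<Longrightarrow> S \<subseteq> cvs C \<Longrightarrow> sparse i j (restr C S)"
  unfolding sparse_def by (auto simp: pot_restr)

lemma wf_modify:
  assumes "conf_wf i j C" "finite K" "\<And>k. k \<in> K \<Longrightarrow> hn k \<subseteq> cvs C - X \<and> card (hn k) = 2"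
  shows "conf_wf i j (modify C X Rf Rh \<mu> K hn hg)"
proof -
  have "max (- 1) (ccp C v False - int (\<mu> v False)) \<le> int i"
    "max (- 1) (ccp C v True - int (\<mu> v True)) \<le> int j" if "v \<in> cvs C" for v
    using wf_D(9,10)[OF assms(1) that] by linarith+
  then show ?thesis
    using assms unfolding conf_wf_def by auto
qed

lemma pot_single:
  assumes "conf_wf i j C"
  shows "pot i j C {v} = wgt i j C v"
proof -
  have "\<not> e \<subseteq> {v}" if "card e = 2" for e :: "'a set"
    using that card_mono[of "{v}" e] by auto
  then have 1: "{e \<in> ces C. e \<subseteq> {v}} = {}" and 2: "{k \<in> chs C. che C k \<subseteq> {v}} = {}"
    using assms unfolding conf_wf_def by blast+
  show ?thesis unfolding pot_def 1 2 by simp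
qed

lemma pot_insert:
  assumes "conf_wf i j C" "finite A" "x \<notin> A"
  shows "pot i j C (insert x A) = pot i j C A + wgt i j C x
     - (int i + 1) * int (card {e \<in> fulls C x. e \<subseteq> insert x A})
     - int (card {k \<in> halves C x. che C k \<subseteq> insert x A})"
proof -
  have "{e \<in> ces C. e \<subseteq> insert x A} = {e \<in> ces C. e \<subseteq> A} \<union> {e \<in> fulls C x. e \<subseteq> insert x A}"
    by (auto simp: fulls_def)
  moreover have "{e \<in> ces C. e \<subseteq> A} \<inter> {e \<in> fulls C x. e \<subseteq> insert x A} = {}"
    using assms(3) by (auto simp: fulls_def)
  ultimately have 1: "card {e \<in> ces C. e \<subseteq> insert x A} =
      card {e \<in> ces C. e \<subseteq> A} + card {e \<in> fulls C x. e \<subseteq> insert x A}"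
    using wf_D(3)[OF assms(1)] by (simp add: card_Un_disjoint fulls_def)
  have "{k \<in> chs C. che C k \<subseteq> insert x A} =
      {k \<in> chs C. che C k \<subseteq> A} \<union> {k \<in> halves C x. che C k \<subseteq> insert x A}"
    by (auto simp: halves_def)
  moreover have "{k \<in> chs C. che C k \<subseteq> A} \<inter> {k \<in> halves C x. che C k \<subseteq> insert x A} = {}"
    using assms(3) by (auto simp: halves_def)
  ultimately have 2: "card {k \<in> chs C. che C k \<subseteq> insert x A} =
      card {k \<in> chs C. che C k \<subseteq> A} + card {k \<in> halves C x. che C k \<subseteq> insert x A}"
    using wf_D(2)[OF assms(1)] by (simp add: card_Un_disjoint halves_def)
  show ?thesis
    unfolding pot_def 1 2 using assms(2,3) by (simp add: algebra_simps)
qed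

lemma card_subset_supermodular:
  assumes "finite E"
  shows "card {e \<in> E. g e \<subseteq> A} + card {e \<in> E. g e \<subseteq> B}
    \<le> card {e \<in> E. g e \<subseteq> A \<union> B} + card {e \<in> E. g e \<subseteq> A \<inter> B}"
proof -
  let ?A = "{e \<in> E. g e \<subseteq> A}" and ?B = "{e \<in> E. g e \<subseteq> B}"
  have "card ?A + card ?B = card (?A \<union> ?B) + card (?A \<inter> ?B)"
    using assms by (intro card_Un_Int) auto
  moreover have "card (?A \<union> ?B) \<le> card {e \<in> E. g e \<subseteq> A \<union> B}"
    using assms by (intro card_mono) auto
  moreover have "?A \<inter> ?B = {e \<in> E. g e \<subseteq> A \<inter> B}" by auto
  ultimately show ?thesis by simp
qed

lemma pot_submodular:
  assumes "conf_wf i j C" "finite A" "finite B"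
  shows "pot i j C (A \<union> B) + pot i j C (A \<inter> B) \<le> pot i j C A + pot i j C B"
proof -
  have 1: "(\<Sum>v\<in>A \<union> B. wgt i j C v) + (\<Sum>v\<in>A \<inter> B. wgt i j C v)
    = (\<Sum>v\<in>A. wgt i j C v) + (\<Sum>v\<in>B. wgt i j C v)"
    using assms by (intro sum.union_inter) auto
  have 2: "int (card {e \<in> ces C. e \<subseteq> A}) + int (card {e \<in> ces C. e \<subseteq> B})
    \<le> int (card {e \<in> ces C. e \<subseteq> A \<union> B}) + int (card {e \<in> ces C. e \<subseteq> A \<inter> B})"
    using card_subset_supermodular[OF wf_D(3)[OF assms(1)], of "\<lambda>e. e" A B] by linarith
  have 3: "int (card {k \<in> chs C. che C k \<subseteq> A}) + int (card {k \<in> chs C. che C k \<subseteq> B})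
    \<le> int (card {k \<in> chs C. che C k \<subseteq> A \<union> B}) + int (card {k \<in> chs C. che C k \<subseteq> A \<inter> B})"
    using card_subset_supermodular[OF wf_D(2)[OF assms(1)], of "che C" A B] by linarith
  have "(int i + 1) * (int (card {e \<in> ces C. e \<subseteq> A}) + int (card {e \<in> ces C. e \<subseteq> B}))
    \<le> (int i + 1) * (int (card {e \<in> ces C. e \<subseteq> A \<union> B}) + int (card {e \<in> ces C. e \<subseteq> A \<inter> B}))"
    using 2 by (intro mult_left_mono) auto
  then show ?thesis
    unfolding pot_def using 1 3 by (simp add: algebra_simps)
qed

lemma pot_empty [simp]: "conf_wf i j C \<Longrightarrow> pot i j C {} = 0"
proof -
  assume a: "conf_wf i j C"
  then have 1: "{e \<in> ces C. e \<subseteq> {}} = {}" and 2: "{k \<in> chs C. che C k \<subseteq> {}} = {}"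
    by (auto simp: conf_wf_def)
  show ?thesis unfolding pot_def 1 2 by simp
qed

text \<open>Only an inequality: truncation may leave more capacity than the subtraction, and deleted
  full edges are not credited.\<close>

lemma pot_modify:
  assumes "conf_wf i j C" "A \<subseteq> cvs C" "finite K" "K \<inter> chs C = {}"
  shows "pot i j (modify C X Rf Rh \<mu> K hn hg) A \<ge> pot i j C A
    - (\<Sum>v\<in>A. int (\<mu> v False) + int (\<mu> v True)) - int (card {k \<in> K. hn k \<subseteq> A})
    + int (card {k \<in> Rh \<inter> chs C. che C k \<subseteq> A})"
proof -
  let ?M = "modify C X Rf Rh \<mu> K hn hg"
  have fin: "finite (chs C)" "finite (ces C)"
    using wf_D[OF assms(1)] by auto
  have "card {e \<in> ces ?M. e \<subseteq> A} \<le> card {e \<in> ces C. e \<subseteq> A}"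
    using fin by (intro card_mono) auto
  then have 1: "(int i + 1) * int (card {e \<in> ces ?M. e \<subseteq> A}) \<le> (int i + 1) * int (card {e \<in> ces C. e \<subseteq> A})"
    by (intro mult_left_mono) auto
  have sub: "{k \<in> chs ?M. che ?M k \<subseteq> A} \<subseteq>
      ({k \<in> chs C. che C k \<subseteq> A} - {k \<in> Rh \<inter> chs C. che C k \<subseteq> A}) \<union> {k \<in> K. hn k \<subseteq> A}"
    using assms(4) by auto
  have "card {k \<in> chs ?M. che ?M k \<subseteq> A} \<le>
      card ({k \<in> chs C. che C k \<subseteq> A} - {k \<in> Rh \<inter> chs C. che C k \<subseteq> A}) + card {k \<in> K. hn k \<subseteq> A}"
    by (rule le_trans[OF card_mono[OF _ sub] card_Un_le]) (use fin assms(3) in auto)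
  also have "card ({k \<in> chs C. che C k \<subseteq> A} - {k \<in> Rh \<inter> chs C. che C k \<subseteq> A}) =
      card {k \<in> chs C. che C k \<subseteq> A} - card {k \<in> Rh \<inter> chs C. che C k \<subseteq> A}"
    using fin by (intro card_Diff_subset) auto
  finally have 2: "card {k \<in> chs ?M. che ?M k \<subseteq> A} \<le> card {k \<in> chs C. che C k \<subseteq> A}
      - card {k \<in> Rh \<inter> chs C. che C k \<subseteq> A} + card {k \<in> K. hn k \<subseteq> A}" .
  have "card {k \<in> Rh \<inter> chs C. che C k \<subseteq> A} \<le> card {k \<in> chs C. che C k \<subseteq> A}"
    using fin by (intro card_mono) auto
  with 2 have 2: "card {k \<in> chs ?M. che ?M k \<subseteq> A} + card {k \<in> Rh \<inter> chs C. che C k \<subseteq> A}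
      \<le> card {k \<in> chs C. che C k \<subseteq> A} + card {k \<in> K. hn k \<subseteq> A}"
    by linarith
  have "wgt i j C v - (int (\<mu> v False) + int (\<mu> v True)) \<le> wgt i j ?M v" for v
    unfolding wgt_def by (simp add: max_def)
  then have "(\<Sum>v\<in>A. wgt i j C v - (int (\<mu> v False) + int (\<mu> v True))) \<le> (\<Sum>v\<in>A. wgt i j ?M v)"
    by (intro sum_mono)
  then have "(\<Sum>v\<in>A. wgt i j C v) - (\<Sum>v\<in>A. int (\<mu> v False) + int (\<mu> v True)) \<le> (\<Sum>v\<in>A. wgt i j ?M v)"
    by (simp only: sum_subtractf)
  then show ?thesis
    unfolding pot_def using 1 2 by linarith
qed

text \<open>Recolouring \<open>x\<close> toggles every edge at \<open>x\<close>, so each edge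
  clashes with exactly one of its two nodes. The degree bounds below arise by adding up what fails
  for the two nodes.\<close>

lemma full_clashes_split:
  assumes "conf_wf i j C" "x \<in> cvs C"
  shows "card (full_clashes C (\<phi>(x := b)) x) + card (full_clashes C (\<phi>(x := \<not> b)) x) = card (fulls C x)"
proof -
  have fl: "clash (\<phi>(x := b)) s e \<longleftrightarrow> \<not> clash (\<phi>(x := \<not> b)) s e" if "e \<in> ces C" "x \<in> e" for e s
    using clash_flip[OF wf_D(5)[OF assms(1) that(1)] that(2)] by metis
  have "fulls C x = full_clashes C (\<phi>(x := b)) x \<union> full_clashes C (\<phi>(x := \<not> b)) x"
    using fl by (auto simp: fulls_def full_clashes_def)
  moreover have "full_clashes C (\<phi>(x := b)) x \<inter> full_clashes C (\<phi>(x := \<not> b)) x = {}"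
    using fl by (auto simp: full_clashes_def)
  ultimately show ?thesis
    using wf_D(3)[OF assms(1)] by (simp add: card_Un_disjoint full_clashes_def)
qed

lemma half_clashes_split:
  assumes "conf_wf i j C" "x \<in> cvs C"
  shows "card (half_clashes C (\<phi>(x := b)) x) + card (half_clashes C (\<phi>(x := \<not> b)) x) = card (halves C x)"
proof -
  have fl: "clash (\<phi>(x := b)) s (che C k) \<longleftrightarrow> \<not> clash (\<phi>(x := \<not> b)) s (che C k)"
    if "k \<in> chs C" "x \<in> che C k" for k s
    using clash_flip[OF wf_D(7)[OF assms(1) that(1)] that(2)] by metis
  have "halves C x = half_clashes C (\<phi>(x := b)) x \<union> half_clashes C (\<phi>(x := \<not> b)) x"
    using fl by (auto simp: halves_def half_clashes_def)
  moreover have "half_clashes C (\<phi>(x := b)) x \<inter> half_clashes C (\<phi>(x := \<not> b)) x = {}"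
    using fl by (auto simp: half_clashes_def)
  ultimately show ?thesis
    using wf_D(2)[OF assms(1)] by (simp add: card_Un_disjoint half_clashes_def)
qed

lemma finite_clashes:
  assumes "conf_wf i j C"
  shows "finite (full_clashes C \<phi> v)" "finite (half_clashes C \<phi> v)" "finite (half_hits C \<phi> \<omega> v)"
    "finite (fulls C v)" "finite (halves C v)"
  using wf_D[OF assms] by (auto simp: full_clashes_def half_clashes_def half_hits_def fulls_def halves_def)

text \<open>\<open>P\<close> is the set of half-edges at the new vertex \<open>x\<close> that are charged to their other end.\<close>

lemma extend_col:
  fixes C :: "'a config" and \<mu> :: "'a \<Rightarrow> bool \<Rightarrow> nat"
  assumes wf: "conf_wf i j C" and x: "x \<in> cvs C" and K: "finite K" "K \<inter> chs C = {}"
    and col: "col {} (modify C {x} {} {} \<mu> K hn hg) \<phi> \<omega>"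
    and P: "P \<subseteq> half_clashes C (\<phi>(x := n)) x"
    and others: "\<And>y. y \<in> cvs C \<Longrightarrow> y \<noteq> x \<Longrightarrow> y \<notin> Q \<Longrightarrow>
      card {e \<in> full_clashes C (\<phi>(x := n)) x. y \<in> e} + card {k \<in> P. y \<in> che C k}
        \<le> \<mu> y (\<phi> y) + card {k \<in> K. \<omega> k = y \<and> clash \<phi> (hg k) (hn k)}"
    and self: "int (card (full_clashes C (\<phi>(x := n)) x) + card (half_clashes C (\<phi>(x := n)) x) - card P)
        \<le> ccp C x n"
  shows "\<exists>\<omega>'. col Q C (\<phi>(x := n)) \<omega>'"
proof -
  let ?M = "modify C {x} {} {} \<mu> K hn hg"
  let ?\<phi> = "\<phi>(x := n)"
  define \<omega>' where "\<omega>' k = (if k \<in> P then (SOME y. y \<in> che C k \<and> y \<noteq> x)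
     else if x \<in> che C k then x else \<omega> k)" for k
  note fin = wf_D[OF wf]
  have PH: "k \<in> chs C" "x \<in> che C k" if "k \<in> P" for k
    using P that by (auto simp: half_clashes_def)
  have other: "\<omega>' k \<in> che C k \<and> \<omega>' k \<noteq> x \<and> (\<forall>y. y \<noteq> x \<longrightarrow> (y \<in> che C k \<longleftrightarrow> \<omega>' k = y))" if kP: "k \<in> P" for k
  proof -
    obtain y where "y \<noteq> x" "che C k = {x, y}"
      using card2_other[OF fin(7)[OF PH(1)[OF kP]] PH(2)[OF kP]] by blast
    then have "\<omega>' k = y" using kP by (auto simp: \<omega>'_def)
    then show ?thesis using \<open>che C k = {x, y}\<close> \<open>y \<noteq> x\<close> by auto
  qed
  have \<omega>M: "\<omega> k \<in> che C k" if "k \<in> chs C" "x \<notin> che C k" for k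
  proof -
    have "k \<in> chs ?M" "k \<notin> K" using that K(2) by auto
    then show ?thesis using col unfolding col_def by fastforce
  qed
  have "\<omega>' k \<in> che C k" if "k \<in> chs C" for k
    using that other[of k] \<omega>M[of k] by (auto simp: \<omega>'_def)
  moreover have "int (card (full_clashes C ?\<phi> v) + card (half_hits C ?\<phi> \<omega>' v)) \<le> ccp C v (?\<phi> v)"
    if v: "v \<in> cvs C" "v \<notin> Q" for v
  proof (cases "v = x")
    case True
    have "half_hits C ?\<phi> \<omega>' x = half_clashes C ?\<phi> x - P"
    proof (rule set_eqI)
      fix k
      show "k \<in> half_hits C ?\<phi> \<omega>' x \<longleftrightarrow> k \<in> half_clashes C ?\<phi> x - P"
        using other[of k] \<omega>M[of k] by (auto simp: half_hits_def half_clashes_def \<omega>'_def)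
    qed
    then have "card (half_hits C ?\<phi> \<omega>' x) = card (half_clashes C ?\<phi> x) - card P"
      using P finite_clashes(2)[OF wf] by (simp add: card_Diff_subset finite_subset)
    moreover have "card P \<le> card (half_clashes C ?\<phi> x)"
      using P finite_clashes(2)[OF wf] by (simp add: card_mono)
    ultimately show ?thesis
      using self True by (simp add: algebra_simps)
  next
    case False
    let ?F = "{e \<in> full_clashes C ?\<phi> x. v \<in> e}" and ?P = "{k \<in> P. v \<in> che C k}"
    let ?K = "{k \<in> K. \<omega> k = v \<and> clash \<phi> (hg k) (hn k)}"
    let ?H = "{k \<in> chs C. x \<notin> che C k \<and> \<omega> k = v \<and> clash \<phi> (chsg C k) (che C k)}"
    have 1: "full_clashes C ?\<phi> v = full_clashes ?M \<phi> v \<union> ?F"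
      using clash_upd_notin[of x] by (auto simp: full_clashes_def)
    have 2: "half_hits C ?\<phi> \<omega>' v = ?H \<union> ?P"
    proof (rule set_eqI)
      fix k
      show "k \<in> half_hits C ?\<phi> \<omega>' v \<longleftrightarrow> k \<in> ?H \<union> ?P"
        using other[of k] False PH[of k] P clash_upd_notin[of x "che C k"]
        by (auto simp: half_hits_def half_clashes_def \<omega>'_def)
    qed
    have 3: "half_hits ?M \<phi> \<omega> v = ?H \<union> ?K"
      using K(2) by (auto simp: half_hits_def)
    have "?H \<inter> ?K = {}" using K(2) by auto
    then have 4: "card (half_hits ?M \<phi> \<omega> v) = card ?H + card ?K"
      unfolding 3 using fin(2) K(1) by (intro card_Un_disjoint) auto
    have "int (card (full_clashes ?M \<phi> v) + card (half_hits ?M \<phi> \<omega> v)) \<le> ccp ?M v (\<phi> v)"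
      using col v False unfolding col_def by auto
    then have 5: "int (card (full_clashes ?M \<phi> v) + (card ?H + card ?K)) \<le> ccp C v (\<phi> v) - int (\<mu> v (\<phi> v))"
      unfolding 4 by (simp add: max_def split: if_splits)
    have "card (full_clashes C ?\<phi> v) \<le> card (full_clashes ?M \<phi> v) + card ?F"
      unfolding 1 by (rule card_Un_le)
    moreover have "card (half_hits C ?\<phi> \<omega>' v) \<le> card ?H + card ?P"
      unfolding 2 by (rule card_Un_le)
    \<comment> \<open>The half-edges of \<open>K\<close> are absent from \<open>C\<close>. The
      clashes that they charged to \<open>v\<close>, together with the reserve \<open>\<mu>\<close>,
      make room for the new clashes with \<open>x\<close>.\<close>
    ultimately have "int (card (full_clashes C ?\<phi> v) + card (half_hits C ?\<phi> \<omega>' v)) \<le> ccp C v (\<phi> v)"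
      using 5 others[OF v(1) False v(2)] by linarith
    then show ?thesis using False by simp
  qed
  ultimately have "col Q C ?\<phi> \<omega>'"
    unfolding col_def by blast
  then show ?thesis by blast
qed

section \<open>Contraction of a coloured set\<close>

definition cut_full :: "'a config \<Rightarrow> 'a set \<Rightarrow> ('a \<Rightarrow> bool) \<Rightarrow> 'a \<Rightarrow> bool \<Rightarrow> 'a set set" where
  "cut_full C S \<phi> x b = {e \<in> ces C. x \<in> e \<and> e \<subseteq> insert x S \<and> clash (\<phi>(x := b)) (csg C e) e}"

definition cut_half :: "'a config \<Rightarrow> 'a set \<Rightarrow> ('a \<Rightarrow> bool) \<Rightarrow> 'a \<Rightarrow> bool \<Rightarrow> nat set" where
  "cut_half C S \<phi> x b =
     {k \<in> chs C. x \<in> che C k \<and> che C k \<subseteq> insert x S \<and> clash (\<phi>(x := b)) (chsg C k) (che C k)}"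

text \<open>The coloured set \<open>S\<close> shrinks to a single vertex \<open>u\<close> that must be rich and tolerates no clash.
  Edges from \<open>S\<close> that clash with the rich node of \<open>x\<close> become one edge \<open>{u, x}\<close>, those that clash with the
  poor node of \<open>x\<close> delete this node; in both cases the loss of potential at \<open>x\<close> is at most the price
  \<open>i + 1\<close> of one edge.\<close>

definition contract :: "'a config \<Rightarrow> 'a set \<Rightarrow> 'a \<Rightarrow> ('a \<Rightarrow> bool) \<Rightarrow> 'a config" where
  "contract C S u \<phi> =
     \<lparr>cvs = insert u (cvs C - S),
      ces = {e \<in> ces C. e \<inter> S = {}} \<union> (\<lambda>x. {u, x}) ` {x \<in> cvs C - S. cut_full C S \<phi> x True \<noteq> {}},
      csg = (\<lambda>e. if u \<in> e then True else csg C e),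
      chs = {k \<in> chs C. che C k \<inter> S = {}},
      che = che C, chsg = chsg C,
      ccp = (\<lambda>v b. if v = u then (if b then 0 else -1)
        else if \<not> b \<and> cut_full C S \<phi> v False \<noteq> {} then -1
        else max (-1) (ccp C v b - int (card (cut_half C S \<phi> v b))))\<rparr>"

lemma contract_simps [simp]:
  "cvs (contract C S u \<phi>) = insert u (cvs C - S)"
  "ces (contract C S u \<phi>) =
     {e \<in> ces C. e \<inter> S = {}} \<union> (\<lambda>x. {u, x}) ` {x \<in> cvs C - S. cut_full C S \<phi> x True \<noteq> {}}"
  "csg (contract C S u \<phi>) = (\<lambda>e. if u \<in> e then True else csg C e)"
  "chs (contract C S u \<phi>) = {k \<in> chs C. che C k \<inter> S = {}}"
  "che (contract C S u \<phi>) = che C" "chsg (contract C S u \<phi>) = chsg C"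
  "ccp (contract C S u \<phi>) v b = (if v = u then (if b then 0 else -1)
        else if \<not> b \<and> cut_full C S \<phi> v False \<noteq> {} then -1
        else max (-1) (ccp C v b - int (card (cut_half C S \<phi> v b))))"
  by (auto simp: contract_def)

lemma wf_contract:
  assumes "conf_wf i j C" "S \<subseteq> cvs C" "u \<in> S"
  shows "conf_wf i j (contract C S u \<phi>)"
proof -
  note D = wf_D[OF assms(1)]
  have 1: "e \<subseteq> insert u (cvs C - S) \<and> card e = 2" if eD: "e \<in> ces (contract C S u \<phi>)" for e
  proof -
    consider "e \<in> ces C" "e \<inter> S = {}" | x where "x \<in> cvs C - S" "e = {u, x}"
      using eD by auto
    then show ?thesis
    proof cases
      case 1 then show ?thesis using D(4,5)[of e] by auto
    next
      case 2
      then have "u \<noteq> x" using assms(3) by auto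
      then show ?thesis using 2 by auto
    qed
  qed
  have 2: "che C k \<subseteq> insert u (cvs C - S) \<and> card (che C k) = 2" if "k \<in> chs (contract C S u \<phi>)" for k
    using that D(6,7)[of k] by auto
  have 3: "- 1 \<le> ccp (contract C S u \<phi>) v False \<and> ccp (contract C S u \<phi>) v False \<le> int i
      \<and> - 1 \<le> ccp (contract C S u \<phi>) v True \<and> ccp (contract C S u \<phi>) v True \<le> int j"
    if "v \<in> insert u (cvs C - S)" for v
    using that D(9)[of v] D(10)[of v] by (auto simp: max_def)
  show ?thesis
    unfolding conf_wf_def using 1 2 3 D(1,2) by simp
qed

lemma contract_colorable:
  assumes wf: "conf_wf i j C" and S: "S \<subseteq> cvs C" "u \<in> S"
    and col: "col {} (restr C S) \<phi> \<omega>" and con: "conf_colorable (contract C S u \<phi>)"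
  shows "conf_colorable C"
proof -
  let ?D = "contract C S u \<phi>"
  note D = wf_D[OF wf]
  obtain \<psi> \<nu> where c: "col {} ?D \<psi> \<nu>"
    using con unfolding conf_colorable_def by blast
  define \<theta> where "\<theta> v = (if v \<in> S then \<phi> v else \<psi> v)" for v
  \<comment> \<open>A half-edge leaving \<open>S\<close> is charged to its outer end, whose
    capacities \<open>cut_half\<close> has lowered in advance, so \<open>S\<close> receives no
    additional charge.\<close>
  define \<kappa> where "\<kappa> k = (if che C k \<subseteq> S then \<omega> k else if che C k \<inter> S = {} then \<nu> k
    else (SOME y. y \<in> che C k \<and> y \<notin> S))" for k
  have capu: "int (card (full_clashes ?D \<psi> u) + card (half_hits ?D \<psi> \<nu> u)) \<le> (if \<psi> u then 0 else -1)"
    using c unfolding col_def by auto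
  then have \<psi>u: "\<psi> u" by (auto split: if_splits)
  have fu: "full_clashes ?D \<psi> u = {}"
  proof -
    have "card (full_clashes ?D \<psi> u) = 0" using capu \<psi>u by simp
    then show ?thesis using finite_clashes(1)[OF wf_contract[OF wf S]] by simp
  qed
  have capx: "int (card (full_clashes ?D \<psi> x) + card (half_hits ?D \<psi> \<nu> x)) \<le> ccp ?D x (\<psi> x)"
    if "x \<in> cvs C - S" for x
    using c that unfolding col_def by auto
  have nocut: "cut_full C S \<phi> x (\<psi> x) = {}" if x: "x \<in> cvs C - S" for x
  proof (cases "\<psi> x")
    case True
    show ?thesis
    proof (rule ccontr)
      assume "cut_full C S \<phi> x (\<psi> x) \<noteq> {}"
      then have "{u, x} \<in> ces ?D" using x True by auto
      moreover have "u \<noteq> x" using S(2) x by auto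
      then have "clash \<psi> (csg ?D {u, x}) {u, x}"
        using \<psi>u True by (simp add: clash_insert)
      ultimately have "{u, x} \<in> full_clashes ?D \<psi> u" by (auto simp: full_clashes_def)
      then show False using fu by simp
    qed
  next
    case False
    have "x \<noteq> u" using x S(2) by auto
    then show ?thesis using capx[OF x] False by (auto split: if_splits)
  qed
  have \<kappa>: "\<kappa> k \<in> che C k" if "k \<in> chs C" for k
  proof (cases "che C k \<subseteq> S \<or> che C k \<inter> S = {}")
    case True
    then show ?thesis
      using col c that D(7)[OF that] unfolding col_def \<kappa>_def by auto
  next
    case False
    then have "\<exists>y. y \<in> che C k \<and> y \<notin> S" by auto
    then show ?thesis using False someI_ex[of "\<lambda>y. y \<in> che C k \<and> y \<notin> S"] by (auto simp: \<kappa>_def)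
  qed
  have \<kappa>cut: "\<kappa> k \<notin> S" if "k \<in> chs C" "\<not> che C k \<subseteq> S" for k
  proof (cases "che C k \<inter> S = {}")
    case True then show ?thesis using \<kappa>[OF that(1)] by auto
  next
    case False
    have "\<exists>y. y \<in> che C k \<and> y \<notin> S" using that by auto
    then show ?thesis using False that someI_ex[of "\<lambda>y. y \<in> che C k \<and> y \<notin> S"] by (auto simp: \<kappa>_def)
  qed
  have sub: "e \<subseteq> insert x S" if "card e = 2" "x \<in> e" "e \<inter> S \<noteq> {}" "x \<notin> S" for e x
    using card2_other[OF that(1,2)] that(3,4) by blast
  have cutclash: "clash \<theta> s e = clash (\<phi>(x := \<psi> x)) s e" if "e \<subseteq> insert x S" "x \<notin> S" for e x s
    using that by (intro clash_cong) (auto simp: \<theta>_def)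
  have inS: "clash \<theta> s e = clash \<phi> s e" if "e \<subseteq> S" for e s
    using that by (intro clash_cong) (auto simp: \<theta>_def)
  have outS: "clash \<theta> s e = clash \<psi> s e" if "e \<inter> S = {}" for e s
    using that by (intro clash_cong) (auto simp: \<theta>_def)
  have "int (card (full_clashes C \<theta> v) + card (half_hits C \<theta> \<kappa> v)) \<le> ccp C v (\<theta> v)" if v: "v \<in> cvs C" for v
  proof (cases "v \<in> S")
    case True
    have "e \<subseteq> S" if e: "e \<in> ces C" "v \<in> e" "clash \<theta> (csg C e) e" for e
    proof (rule ccontr)
      assume "\<not> e \<subseteq> S"
      then obtain x where x: "x \<in> e" "x \<notin> S" by auto
      then have "x \<in> cvs C - S" using D(4)[OF e(1)] by auto
      moreover have "e \<subseteq> insert x S" using sub[OF D(5)[OF e(1)] x(1) _ x(2)] e(2) True by auto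
      ultimately have "e \<in> cut_full C S \<phi> x (\<psi> x)"
        using e x cutclash[of e x] by (auto simp: cut_full_def)
      then show False using nocut \<open>x \<in> cvs C - S\<close> by auto
    qed
    then have "full_clashes C \<theta> v = full_clashes (restr C S) \<phi> v"
      unfolding full_clashes_def restr_simps using inS by (intro Collect_cong) (metis mem_Collect_eq)
    moreover have "half_hits C \<theta> \<kappa> v = half_hits (restr C S) \<phi> \<omega> v"
    proof -
      have "che C k \<subseteq> S" if "k \<in> chs C" "\<kappa> k = v" for k
        using \<kappa>cut[OF that(1)] that(2) True by auto
      then have cS: "che C k \<subseteq> S" if "k \<in> chs C" "\<kappa> k = v" for k using that by blast
      show ?thesis
      proof (rule set_eqI)
        fix k
        show "k \<in> half_hits C \<theta> \<kappa> v \<longleftrightarrow> k \<in> half_hits (restr C S) \<phi> \<omega> v"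
        proof (cases "che C k \<subseteq> S")
          case True
          then have "\<kappa> k = \<omega> k" by (simp add: \<kappa>_def)
          then show ?thesis using True inS[OF True, of "chsg C k"] by (simp add: half_hits_def)
        next
          case False
          then show ?thesis using cS[of k] by (auto simp add: half_hits_def)
        qed
      qed
    qed
    ultimately show ?thesis
      using col True unfolding col_def by (auto simp: \<theta>_def)
  next
    case False
    then have vT: "v \<in> cvs C - S" "v \<noteq> u" using v S(2) by auto
    have "e \<inter> S = {}" if e: "e \<in> ces C" "v \<in> e" "clash \<theta> (csg C e) e" for e
    proof (rule ccontr)
      assume "e \<inter> S \<noteq> {}"
      then have "e \<subseteq> insert v S" using sub[OF D(5)[OF e(1)] e(2) _ False] by auto
      then have "e \<in> cut_full C S \<phi> v (\<psi> v)"
        using e False cutclash[of e v] by (auto simp: cut_full_def)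
      then show False using nocut[OF vT(1)] by auto
    qed
    note eS = this
    have "full_clashes C \<theta> v \<subseteq> full_clashes ?D \<psi> v"
    proof
      fix e assume "e \<in> full_clashes C \<theta> v"
      then have e: "e \<in> ces C" "v \<in> e" "clash \<theta> (csg C e) e" by (auto simp: full_clashes_def)
      have "e \<inter> S = {}" by (rule eS[OF e])
      moreover have "u \<notin> e" using \<open>e \<inter> S = {}\<close> S(2) by auto
      ultimately show "e \<in> full_clashes ?D \<psi> v"
        using e outS[of e "csg C e"] by (simp add: full_clashes_def)
    qed
    then have 1: "card (full_clashes C \<theta> v) \<le> card (full_clashes ?D \<psi> v)"
      by (intro card_mono finite_clashes[OF wf_contract[OF wf S]])
    have "half_hits C \<theta> \<kappa> v \<subseteq> half_hits ?D \<psi> \<nu> v \<union> cut_half C S \<phi> v (\<psi> v)"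
    proof
      fix k assume k: "k \<in> half_hits C \<theta> \<kappa> v"
      then have k': "k \<in> chs C" "\<kappa> k = v" "clash \<theta> (chsg C k) (che C k)" by (auto simp: half_hits_def)
      then have vk: "v \<in> che C k" using \<kappa> by auto
      show "k \<in> half_hits ?D \<psi> \<nu> v \<union> cut_half C S \<phi> v (\<psi> v)"
      proof (cases "che C k \<inter> S = {}")
        case True
        moreover have "\<not> che C k \<subseteq> S" using vk False by auto
        ultimately show ?thesis using k' outS[OF True] by (auto simp: half_hits_def \<kappa>_def)
      next
        case F: False
        have "che C k \<subseteq> insert v S" using sub[OF D(7)[OF k'(1)] vk F False] .
        then show ?thesis using k' vk cutclash[of "che C k" v] False by (auto simp: cut_half_def)
      qed
    qed
    then have "card (half_hits C \<theta> \<kappa> v) \<le> card (half_hits ?D \<psi> \<nu> v \<union> cut_half C S \<phi> v (\<psi> v))"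
      using D(2) by (intro card_mono) (auto simp: half_hits_def cut_half_def)
    then have 2: "card (half_hits C \<theta> \<kappa> v) \<le> card (half_hits ?D \<psi> \<nu> v) + card (cut_half C S \<phi> v (\<psi> v))"
      using card_Un_le le_trans by blast
    have "ccp ?D v (\<psi> v) = max (-1) (ccp C v (\<psi> v) - int (card (cut_half C S \<phi> v (\<psi> v))))"
      using nocut[OF vT(1)] vT(2) by auto
    then have "int (card (full_clashes ?D \<psi> v) + card (half_hits ?D \<psi> \<nu> v))
       \<le> ccp C v (\<psi> v) - int (card (cut_half C S \<phi> v (\<psi> v)))"
      using capx[OF vT(1)] by linarith
    then show ?thesis using 1 2 False by (simp add: \<theta>_def)
  qed
  then have "col {} C \<theta> \<kappa>" using \<kappa> unfolding col_def by blast
  then show ?thesis unfolding conf_colorable_def by blast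
qed

text \<open>An edge from \<open>x\<close> to \<open>S\<close> clashes with exactly one node of
  \<open>x\<close>, so the sets belonging to the two nodes are disjoint.\<close>

lemma card_cut_ge:
  assumes "conf_wf i j C" "x \<notin> S"
  shows "(if cut_full C S \<phi> x True \<noteq> {} then 1 else 0) + (if cut_full C S \<phi> x False \<noteq> {} then 1 else 0)
      \<le> card {e \<in> ces C. x \<in> e \<and> e \<subseteq> insert x S}"
    and "card (cut_half C S \<phi> x True) + card (cut_half C S \<phi> x False)
      \<le> card {k \<in> chs C. x \<in> che C k \<and> che C k \<subseteq> insert x S}"
proof -
  note D = wf_D[OF assms(1)]
  have "cut_full C S \<phi> x True \<inter> cut_full C S \<phi> x False = {}"
    using clash_flip[OF D(5), of _ x \<phi> True] by (auto simp: cut_full_def)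
  then have "card (cut_full C S \<phi> x True) + card (cut_full C S \<phi> x False)
      = card (cut_full C S \<phi> x True \<union> cut_full C S \<phi> x False)"
    using D(3) by (simp add: card_Un_disjoint cut_full_def)
  also have "\<dots> \<le> card {e \<in> ces C. x \<in> e \<and> e \<subseteq> insert x S}"
    using D(3) by (intro card_mono) (auto simp: cut_full_def)
  finally have "card (cut_full C S \<phi> x True) + card (cut_full C S \<phi> x False)
      \<le> card {e \<in> ces C. x \<in> e \<and> e \<subseteq> insert x S}" .
  moreover have "(if cut_full C S \<phi> x b \<noteq> {} then 1 else 0) \<le> card (cut_full C S \<phi> x b)" for b
    using D(3) by (simp add: cut_full_def Suc_le_eq card_gt_0_iff)
  ultimately show "(if cut_full C S \<phi> x True \<noteq> {} then 1 else 0) + (if cut_full C S \<phi> x False \<noteq> {} then 1 else 0)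
      \<le> card {e \<in> ces C. x \<in> e \<and> e \<subseteq> insert x S}"
    by (meson add_mono le_trans)
  have "cut_half C S \<phi> x True \<inter> cut_half C S \<phi> x False = {}"
    using clash_flip[OF D(7), of _ x \<phi> True] by (auto simp: cut_half_def)
  then have "card (cut_half C S \<phi> x True) + card (cut_half C S \<phi> x False)
      = card (cut_half C S \<phi> x True \<union> cut_half C S \<phi> x False)"
    using D(2) by (simp add: card_Un_disjoint cut_half_def)
  also have "\<dots> \<le> card {k \<in> chs C. x \<in> che C k \<and> che C k \<subseteq> insert x S}"
    using D(2) by (intro card_mono) (auto simp: cut_half_def)
  finally show "card (cut_half C S \<phi> x True) + card (cut_half C S \<phi> x False)
      \<le> card {k \<in> chs C. x \<in> che C k \<and> che C k \<subseteq> insert x S}" .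
qed

lemma card_cut_sum:
  assumes E: "finite E" "\<And>e. e \<in> E \<Longrightarrow> card (g e) = 2" and T: "finite T" "T \<inter> S = {}"
  shows "card {e \<in> E. g e \<subseteq> S \<union> T} = card {e \<in> E. g e \<subseteq> S} + card {e \<in> E. g e \<subseteq> T}
     + (\<Sum>x\<in>T. card {e \<in> E. x \<in> g e \<and> g e \<subseteq> insert x S})"
proof -
  let ?cut = "\<lambda>x. {e \<in> E. x \<in> g e \<and> g e \<subseteq> insert x S}"
  have "g e \<subseteq> S \<or> g e \<subseteq> T \<or> (\<exists>x\<in>T. x \<in> g e \<and> g e \<subseteq> insert x S)" if eE: "e \<in> E" "g e \<subseteq> S \<union> T" for e
  proof -
    obtain a b where "g e = {a, b}" using E(2)[OF eE(1)] by (meson card_2_iff)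
    then show ?thesis using eE(2) by auto
  qed
  then have eq: "{e \<in> E. g e \<subseteq> S \<union> T} = {e \<in> E. g e \<subseteq> S} \<union> {e \<in> E. g e \<subseteq> T} \<union> (\<Union>x\<in>T. ?cut x)"
    by blast
  have ne: "g e \<noteq> {}" "\<not> g e \<subseteq> {x}" if "e \<in> E" for e x
    using E(2)[OF that] card_mono[of "{x}" "g e"] by auto
  have 1: "{e \<in> E. g e \<subseteq> S} \<inter> {e \<in> E. g e \<subseteq> T} = {}"
    using T(2) ne(1) by blast
  have 2: "({e \<in> E. g e \<subseteq> S} \<union> {e \<in> E. g e \<subseteq> T}) \<inter> (\<Union>x\<in>T. ?cut x) = {}"
    using T(2) ne(2) by blast
  have 3: "card (\<Union>x\<in>T. ?cut x) = (\<Sum>x\<in>T. card (?cut x))"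
    using E(1) T by (intro card_UN_disjoint) auto
  show ?thesis
    unfolding eq using E(1) T(1) 1 2 3 by (simp add: card_Un_disjoint)
qed

text \<open>At each \<open>x\<close> in \<open>T\<close>, the new edge to \<open>u\<close> and the
  deletion of the poor node are paid by different full edges from \<open>x\<close> to
  \<open>S\<close>, and the lowered capacities by half-edges. So differences of potential survive,
  and \<open>u\<close> itself contributes \<open>i - j\<close>.\<close>

lemma pot_contract:
  assumes wf: "conf_wf i j C" and ij: "i \<le> j" and S: "S \<subseteq> cvs C" "u \<in> S" and T: "T \<subseteq> cvs C - S"
  shows "pot i j (contract C S u \<phi>) (insert u T) \<ge> int i - int j + pot i j C (S \<union> T) - pot i j C S"
    and "pot i j (contract C S u \<phi>) T \<ge> pot i j C (S \<union> T) - pot i j C S"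
proof -
  let ?D = "contract C S u \<phi>"
  note D = wf_D[OF wf]
  have fT: "finite T" "finite S" and uT: "u \<notin> T" and TS: "T \<inter> S = {}"
    using D(1) S T by (auto intro: finite_subset)
  define p where "p x = (if cut_full C S \<phi> x False \<noteq> {} then 1 else 0 :: int)" for x
  define q where "q x = (if cut_full C S \<phi> x True \<noteq> {} then 1 else 0 :: int)" for x
  define h where "h x = int (card (cut_half C S \<phi> x True)) + int (card (cut_half C S \<phi> x False))" for x
  define dc where "dc x = int (card {e \<in> ces C. x \<in> e \<and> e \<subseteq> insert x S})" for x
  define hc where "hc x = int (card {k \<in> chs C. x \<in> che C k \<and> che C k \<subseteq> insert x S})" for x
  have pq: "p x + q x \<le> dc x" "h x \<le> hc x" if "x \<in> T" for x
  proof -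
    have "x \<notin> S" using that TS by auto
    note ge = card_cut_ge[OF wf this, of \<phi>]
    show "p x + q x \<le> dc x"
      using ge(1) unfolding p_def q_def dc_def
      by (cases "cut_full C S \<phi> x True = {}"; cases "cut_full C S \<phi> x False = {}") simp_all
    show "h x \<le> hc x"
      using ge(2) unfolding h_def hc_def by linarith
  qed
  have w: "wgt i j C x - (int i + 1) * p x - h x \<le> wgt i j ?D x" if x: "x \<in> T" for x
  proof -
    have xu: "x \<noteq> u" "x \<in> cvs C" using x uT T by auto
    have "ccp C x False - int i * p x - p x - int (card (cut_half C S \<phi> x False)) \<le> ccp ?D x False"
      using xu(1) D(9)[OF xu(2)] by (auto simp: p_def)
    moreover have "ccp C x True - int (card (cut_half C S \<phi> x True)) \<le> ccp ?D x True"
      using xu(1) by auto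
    ultimately show ?thesis unfolding wgt_def h_def by (simp add: algebra_simps)
  qed
  have "(\<Sum>x\<in>T. wgt i j C x - (int i + 1) * p x - h x) \<le> (\<Sum>x\<in>T. wgt i j ?D x)"
    using w by (rule sum_mono)
  then have sw: "(\<Sum>x\<in>T. wgt i j C x) - (int i + 1) * (\<Sum>x\<in>T. p x) - (\<Sum>x\<in>T. h x) \<le> (\<Sum>x\<in>T. wgt i j ?D x)"
    by (simp add: sum_subtractf sum_distrib_left)
  have f1: "int (card {e \<in> ces C. e \<subseteq> S \<union> T}) = int (card {e \<in> ces C. e \<subseteq> S})
      + int (card {e \<in> ces C. e \<subseteq> T}) + (\<Sum>x\<in>T. dc x)"
    using card_cut_sum[OF D(3), of "\<lambda>e. e" T S] D(5) fT TS by (simp add: dc_def)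
  have f2: "int (card {k \<in> chs C. che C k \<subseteq> S \<union> T}) = int (card {k \<in> chs C. che C k \<subseteq> S})
      + int (card {k \<in> chs C. che C k \<subseteq> T}) + (\<Sum>x\<in>T. hc x)"
    using card_cut_sum[OF D(2), of "che C" T S] D(7) fT TS by (simp add: hc_def)
  have "(\<Sum>x\<in>T. p x + q x) \<le> (\<Sum>x\<in>T. dc x)" "(\<Sum>x\<in>T. h x) \<le> (\<Sum>x\<in>T. hc x)"
    using pq by (auto intro: sum_mono)
  then have s1: "(\<Sum>x\<in>T. p x) + (\<Sum>x\<in>T. q x) \<le> (\<Sum>x\<in>T. dc x)" and s2: "(\<Sum>x\<in>T. h x) \<le> (\<Sum>x\<in>T. hc x)"
    by (simp_all add: sum.distrib)
  have sS: "(\<Sum>x\<in>S \<union> T. wgt i j C x) = (\<Sum>x\<in>S. wgt i j C x) + (\<Sum>x\<in>T. wgt i j C x)"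
    using fT TS by (intro sum.union_disjoint) auto
  have "{e \<in> ces ?D. e \<subseteq> insert u T} \<subseteq>
      {e \<in> ces C. e \<subseteq> T} \<union> (\<lambda>x. {u, x}) ` {x \<in> T. cut_full C S \<phi> x True \<noteq> {}}"
    using S(2) uT by auto
  then have "card {e \<in> ces ?D. e \<subseteq> insert u T} \<le>
      card ({e \<in> ces C. e \<subseteq> T} \<union> (\<lambda>x. {u, x}) ` {x \<in> T. cut_full C S \<phi> x True \<noteq> {}})"
    using fT(1) D(3) by (intro card_mono) auto
  also have "\<dots> \<le> card {e \<in> ces C. e \<subseteq> T} + card {x \<in> T. cut_full C S \<phi> x True \<noteq> {}}"
    using fT(1) by (intro le_trans[OF card_Un_le] add_mono card_image_le) auto
  finally have "card {e \<in> ces ?D. e \<subseteq> insert u T} \<le>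
      card {e \<in> ces C. e \<subseteq> T} + card {x \<in> T. cut_full C S \<phi> x True \<noteq> {}}" .
  moreover have "int (card {x \<in> T. cut_full C S \<phi> x True \<noteq> {}}) = (\<Sum>x\<in>T. q x)"
    using fT(1) by (simp add: q_def sum.If_cases Int_def)
  ultimately have e1: "int (card {e \<in> ces ?D. e \<subseteq> insert u T}) \<le> int (card {e \<in> ces C. e \<subseteq> T}) + (\<Sum>x\<in>T. q x)"
    by linarith
  have "{e \<in> ces ?D. e \<subseteq> T} \<subseteq> {e \<in> ces C. e \<subseteq> T}" using uT by auto
  then have e2: "int (card {e \<in> ces ?D. e \<subseteq> T}) \<le> int (card {e \<in> ces C. e \<subseteq> T})"
    using D(3) by (simp add: card_mono)
  have "{k \<in> chs ?D. che ?D k \<subseteq> insert u T} \<subseteq> {k \<in> chs C. che C k \<subseteq> T}"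
    "{k \<in> chs ?D. che ?D k \<subseteq> T} \<subseteq> {k \<in> chs C. che C k \<subseteq> T}"
    using S(2) by auto
  then have h1: "int (card {k \<in> chs ?D. che ?D k \<subseteq> insert u T}) \<le> int (card {k \<in> chs C. che C k \<subseteq> T})"
    "int (card {k \<in> chs ?D. che ?D k \<subseteq> T}) \<le> int (card {k \<in> chs C. che C k \<subseteq> T})"
    using D(2) by (simp_all add: card_mono)
  have wu: "wgt i j ?D u = int i - int j" by (simp add: wgt_def)
  have sU: "(\<Sum>x\<in>insert u T. wgt i j ?D x) = int i - int j + (\<Sum>x\<in>T. wgt i j ?D x)"
    using fT(1) uT wu by simp
  have sT: "(\<Sum>x\<in>T. p x) + (\<Sum>x\<in>T. q x) - (\<Sum>x\<in>T. dc x) \<le> 0" using s1 by simp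
  have m1: "(int i + 1) * ((\<Sum>x\<in>T. p x) + (\<Sum>x\<in>T. q x)) \<le> (int i + 1) * (\<Sum>x\<in>T. dc x)"
    using s1 by (intro mult_left_mono) auto
  have m2: "(int i + 1) * int (card {e \<in> ces ?D. e \<subseteq> insert u T})
      \<le> (int i + 1) * (int (card {e \<in> ces C. e \<subseteq> T}) + (\<Sum>x\<in>T. q x))"
    using e1 by (intro mult_left_mono) auto
  have m3: "(int i + 1) * int (card {e \<in> ces ?D. e \<subseteq> T}) \<le> (int i + 1) * int (card {e \<in> ces C. e \<subseteq> T})"
    using e2 by (intro mult_left_mono) auto
  have m4: "(int i + 1) * (\<Sum>x\<in>T. p x) \<le> (int i + 1) * (\<Sum>x\<in>T. dc x)"
  proof -
    have "0 \<le> (\<Sum>x\<in>T. q x)" by (intro sum_nonneg) (auto simp: q_def)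
    then show ?thesis using s1 by (intro mult_left_mono) auto
  qed
  show "pot i j ?D (insert u T) \<ge> int i - int j + pot i j C (S \<union> T) - pot i j C S"
    unfolding pot_def sU f1 f2 sS using sw m1 m2 s2 h1 by (simp only: distrib_left)
  show "pot i j ?D T \<ge> pot i j C (S \<union> T) - pot i j C S"
    unfolding pot_def f1 f2 sS using sw m4 m3 s2 h1 by (simp only: distrib_left)
qed

lemma clash_toggle:
  assumes "card e = 2" "x \<in> e" "\<psi> x = (\<not> \<phi> x)" "\<And>y. y \<in> e \<Longrightarrow> y \<noteq> x \<Longrightarrow> \<psi> y = \<phi> y"
  shows "clash \<psi> s e \<longleftrightarrow> \<not> clash \<phi> s e"
proof -
  obtain y where y: "y \<noteq> x" "e = {x, y}" using card2_other[OF assms(1,2)] .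
  have "\<psi> y = \<phi> y" using assms(4) y by auto
  then show ?thesis using y assms(3) clash_insert[of x y] by auto
qed

text \<open>If the contraction were sparse, it would be colourable and so would \<open>C\<close>. A
  set violating sparseness becomes, with \<open>S\<close> put in for \<open>u\<close>, a superset of
  \<open>S\<close> of smaller potential.\<close>

lemma contract_step:
  fixes C :: "'a config"
  assumes wf: "conf_wf i j C" and ij: "i \<le> j" and S: "S \<subseteq> cvs C" "S \<noteq> {}"
    and col: "conf_colorable (restr C S)" and nc: "\<not> conf_colorable C"
    and con: "\<And>u \<phi>. u \<in> S \<Longrightarrow> sparse i j (contract C S u \<phi>) \<Longrightarrow> conf_colorable (contract C S u \<phi>)"
  shows "\<exists>T. T \<subseteq> cvs C - S \<and> T \<noteq> {} \<and> pot i j C (S \<union> T) < pot i j C S"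
proof -
  obtain u where u: "u \<in> S" using S by auto
  obtain \<phi> \<omega> where c: "col {} (restr C S) \<phi> \<omega>" using col unfolding conf_colorable_def by blast
  have "\<not> sparse i j (contract C S u \<phi>)"
    using contract_colorable[OF wf S(1) u c] con[OF u] nc by blast
  then obtain A where A: "A \<subseteq> insert u (cvs C - S)" "A \<noteq> {}" "pot i j (contract C S u \<phi>) A < int i - int j"
    unfolding sparse_def by (auto simp: not_le)
  define T where "T = A - {u}"
  have T: "T \<subseteq> cvs C - S" using A(1) by (auto simp: T_def)
  have "pot i j C (S \<union> T) < pot i j C S"
  proof (cases "u \<in> A")
    case True
    then have AT: "A = insert u T" by (auto simp: T_def)
    show ?thesis using pot_contract(1)[OF wf ij S(1) u T, of \<phi>] A(3)[unfolded AT] by linarith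
  next
    case False
    then have AT: "A = T" by (auto simp: T_def)
    show ?thesis using pot_contract(2)[OF wf ij S(1) u T, of \<phi>] A(3)[unfolded AT] ij by linarith
  qed
  moreover from this have "T \<noteq> {}" by auto
  ultimately show ?thesis using T by blast
qed

section \<open>Minimal counterexamples\<close>

locale minimal_counterexample =
  fixes i j :: nat and C :: "'a config"
  assumes i12: "i = 1 \<or> i = 2" and ji: "2 * i \<le> j"
    and wf: "conf_wf i j C" and sp: "sparse i j C" and nc: "\<not> conf_colorable C"
    and least: "\<And>D :: 'a config. conf_wf i j D \<Longrightarrow> sparse i j D \<Longrightarrow>
      card (cvs D) < card (cvs C) \<or>
      card (cvs D) = card (cvs C) \<and> card (ces D) + card (chs D) < card (ces C) + card (chs C) \<Longrightarrow>
      conf_colorable D"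
begin

abbreviation "pt \<equiv> pot i j C"
abbreviation "wt \<equiv> wgt i j C"
abbreviation "T \<equiv> int i - int j"

lemmas D = wf_D[OF wf]
lemmas fin_cl = finite_clashes[OF wf]

lemma sparseD: "A \<subseteq> cvs C \<Longrightarrow> A \<noteq> {} \<Longrightarrow> T \<le> pt A"
  using sp unfolding sparse_def by blast

lemma finsub: "A \<subseteq> cvs C \<Longrightarrow> finite A"
  using D(1) by (rule finite_subset[rotated])

text \<open>Since \<open>S\<close> has two vertices, contracting it leaves fewer vertices, so
  minimality applies and \<open>S\<close> grows to a set of smaller potential. Repetition can stop
  only at the whole vertex set.\<close>

lemma gap:
  assumes "S \<subset> cvs C" "2 \<le> card S"
  shows "pt (cvs C) < pt S"
  using assms
proof (induction "card (cvs C - S)" arbitrary: S rule: less_induct)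
  case less
  have S: "S \<subseteq> cvs C" "S \<noteq> {}" and fS: "finite S" using less.prems finsub[of S] by auto
  have lt: "card S < card (cvs C)" using less.prems(1) D(1) psubset_card_mono by blast
  have "conf_colorable (restr C S)"
    using least[OF wf_restr[OF wf S(1)] sparse_restr[OF sp S(1)]] lt by simp
  moreover have "conf_colorable (contract C S u \<phi>)" if "u \<in> S" "sparse i j (contract C S u \<phi>)" for u \<phi>
  proof (rule least[OF wf_contract[OF wf S(1) that(1)] that(2)])
    have "card (insert u (cvs C - S)) = Suc (card (cvs C) - card S)"
      using D(1) fS S(1) that(1) by (simp add: card_Diff_subset)
    then show "card (cvs (contract C S u \<phi>)) < card (cvs C) \<or>
      card (cvs (contract C S u \<phi>)) = card (cvs C) \<and>
      card (ces (contract C S u \<phi>)) + card (chs (contract C S u \<phi>)) < card (ces C) + card (chs C)"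
      using less.prems(2) lt by auto
  qed
  ultimately obtain U where U: "U \<subseteq> cvs C - S" "U \<noteq> {}" "pt (S \<union> U) < pt S"
    using contract_step[OF wf _ S _ nc] ji by (metis le_add1 le_trans mult_2)
  show ?case
  proof (cases "S \<union> U = cvs C")
    case True then show ?thesis using U(3) by simp
  next
    case False
    then have ps: "S \<union> U \<subset> cvs C" using S U by auto
    have "card (cvs C - (S \<union> U)) < card (cvs C - S)"
      using U D(1) by (intro psubset_card_mono) auto
    moreover have "2 \<le> card (S \<union> U)"
      using less.prems(2) card_mono[of "S \<union> U" S] finsub[of "S \<union> U"] ps by auto
    ultimately show ?thesis using less.hyps ps U(3) by force
  qed
qed

lemma gap': "S \<subset> cvs C \<Longrightarrow> 2 \<le> card S \<Longrightarrow> T + 1 \<le> pt S"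
  using gap[of S] sparseD[of "cvs C"] by fastforce

text \<open>\<open>gap'\<close> does not cover singletons; for these the potential is the
  weight.\<close>

lemma low:
  assumes "A \<subset> cvs C" "v \<in> A" "T < wt v"
  shows "T + 1 \<le> pt A"
proof (cases "2 \<le> card A")
  case True then show ?thesis using gap'[OF assms(1)] by simp
next
  case False
  have "finite A" using assms(1) finsub by blast
  then have "card A = 1" using False assms(2) card_gt_0_iff[of A] by fastforce
  then have "A = {v}" using assms(2) by (metis card_1_singletonE singletonD)
  then show ?thesis using pot_single[OF wf, of v] assms(3) by simp
qed

lemma wt_ge: "v \<in> cvs C \<Longrightarrow> T \<le> wt v"
  using sparseD[of "{v}"] pot_single[OF wf] by auto

lemma T_neg: "T \<le> - 1"
  using i12 ji by auto

lemma pot_pair: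
  assumes "x \<in> cvs C" "y \<in> cvs C" "x \<noteq> y"
  shows "pt {x, y} = wt x + wt y - (int i + 1) * int (card {e \<in> fulls C x. e \<subseteq> {x, y}})
     - int (card {k \<in> halves C x. che C k \<subseteq> {x, y}})"
  using pot_insert[OF wf, of "{y}" x] pot_single[OF wf, of y] assms(3) by simp

text \<open>Two vertices of weight \<open>T\<close> would form a set of potential at most
  \<open>2 * T\<close>, which is below \<open>T\<close> because \<open>T\<close> is
  negative.\<close>

lemma two_tight:
  assumes "x \<in> cvs C" "y \<in> cvs C" "x \<noteq> y"
  shows "T < wt x \<or> T < wt y"
proof (rule ccontr)
  assume "\<not> ?thesis"
  moreover have "0 \<le> (int i + 1) * int (card {e \<in> fulls C x. e \<subseteq> {x, y}})" by simp
  then have "pt {x, y} \<le> wt x + wt y" using pot_pair[OF assms] by linarith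
  moreover have "T \<le> pt {x, y}" using assms by (intro sparseD) auto
  ultimately show False using T_neg by linarith
qed

text \<open>Every reduction deletes or weakens something; since the resulting configuration is not colourable,
  some set of vertices has potential below \<open>T\<close> in it, hence small potential in \<open>C\<close>.\<close>

lemma reduce:
  assumes X: "X \<subseteq> cvs C" and K: "finite K" "K \<inter> chs C = {}"
    and hn: "\<And>k. k \<in> K \<Longrightarrow> hn k \<subseteq> cvs C - X \<and> card (hn k) = 2"
    and small: "X \<noteq> {} \<or> K = {} \<and> (Rf \<inter> ces C \<noteq> {} \<or> Rh \<inter> chs C \<noteq> {})"
    and ncol: "\<And>\<phi> \<omega>. \<not> col {} (modify C X Rf Rh \<mu> K hn hg) \<phi> \<omega>"
  shows "\<exists>A. A \<subseteq> cvs C - X \<and> A \<noteq> {} \<and>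
    pt A + int (card {k \<in> Rh \<inter> chs C. che C k \<subseteq> A}) <
      T + (\<Sum>v\<in>A. int (\<mu> v False) + int (\<mu> v True)) + int (card {k \<in> K. hn k \<subseteq> A})"
proof -
  let ?M = "modify C X Rf Rh \<mu> K hn hg"
  have wfM: "conf_wf i j ?M" using wf_modify[OF wf K(1) hn] .
  have "card (cvs ?M) < card (cvs C) \<or>
      card (cvs ?M) = card (cvs C) \<and> card (ces ?M) + card (chs ?M) < card (ces C) + card (chs C)"
  proof (cases "X = {}")
    case False
    then have "cvs C - X \<subset> cvs C" using X by auto
    then show ?thesis using D(1) psubset_card_mono by auto
  next
    case True
    then have KK: "K = {}" and R: "Rf \<inter> ces C \<noteq> {} \<or> Rh \<inter> chs C \<noteq> {}" using small by auto
    have 1: "card (ces C - Rf) \<le> card (ces C)" "card (chs C - Rh) \<le> card (chs C)"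
      using D(2,3) by (auto intro: card_mono)
    have 2: "card (ces C - Rf) < card (ces C)" if "Rf \<inter> ces C \<noteq> {}"
      using that D(3) by (intro psubset_card_mono) auto
    have 3: "card (chs C - Rh) < card (chs C)" if "Rh \<inter> chs C \<noteq> {}"
      using that D(2) by (intro psubset_card_mono) auto
    have "card (ces C - Rf) + card (chs C - Rh) < card (ces C) + card (chs C)"
      using 1 2 3 R by (meson add_le_less_mono add_less_le_mono)
    moreover have "ces ?M = ces C - Rf" "chs ?M = chs C - Rh" "cvs ?M = cvs C" using True KK by auto
    ultimately show ?thesis by metis
  qed
  then have "\<not> sparse i j ?M"
    using least[OF wfM] ncol unfolding conf_colorable_def by blast
  then obtain A where A: "A \<subseteq> cvs C - X" "A \<noteq> {}" "pot i j ?M A < T"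
    unfolding sparse_def by (auto simp: not_le)
  then have "A \<subseteq> cvs C" by auto
  from pot_modify[OF wf this K, where X = X and Rf = Rf and Rh = Rh and \<mu> = \<mu> and hn = hn and hg = hg] A show ?thesis
    by (intro exI[of _ A]) linarith
qed

text \<open>The constraints at these vertices can be dropped: a violated one has a poor node with three clashes, and
  switching to the rich node removes them all.\<close>

definition Qs :: "'a set" where
  "Qs = {v \<in> cvs C. i = 2 \<and> ccp C v False = 2 \<and> ccp C v True = int j \<and> card (fulls C v) = 3 \<and> halves C v = {}}"

lemma Qs_cap: "q \<in> Qs \<Longrightarrow> ccp C q False = 2 \<and> 4 \<le> ccp C q True"
  using ji by (auto simp: Qs_def)

text \<open>With three full edges and no half-edge, only a poor node can be overloaded, its capacity
  being 2, and only if all three edges clash.\<close>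

lemma Qs_violated:
  assumes q: "q \<in> Qs" and \<omega>: "\<And>k. k \<in> chs C \<Longrightarrow> \<omega> k \<in> che C k"
    and v: "\<not> int (card (full_clashes C \<phi> q) + card (half_hits C \<phi> \<omega> q)) \<le> ccp C q (\<phi> q)"
  shows "\<not> \<phi> q" "full_clashes C \<phi> q = fulls C q"
proof -
  have h: "half_hits C \<phi> \<omega> q = {}"
    using q \<omega> unfolding Qs_def halves_def half_hits_def by blast
  have s: "full_clashes C \<phi> q \<subseteq> fulls C q" by (auto simp: full_clashes_def fulls_def)
  then have "card (full_clashes C \<phi> q) \<le> 3"
    using card_mono[OF fin_cl(4) s] q by (auto simp: Qs_def)
  then show n: "\<not> \<phi> q"
    using v h Qs_cap[OF q] by (cases "\<phi> q") auto
  then have "card (full_clashes C \<phi> q) \<ge> 3"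
    using v h Qs_cap[OF q] by auto
  then show "full_clashes C \<phi> q = fulls C q"
    using q s card_seteq[OF fin_cl(4) s] by (auto simp: Qs_def)
qed

lemma Qs_no_half: "q \<in> Qs \<Longrightarrow> k \<in> chs C \<Longrightarrow> q \<notin> che C k"
  unfolding Qs_def halves_def by blast

text \<open>Without the edge between them the configuration is still sparse, hence colourable.
  Putting the edge back can violate only one of its ends; such an end is poor with all its edges
  clashing, and making it rich removes all these clashes, that of the restored edge
  included.\<close>

lemma Qs_independent:
  assumes "q \<in> Qs" "q' \<in> Qs" "q \<noteq> q'"
  shows "{q, q'} \<notin> ces C"
proof
  let ?e = "{q, q'}"
  assume e: "?e \<in> ces C"
  let ?M = "modify C {} {?e} {} (\<lambda>_ _. 0) {} (\<lambda>_. {}) (\<lambda>_. True)"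
  have "\<exists>\<phi> \<omega>. col {} ?M \<phi> \<omega>"
  proof (rule ccontr)
    assume "\<not> ?thesis"
    then have n: "\<not> col {} ?M \<phi> \<omega>" for \<phi> \<omega> by blast
    have "\<exists>A. A \<subseteq> cvs C - {} \<and> A \<noteq> {} \<and> pt A + int (card {k \<in> {} \<inter> chs C. che C k \<subseteq> A}) <
      T + (\<Sum>v\<in>A. int 0 + int 0) + int (card {k \<in> {}::nat set. {} \<subseteq> A})"
      using e by (intro reduce[OF _ _ _ _ _ n]) auto
    then obtain A where "A \<subseteq> cvs C" "A \<noteq> {}" "pt A < T" by auto
    then show False using sparseD[of A] by linarith
  qed
  then obtain \<phi> \<omega> where c: "col {} ?M \<phi> \<omega>" by blast
  have \<omega>: "\<omega> k \<in> che C k" if "k \<in> chs C" for k using c that unfolding col_def by auto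
  have hh: "half_hits ?M \<phi> \<omega> v = half_hits C \<phi> \<omega> v" for v by (auto simp: half_hits_def)
  have fc: "full_clashes ?M \<phi> v = full_clashes C \<phi> v - {?e}" for v by (auto simp: full_clashes_def)
  have cap: "int (card (full_clashes C \<phi> v - {?e}) + card (half_hits C \<phi> \<omega> v)) \<le> ccp C v (\<phi> v)" if "v \<in> cvs C" for v
  proof -
    have "int (card (full_clashes C \<phi> v - {?e}) + card (half_hits C \<phi> \<omega> v)) \<le> max (-1) (ccp C v (\<phi> v))"
      using c that unfolding col_def hh fc by auto
    then show ?thesis by linarith
  qed
  obtain p p' where p: "p \<in> Qs" "?e = {p, p'}" "p \<noteq> p'"
    and viol: "\<not> int (card (full_clashes C \<phi> p) + card (half_hits C \<phi> \<omega> p)) \<le> ccp C p (\<phi> p)"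
  proof -
    have "\<exists>v\<in>cvs C. \<not> int (card (full_clashes C \<phi> v) + card (half_hits C \<phi> \<omega> v)) \<le> ccp C v (\<phi> v)"
      using nc \<omega> unfolding conf_colorable_def col_def by blast
    then obtain v where v: "v \<in> cvs C" "\<not> int (card (full_clashes C \<phi> v) + card (half_hits C \<phi> \<omega> v)) \<le> ccp C v (\<phi> v)"
      by blast
    have "?e \<in> full_clashes C \<phi> v"
    proof (rule ccontr)
      assume "?e \<notin> full_clashes C \<phi> v"
      then have "full_clashes C \<phi> v - {?e} = full_clashes C \<phi> v" by simp
      then show False using cap[OF v(1)] v(2) by simp
    qed
    then have "v = q \<or> v = q'" by (auto simp: full_clashes_def)
    then show thesis
    proof
      assume "v = q" then show thesis using that[of q q'] assms v by auto
    next
      assume "v = q'" then show thesis using that[of q' q] assms v by auto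
    qed
  qed
  note pv = Qs_violated[OF p(1) \<omega> viol]
  let ?\<psi> = "\<phi>(p := True)"
  have tog: "clash ?\<psi> (csg C e) e = (\<not> clash \<phi> (csg C e) e)" if "e \<in> ces C" "p \<in> e" for e
    using D(5)[OF that(1)] that(2) pv(1) by (intro clash_toggle) auto
  have fp: "full_clashes C ?\<psi> p = {}"
    using tog pv(2) unfolding full_clashes_def fulls_def by blast
  have fv: "full_clashes C ?\<psi> v \<subseteq> full_clashes C \<phi> v - {?e}" if "v \<noteq> p" for v
  proof
    fix e assume "e \<in> full_clashes C ?\<psi> v"
    then have e: "e \<in> ces C" "v \<in> e" "clash ?\<psi> (csg C e) e" by (auto simp: full_clashes_def)
    have "p \<notin> e"
    proof
      assume "p \<in> e"
      then have "e \<in> full_clashes C \<phi> p" using e(1) pv(2) by (auto simp: fulls_def)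
      then show False using tog[OF e(1) \<open>p \<in> e\<close>] e(3) by (auto simp: full_clashes_def)
    qed
    then show "e \<in> full_clashes C \<phi> v - {?e}" using e p(2) by (auto simp: full_clashes_def)
  qed
  have hv: "half_hits C ?\<psi> \<omega> v = half_hits C \<phi> \<omega> v" for v
    using Qs_no_half[OF p(1)] by (auto simp: half_hits_def)
  have hp: "half_hits C \<phi> \<omega> p = {}"
    using Qs_no_half[OF p(1)] \<omega> by (auto simp: half_hits_def)
  have "int (card (full_clashes C ?\<psi> v) + card (half_hits C ?\<psi> \<omega> v)) \<le> ccp C v (?\<psi> v)" if "v \<in> cvs C" for v
  proof (cases "v = p")
    case True
    then show ?thesis using fp hv hp Qs_cap[OF p(1)] by simp
  next
    case False
    have "card (full_clashes C ?\<psi> v) \<le> card (full_clashes C \<phi> v - {?e})"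
      using fin_cl(1) by (intro card_mono fv[OF False]) auto
    then show ?thesis using cap[OF that] hv False by simp
  qed
  then have "col {} C ?\<psi> \<omega>" using \<omega> unfolding col_def by blast
  then show False using nc unfolding conf_colorable_def by blast
qed

text \<open>All violated vertices of \<open>Qs\<close> are made rich simultaneously. They are
  pairwise nonadjacent, so each edge at them is toggled exactly once; it clashed before, so no clash
  is created.\<close>

lemma col_off_Qs: "\<not> col Qs C \<phi> \<omega>"
proof
  assume c: "col Qs C \<phi> \<omega>"
  then have \<omega>: "\<omega> k \<in> che C k" if "k \<in> chs C" for k using that unfolding col_def by blast
  define B where "B = {q \<in> Qs. \<not> int (card (full_clashes C \<phi> q) + card (half_hits C \<phi> \<omega> q)) \<le> ccp C q (\<phi> q)}"
  define \<psi> where "\<psi> v = (if v \<in> B then True else \<phi> v)" for v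
  have B: "q \<in> Qs" "\<not> \<phi> q" "full_clashes C \<phi> q = fulls C q" if "q \<in> B" for q
    using that Qs_violated[OF _ \<omega>, of q \<phi>] unfolding B_def by auto
  have noB: "clash \<psi> (csg C e) e = (\<not> clash \<phi> (csg C e) e) \<and> clash \<phi> (csg C e) e" if "q \<in> B" "q \<in> e" "e \<in> ces C" for q e
  proof -
    have "y \<notin> B" if "y \<in> e" "y \<noteq> q" for y
    proof
      assume "y \<in> B"
      obtain z where "z \<noteq> q" "e = {q, z}" using card2_other[OF D(5)[OF \<open>e \<in> ces C\<close>] \<open>q \<in> e\<close>] .
      then have "e = {q, y}" using that by auto
      then show False using Qs_independent[OF B(1)[OF \<open>q \<in> B\<close>] B(1)[OF \<open>y \<in> B\<close>]] that \<open>e \<in> ces C\<close> by auto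
    qed
    then have "clash \<psi> (csg C e) e = (\<not> clash \<phi> (csg C e) e)"
      using that B(2)[OF that(1)] D(5)[OF that(3)] by (intro clash_toggle) (auto simp: \<psi>_def)
    moreover have "e \<in> full_clashes C \<phi> q" using B(3)[OF that(1)] that by (auto simp: fulls_def)
    ultimately show ?thesis by (auto simp: full_clashes_def)
  qed
  have sub: "full_clashes C \<psi> v \<subseteq> full_clashes C \<phi> v" for v
  proof
    fix e assume "e \<in> full_clashes C \<psi> v"
    then have e: "e \<in> ces C" "v \<in> e" "clash \<psi> (csg C e) e" by (auto simp: full_clashes_def)
    have "e \<inter> B = {}" using noB e by blast
    then have "clash \<psi> (csg C e) e = clash \<phi> (csg C e) e" by (intro clash_cong) (auto simp: \<psi>_def)
    then show "e \<in> full_clashes C \<phi> v" using e by (auto simp: full_clashes_def)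
  qed
  have hv: "half_hits C \<psi> \<omega> v = half_hits C \<phi> \<omega> v" for v
  proof -
    have "clash \<psi> s (che C k) = clash \<phi> s (che C k)" if "k \<in> chs C" for k s
      using Qs_no_half[OF B(1) that] by (intro clash_cong) (auto simp: \<psi>_def)
    then show ?thesis by (auto simp: half_hits_def)
  qed
  have "int (card (full_clashes C \<psi> v) + card (half_hits C \<psi> \<omega> v)) \<le> ccp C v (\<psi> v)" if v: "v \<in> cvs C" for v
  proof (cases "v \<in> B")
    case True
    have "full_clashes C \<psi> v = {}" using noB[OF True] unfolding full_clashes_def by blast
    moreover have "half_hits C \<phi> \<omega> v = {}"
      using Qs_no_half[OF B(1)[OF True]] \<omega> by (auto simp: half_hits_def)
    ultimately show ?thesis using hv Qs_cap[OF B(1)[OF True]] True by (simp add: \<psi>_def)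
  next
    case False
    then have "int (card (full_clashes C \<phi> v) + card (half_hits C \<phi> \<omega> v)) \<le> ccp C v (\<phi> v)"
      using c v unfolding col_def B_def by blast
    then show ?thesis using card_mono[OF fin_cl(1) sub[of v]] hv False by (simp add: \<psi>_def)
  qed
  then have "col {} C \<psi> \<omega>" using \<omega> unfolding col_def by blast
  then show False using nc unfolding conf_colorable_def by blast
qed

text \<open>The form in which deletion of \<open>x\<close> is used: only neighbours outside
  \<open>Qs\<close> need reserves for their clashes with \<open>x\<close>.\<close>

lemma no_extension:
  assumes "x \<in> cvs C" "finite K" "K \<inter> chs C = {}"
    and "col {} (modify C {x} {} {} \<mu> K hn hg) \<phi> \<omega>"
    and "P \<subseteq> half_clashes C (\<phi>(x := n)) x"
    and "\<And>y. y \<in> cvs C \<Longrightarrow> y \<noteq> x \<Longrightarrow> y \<notin> Qs \<Longrightarrow>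
      card {e \<in> full_clashes C (\<phi>(x := n)) x. y \<in> e} + card {k \<in> P. y \<in> che C k}
        \<le> \<mu> y (\<phi> y) + card {k \<in> K. \<omega> k = y \<and> clash \<phi> (hg k) (hn k)}"
    and "int (card (full_clashes C (\<phi>(x := n)) x) + card (half_clashes C (\<phi>(x := n)) x) - card P) \<le> ccp C x n"
  shows False
  using extend_col[OF wf assms] col_off_Qs by blast

end

text \<open>A reserve of one clash at the other end of \<open>e\<close>, only at the node in
  conflict with a rich \<open>x\<close>. It costs one unit of potential and covers \<open>e\<close>
  whenever \<open>x\<close> is made rich.\<close>

definition unit_at :: "'a \<Rightarrow> 'a set \<Rightarrow> bool \<Rightarrow> 'a \<Rightarrow> bool \<Rightarrow> nat" where
  "unit_at x e s y b = (if y \<in> e \<and> y \<noteq> x \<and> b = s then 1 else 0)"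

lemma unit_at_sum:
  assumes "card e = 2" "x \<in> e" "x \<notin> A" "finite A"
  shows "(\<Sum>v\<in>A. int (unit_at x e s v False) + int (unit_at x e s v True)) = (if e \<subseteq> insert x A then 1 else 0)"
proof -
  obtain y where y: "y \<noteq> x" "e = {x, y}" using card2_other[OF assms(1,2)] .
  have "int (unit_at x e s v False) + int (unit_at x e s v True) = (if v = y then 1 else 0)" for v
    using y by (auto simp: unit_at_def)
  then have "(\<Sum>v\<in>A. int (unit_at x e s v False) + int (unit_at x e s v True)) = (\<Sum>v\<in>A. if v = y then 1 else 0)"
    by simp
  also have "\<dots> = (if y \<in> A then 1 else 0)" using assms(4) by simp
  finally show ?thesis using y by auto
qed

lemma unit_at_clash:
  assumes "card e = 2" "x \<in> e" "y \<in> e" "y \<noteq> x" "clash (\<phi>(x := True)) s e"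
  shows "unit_at x e s y (\<phi> y) = 1"
proof -
  have "e = {x, y}" using card2_other[OF assms(1,2)] assms(3,4) by (metis insertE singletonD)
  then have "clash (\<phi>(x := True)) s {x, y}" using assms(5) by simp
  then have "\<phi> y = s" using clash_insert[of x y "\<phi>(x := True)" s] assms(4) by auto
  then show ?thesis using assms(3,4) by (simp add: unit_at_def)
qed

context minimal_counterexample begin

definition outer :: "'a \<Rightarrow> 'a set set" where
  "outer x = {e \<in> fulls C x. \<exists>y\<in>e. y \<noteq> x \<and> y \<notin> Qs}"

lemma del_col:
  assumes "x \<in> cvs C" "finite K" "K \<inter> chs C = {}"
    and "\<And>k. k \<in> K \<Longrightarrow> hn k \<subseteq> cvs C - {x} \<and> card (hn k) = 2"
    and "\<And>A. A \<subseteq> cvs C - {x} \<Longrightarrow> A \<noteq> {} \<Longrightarrow>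
      T + (\<Sum>v\<in>A. int (\<mu> v False) + int (\<mu> v True)) + int (card {k \<in> K. hn k \<subseteq> A}) \<le> pt A"
  shows "\<exists>\<phi> \<omega>. col {} (modify C {x} {} {} \<mu> K hn hg) \<phi> \<omega>"
proof (rule ccontr)
  assume "\<not> ?thesis"
  then have n: "\<not> col {} (modify C {x} {} {} \<mu> K hn hg) \<phi> \<omega>" for \<phi> \<omega> by blast
  obtain A where "A \<subseteq> cvs C - {x}" "A \<noteq> {}"
    "pt A + int (card {k \<in> {} \<inter> chs C. che C k \<subseteq> A}) <
      T + (\<Sum>v\<in>A. int (\<mu> v False) + int (\<mu> v True)) + int (card {k \<in> K. hn k \<subseteq> A})"
    using reduce[OF _ assms(2,3) assms(4) _ n] assms(1) by blast
  then show False using assms(5)[of A] by simp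
qed

lemma del_plain:
  assumes "x \<in> cvs C"
  shows "\<exists>\<phi> \<omega>. col {} (modify C {x} {} {} (\<lambda>_ _. 0) {} (\<lambda>_. {}) (\<lambda>_. True)) \<phi> \<omega>"
proof (rule del_col[OF assms])
  fix A assume "A \<subseteq> cvs C - {x}" "A \<noteq> {}"
  then show "T + (\<Sum>v\<in>A. int 0 + int 0) + int (card {k \<in> {}::nat set. {} \<subseteq> A}) \<le> pt A"
    using sparseD[of A] by auto
qed auto

lemma full_card_le: "card {e \<in> full_clashes C \<phi> x. y \<in> e} \<le> 1" if "y \<noteq> x"
proof -
  have "{e \<in> full_clashes C \<phi> x. y \<in> e} \<subseteq> {{x, y}}"
  proof
    fix e assume "e \<in> {e \<in> full_clashes C \<phi> x. y \<in> e}"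
    then have "e \<in> ces C" "x \<in> e" "y \<in> e" by (auto simp: full_clashes_def)
    then obtain z where "z \<noteq> x" "e = {x, z}" using card2_other[OF D(5)] by metis
    then show "e \<in> {{x, y}}" using \<open>y \<in> e\<close> that by auto
  qed
  then show ?thesis using card_mono[of "{{x, y}}"] by fastforce
qed

lemma pt_insert_le:
  assumes "A \<subseteq> cvs C - {x}" "F \<subseteq> fulls C x" "\<And>e. e \<in> F \<Longrightarrow> e \<subseteq> insert x A"
    and "H \<subseteq> halves C x" "\<And>k. k \<in> H \<Longrightarrow> che C k \<subseteq> insert x A"
  shows "pt (insert x A) \<le> pt A + wt x - (int i + 1) * int (card F) - int (card H)"
proof -
  have A: "finite A" "x \<notin> A" using assms(1) finsub[of A] by auto
  have "F \<subseteq> {e \<in> fulls C x. e \<subseteq> insert x A}" "H \<subseteq> {k \<in> halves C x. che C k \<subseteq> insert x A}"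
    using assms(2-5) by blast+
  then have "card F \<le> card {e \<in> fulls C x. e \<subseteq> insert x A}" "card H \<le> card {k \<in> halves C x. che C k \<subseteq> insert x A}"
    using fin_cl(4,5) by (auto intro!: card_mono)
  then have "(int i + 1) * int (card F) \<le> (int i + 1) * int (card {e \<in> fulls C x. e \<subseteq> insert x A})"
    "int (card H) \<le> int (card {k \<in> halves C x. che C k \<subseteq> insert x A})"
    by (auto intro: mult_left_mono)
  then show ?thesis using pot_insert[OF wf A] by linarith
qed

section \<open>Vertices without half-edges and with at most two full edges\<close>

lemma not_isolated:
  assumes x: "x \<in> cvs C"
  shows "fulls C x \<noteq> {} \<or> halves C x \<noteq> {}"
proof (rule ccontr)
  assume "\<not> ?thesis"
  then have e: "full_clashes C \<phi> x = {}" "half_clashes C \<phi> x = {}" for \<phi>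
    by (auto simp: full_clashes_def half_clashes_def fulls_def halves_def)
  obtain \<phi> \<omega> where c: "col {} (modify C {x} {} {} (\<lambda>_ _. 0) {} (\<lambda>_. {}) (\<lambda>_. True)) \<phi> \<omega>"
    using del_plain[OF x] by blast
  \<comment> \<open>Weight at least \<open>T\<close> means that the capacities add up to at least
    \<open>-1\<close>, so they cannot both be negative.\<close>
  have "0 \<le> ccp C x True \<or> 0 \<le> ccp C x False"
    using wt_ge[OF x] unfolding wgt_def by linarith
  then obtain n where "0 \<le> ccp C x n" by blast
  then show False using no_extension[OF x _ _ c, of "{}" n] e by simp
qed

text \<open>The only edge clashes with just one node of \<open>x\<close>; the other node is
  free.\<close>

lemma no_leaf:
  assumes x: "x \<in> cvs C" and f: "fulls C x = {e}" and h: "halves C x = {}"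
    and c: "0 \<le> ccp C x False" "0 \<le> ccp C x True"
  shows False
proof -
  obtain \<phi> \<omega> where col: "col {} (modify C {x} {} {} (\<lambda>_ _. 0) {} (\<lambda>_. {}) (\<lambda>_. True)) \<phi> \<omega>"
    using del_plain[OF x] by blast
  have "card (full_clashes C (\<phi>(x := True)) x) + card (full_clashes C (\<phi>(x := False)) x) = 1"
    using full_clashes_split[OF wf x, of \<phi> True] f by simp
  then have "card (full_clashes C (\<phi>(x := True)) x) = 0 \<or> card (full_clashes C (\<phi>(x := False)) x) = 0"
    by linarith
  then have "full_clashes C (\<phi>(x := True)) x = {} \<or> full_clashes C (\<phi>(x := False)) x = {}"
    using fin_cl(1) by simp
  then obtain n where n: "full_clashes C (\<phi>(x := n)) x = {}" by blast
  have "half_clashes C (\<phi>(x := n)) x = {}" using h by (auto simp: half_clashes_def halves_def)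
  then show False using no_extension[OF x _ _ col, of "{}" n] n c by (cases n) simp_all
qed

text \<open>\<open>x\<close> is made rich, and its possible clash is reserved at the neighbour. A
  set containing the neighbour can afford this: adding \<open>x\<close> lowers its potential by at
  least \<open>i + 1 - wt x\<close>, which is positive, and still leaves \<open>T\<close>.\<close>

lemma no_poor_leaf:
  assumes x: "x \<in> cvs C" and f: "fulls C x = {e}" and h: "halves C x = {}"
    and c: "1 \<le> ccp C x True" and w: "wt x \<le> int i"
  shows False
proof -
  have e: "card e = 2" "x \<in> e" using f D(5)[of e] by (auto simp: fulls_def)
  let ?u = "unit_at x e (csg C e)"
  have "\<exists>\<phi> \<omega>. col {} (modify C {x} {} {} ?u {} (\<lambda>_. {}) (\<lambda>_. True)) \<phi> \<omega>"
  proof (rule del_col[OF x])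
    fix A assume A: "A \<subseteq> cvs C - {x}" "A \<noteq> {}"
    then have fA: "finite A" "x \<notin> A" using finsub[of A] by auto
    have "T + (if e \<subseteq> insert x A then 1 else 0) \<le> pt A"
    proof (cases "e \<subseteq> insert x A")
      case True
      then have "pt (insert x A) \<le> pt A + wt x - (int i + 1)"
        using pt_insert_le[OF A(1), of "{e}" "{}"] f by auto
      moreover have "T \<le> pt (insert x A)" using A x by (intro sparseD) auto
      ultimately show ?thesis using w True by simp
    next
      case False then show ?thesis using sparseD[of A] A by auto
    qed
    then show "T + (\<Sum>v\<in>A. int (?u v False) + int (?u v True)) + int (card {k \<in> {}::nat set. {} \<subseteq> A}) \<le> pt A"
      using unit_at_sum[OF e fA(2,1)] by simp
  qed auto
  then obtain \<phi> \<omega> where col: "col {} (modify C {x} {} {} ?u {} (\<lambda>_. {}) (\<lambda>_. True)) \<phi> \<omega>" by blast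
  have hc: "half_clashes C \<psi> x = {}" for \<psi> using h by (auto simp: half_clashes_def halves_def)
  have fc: "full_clashes C (\<phi>(x := True)) x \<subseteq> {e}" using f by (auto simp: full_clashes_def fulls_def)
  then have "card (full_clashes C (\<phi>(x := True)) x) \<le> 1" using card_mono[OF _ fc] by simp
  then have self: "int (card (full_clashes C (\<phi>(x := True)) x) + card (half_clashes C (\<phi>(x := True)) x) - card ({}::nat set))
      \<le> ccp C x True" using hc c by simp
  have oth: "card {e' \<in> full_clashes C (\<phi>(x := True)) x. y \<in> e'} + card {k \<in> {}. y \<in> che C k}
      \<le> ?u y (\<phi> y) + card {k \<in> {}::nat set. \<omega> k = y \<and> clash \<phi> True {}}" if y: "y \<noteq> x" for y
  proof (cases "{e' \<in> full_clashes C (\<phi>(x := True)) x. y \<in> e'} = {}")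
    case True then show ?thesis unfolding True by simp
  next
    case False
    then have "y \<in> e" "clash (\<phi>(x := True)) (csg C e) e" using fc by (auto simp: full_clashes_def)
    then have "?u y (\<phi> y) = 1" using unit_at_clash[OF e _ y] by blast
    then show ?thesis using full_card_le[OF y, of "\<phi>(x := True)"] by simp
  qed
  show False using no_extension[OF x _ _ col _ oth self] by auto
qed

text \<open>A vertex with two full edges that tolerates one clash in either colour acts like a half-edge between
  its neighbours.\<close>

lemma no_path_vertex:
  assumes x: "x \<in> cvs C" and f: "fulls C x = {e, e'}" "e \<noteq> e'" and h: "halves C x = {}"
    and c: "1 \<le> ccp C x False" "1 \<le> ccp C x True"
  shows False
proof -
  have e: "card e = 2" "x \<in> e" "card e' = 2" "x \<in> e'" "e \<in> ces C" "e' \<in> ces C"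
    using f D(5)[of e] D(5)[of e'] by (auto simp: fulls_def)
  obtain u where u: "u \<noteq> x" "e = {x, u}" using card2_other[OF e(1,2)] .
  obtain v where v: "v \<noteq> x" "e' = {x, v}" using card2_other[OF e(3,4)] .
  have uv: "u \<noteq> v" "u \<in> cvs C" "v \<in> cvs C" using u v f D(4)[OF e(5)] D(4)[OF e(6)] by auto
  obtain k where k: "k \<notin> chs C" using D(2) ex_new_if_finite infinite_UNIV_nat by blast
  \<comment> \<open>With this sign the half-edge clashes exactly when no node of \<open>x\<close>
    avoids both \<open>e\<close> and \<open>e'\<close>.\<close>
  let ?hn = "\<lambda>_::nat. {u, v}" and ?hg = "\<lambda>_::nat. csg C e \<noteq> csg C e'"
  have "\<exists>\<phi> \<omega>. col {} (modify C {x} {} {} (\<lambda>_ _. 0) {k} ?hn ?hg) \<phi> \<omega>"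
  proof (rule del_col[OF x])
    fix A assume A: "A \<subseteq> cvs C - {x}" "A \<noteq> {}"
    show "T + (\<Sum>v\<in>A. int 0 + int 0) + int (card {k' \<in> {k}. {u, v} \<subseteq> A}) \<le> pt A"
    proof (cases "{u, v} \<subseteq> A")
      case True
      then have "pt (insert x A) \<le> pt A + wt x - (int i + 1) * 2"
        using pt_insert_le[OF A(1), of "{e, e'}" "{}"] f u v by auto
      moreover have "T \<le> pt (insert x A)" using A x by (intro sparseD) auto
      \<comment> \<open>The two edges cost \<open>2 * (i + 1)\<close>, one more than the largest
        possible weight: just enough for the new half-edge.\<close>
      moreover have "wt x \<le> 2 * int i + 1" using D(9,10)[OF x] by (simp add: wgt_def)
      ultimately show ?thesis using True by simp
    next
      case False then have 0: "{k' \<in> {k}. {u, v} \<subseteq> A} = {}" by auto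
      show ?thesis unfolding 0 using sparseD[of A] A by auto
    qed
  qed (use k uv u v in auto)
  then obtain \<phi> \<omega> where col: "col {} (modify C {x} {} {} (\<lambda>_ _. 0) {k} ?hn ?hg) \<phi> \<omega>" by blast
  have hc: "half_clashes C \<psi> x = {}" for \<psi> using h by (auto simp: half_clashes_def halves_def)
  have cl: "e \<in> full_clashes C (\<phi>(x := n)) x \<longleftrightarrow> (n = \<phi> u) = csg C e"
    "e' \<in> full_clashes C (\<phi>(x := n)) x \<longleftrightarrow> (n = \<phi> v) = csg C e'" for n
    using clash_insert[of x u "\<phi>(x := n)" "csg C e"] clash_insert[of x v "\<phi>(x := n)" "csg C e'"] u v e
    by (auto simp: full_clashes_def)
  have fc: "full_clashes C (\<phi>(x := n)) x \<subseteq> {e, e'}" for n using f by (auto simp: full_clashes_def fulls_def)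
  have "\<omega> k \<in> {u, v}" using col by (auto simp: col_def)
  \<comment> \<open>If a clash is unavoidable, \<open>x\<close> takes the node for which it falls on
    the edge to \<open>\<omega> k\<close>, the end that already tolerated the clash of the
    half-edge.\<close>
  define n where "n = (if (\<phi> u = csg C e) = (\<phi> v = csg C e') then \<not> (\<phi> u = csg C e)
      else if \<omega> k = u then (\<phi> u = csg C e) else (\<phi> v = csg C e'))"
  have F: "full_clashes C (\<phi>(x := n)) x = {} \<or>
      clash \<phi> (?hg k) (?hn k) \<and> (\<omega> k = u \<and> full_clashes C (\<phi>(x := n)) x = {e}
        \<or> \<omega> k = v \<and> full_clashes C (\<phi>(x := n)) x = {e'})"
  proof (cases "(\<phi> u = csg C e) = (\<phi> v = csg C e')")
    case True
    then have "e \<notin> full_clashes C (\<phi>(x := n)) x" "e' \<notin> full_clashes C (\<phi>(x := n)) x"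
      unfolding cl by (auto simp: n_def)
    then show ?thesis using fc[of n] by auto
  next
    case False
    then have "clash \<phi> (?hg k) (?hn k)" using clash_insert[OF uv(1)] by auto
    moreover have "\<omega> k = u \<and> e \<in> full_clashes C (\<phi>(x := n)) x \<and> e' \<notin> full_clashes C (\<phi>(x := n)) x
        \<or> \<omega> k = v \<and> e \<notin> full_clashes C (\<phi>(x := n)) x \<and> e' \<in> full_clashes C (\<phi>(x := n)) x"
      unfolding cl using False \<open>\<omega> k \<in> {u, v}\<close> by (auto simp: n_def)
    ultimately show ?thesis using fc[of n] by blast
  qed
  have oth: "card {d \<in> full_clashes C (\<phi>(x := n)) x. y \<in> d} + card {k \<in> {}. y \<in> che C k}
      \<le> 0 + card {k' \<in> {k}. \<omega> k' = y \<and> clash \<phi> (?hg k') (?hn k')}" if y: "y \<noteq> x" for y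
  proof (cases "{d \<in> full_clashes C (\<phi>(x := n)) x. y \<in> d} = {}")
    case True then show ?thesis unfolding True by simp
  next
    case False
    then have "clash \<phi> (?hg k) (?hn k) \<and> \<omega> k = y" using F u v y by auto
    then have "{k' \<in> {k}. \<omega> k' = y \<and> clash \<phi> (?hg k') (?hn k')} = {k}" by auto
    then show ?thesis using full_card_le[OF y, of "\<phi>(x := n)"] by simp
  qed
  have "card (full_clashes C (\<phi>(x := n)) x) \<le> 1" using F by auto
  then have self: "int (card (full_clashes C (\<phi>(x := n)) x) + card (half_clashes C (\<phi>(x := n)) x) - card ({}::nat set))
      \<le> ccp C x n" using hc c by (cases n) simp_all
  show False using no_extension[OF x _ _ col _ oth self] k by auto
qed

text \<open>\<open>x\<close> is made rich, which tolerates both edges, and a clash is reserved at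
  each neighbour. For sets containing both neighbours the two edges pay for the weight of
  \<open>x\<close> and for both reserves. For sets containing one neighbour the edge only pays for
  the weight, and the unit comes from \<open>gap'\<close>.\<close>

lemma no_rich_path_vertex:
  assumes x: "x \<in> cvs C" and f: "fulls C x = {e, e'}" "e \<noteq> e'" and h: "halves C x = {}"
    and c: "2 \<le> ccp C x True" and w: "wt x \<le> int i + 1"
  shows False
proof -
  have e: "card e = 2" "x \<in> e" "card e' = 2" "x \<in> e'" "e \<in> ces C" "e' \<in> ces C"
    using f D(5)[of e] D(5)[of e'] by (auto simp: fulls_def)
  let ?u = "\<lambda>y b. unit_at x e (csg C e) y b + unit_at x e' (csg C e') y b"
  have "\<exists>\<phi> \<omega>. col {} (modify C {x} {} {} ?u {} (\<lambda>_. {}) (\<lambda>_. True)) \<phi> \<omega>"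
  proof (rule del_col[OF x])
    fix A assume A: "A \<subseteq> cvs C - {x}" "A \<noteq> {}"
    then have fA: "finite A" "x \<notin> A" using finsub[of A] by auto
    have TA: "T \<le> pt A" "T \<le> pt (insert x A)" using A x by (auto intro!: sparseD)
    have one: "T + 1 \<le> pt A" if d: "d \<in> {e, e'}" "d \<subseteq> insert x A" "\<not> {e, e'} \<subseteq> Pow (insert x A)" for d
    proof -
      have "insert x A \<subset> cvs C" using d(3) A x D(4)[OF e(5)] D(4)[OF e(6)] by auto
      moreover have "2 \<le> card (insert x A)" using fA A(2) card_gt_0_iff[of A] by (simp add: Suc_le_eq)
      ultimately have "T + 1 \<le> pt (insert x A)" by (rule gap')
      moreover have "pt (insert x A) \<le> pt A + wt x - (int i + 1)"
        using pt_insert_le[OF A(1), of "{d}" "{}"] f d by auto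
      ultimately show ?thesis using w by linarith
    qed
    have both: "T + 2 \<le> pt A" if "e \<subseteq> insert x A" "e' \<subseteq> insert x A"
    proof -
      have "pt (insert x A) \<le> pt A + wt x - (int i + 1) * 2"
        using pt_insert_le[OF A(1), of "{e, e'}" "{}"] f that by auto
      then show ?thesis using TA w i12 by auto
    qed
    have "T + (if e \<subseteq> insert x A then 1 else 0) + (if e' \<subseteq> insert x A then 1 else 0) \<le> pt A"
      using one[of e] one[of e'] both TA by (auto split: if_splits)
    moreover have "(\<Sum>v\<in>A. int (?u v False) + int (?u v True)) =
       (if e \<subseteq> insert x A then 1 else 0) + (if e' \<subseteq> insert x A then 1 else 0)"
      unfolding unit_at_sum[OF e(1,2) fA(2,1), of "csg C e", symmetric]
        unit_at_sum[OF e(3,4) fA(2,1), of "csg C e'", symmetric] sum.distrib[symmetric]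
      by (simp add: algebra_simps)
    ultimately show "T + (\<Sum>v\<in>A. int (?u v False) + int (?u v True)) + int (card {k \<in> {}::nat set. {} \<subseteq> A}) \<le> pt A"
      by simp
  qed auto
  then obtain \<phi> \<omega> where col: "col {} (modify C {x} {} {} ?u {} (\<lambda>_. {}) (\<lambda>_. True)) \<phi> \<omega>" by blast
  have hc: "half_clashes C \<psi> x = {}" for \<psi> using h by (auto simp: half_clashes_def halves_def)
  have fc: "full_clashes C (\<phi>(x := True)) x \<subseteq> {e, e'}" using f by (auto simp: full_clashes_def fulls_def)
  then have "card (full_clashes C (\<phi>(x := True)) x) \<le> 2" using card_mono[OF _ fc] f by (simp add: le_trans)
  then have self: "int (card (full_clashes C (\<phi>(x := True)) x) + card (half_clashes C (\<phi>(x := True)) x) - card ({}::nat set))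
      \<le> ccp C x True" using hc c by simp
  have oth: "card {e' \<in> full_clashes C (\<phi>(x := True)) x. y \<in> e'} + card {k \<in> {}. y \<in> che C k}
      \<le> ?u y (\<phi> y) + card {k \<in> {}::nat set. \<omega> k = y \<and> clash \<phi> True {}}" if y: "y \<noteq> x" for y
  proof (cases "{e' \<in> full_clashes C (\<phi>(x := True)) x. y \<in> e'} = {}")
    case True then show ?thesis unfolding True by simp
  next
    case False
    then obtain d where "y \<in> d" "clash (\<phi>(x := True)) (csg C d) d" "d = e \<or> d = e'"
      using fc by (auto simp: full_clashes_def)
    then have "1 \<le> ?u y (\<phi> y)"
      using unit_at_clash[OF e(1,2) _ y, of \<phi>] unit_at_clash[OF e(3,4) _ y, of \<phi>] by fastforce
    then show ?thesis using full_card_le[OF y, of "\<phi>(x := True)"] by simp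
  qed
  show False using no_extension[OF x _ _ col _ oth self] by auto
qed

section \<open>Deleting a half-edge: capacities and degrees at its ends\<close>

definition drop_half :: "nat \<Rightarrow> 'a config" where
  "drop_half k = modify C {} {} {k} (\<lambda>_ _. 0) {} (\<lambda>_. {}) (\<lambda>_. True)"

lemma drop_half_iff:
  "col {} (drop_half k) \<phi> \<omega> \<longleftrightarrow> (\<forall>l\<in>chs C - {k}. \<omega> l \<in> che C l) \<and>
    (\<forall>v\<in>cvs C. int (card (full_clashes C \<phi> v) + card (half_hits C \<phi> \<omega> v - {k})) \<le> ccp C v (\<phi> v))"
proof -
  have "full_clashes (drop_half k) \<phi> v = full_clashes C \<phi> v" for v
    by (auto simp: drop_half_def full_clashes_def)
  moreover have "half_hits (drop_half k) \<phi> \<omega> v = half_hits C \<phi> \<omega> v - {k}" for v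
    by (auto simp: drop_half_def half_hits_def)
  moreover have "(a \<le> max (-1) b) = (a \<le> b)" if "0 \<le> a" for a b :: int using that by auto
  ultimately show ?thesis
    unfolding col_def by (auto simp: drop_half_def)
qed

text \<open>Otherwise the half-edge could be put back at no cost, charged to either end.\<close>

lemma drop_half_clash:
  assumes k: "k \<in> chs C" and c: "col {} (drop_half k) \<phi> \<omega>"
  shows "clash \<phi> (chsg C k) (che C k)"
proof (rule ccontr)
  assume n: "\<not> ?thesis"
  obtain y where y: "y \<in> che C k" using D(7)[OF k] by fastforce
  have "half_hits C \<phi> (\<omega>(k := y)) v = half_hits C \<phi> \<omega> v - {k}" for v
    using n by (auto simp: half_hits_def)
  then have "col {} C \<phi> (\<omega>(k := y))"
    using c[unfolded drop_half_iff] y unfolding col_def by auto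
  then show False using nc unfolding conf_colorable_def by blast
qed

text \<open>Lowering by one the capacity of a node of \<open>x\<close> pays for deleting a half-edge at \<open>x\<close>; a colouring
  using this node could absorb the half-edge, so it must use the other node.\<close>

lemma drop_half_col:
  assumes k: "k \<in> chs C" "x \<in> che C k" and w: "T < wt x"
  shows "\<exists>\<phi> \<omega>. col {} (drop_half k) \<phi> \<omega> \<and> \<phi> x = n"
proof -
  define \<mu> where "\<mu> y b = (if y = x \<and> b = (\<not> n) then 1 else 0 :: nat)" for y b
  let ?M = "modify C {} {} {k} \<mu> {} (\<lambda>_. {}) (\<lambda>_. True)"
  have "\<exists>\<phi> \<omega>. col {} ?M \<phi> \<omega>"
  proof (rule ccontr)
    assume "\<not> ?thesis"
    then have nn: "\<not> col {} ?M \<phi> \<omega>" for \<phi> \<omega> by blast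
    have "\<exists>A. A \<subseteq> cvs C - {} \<and> A \<noteq> {} \<and> pt A + int (card {l \<in> {k} \<inter> chs C. che C l \<subseteq> A}) <
      T + (\<Sum>v\<in>A. int (\<mu> v False) + int (\<mu> v True)) + int (card {l \<in> {}::nat set. {} \<subseteq> A})"
      using k(1) by (intro reduce[OF _ _ _ _ _ nn]) auto
    then obtain A where A: "A \<subseteq> cvs C" "A \<noteq> {}" and
      lt: "pt A + int (card {l \<in> {k} \<inter> chs C. che C l \<subseteq> A}) < T + (\<Sum>v\<in>A. int (\<mu> v False) + int (\<mu> v True))"
      by auto
    have "int (\<mu> v False) + int (\<mu> v True) = (if v = x then 1 else 0)" for v by (auto simp: \<mu>_def)
    then have s: "(\<Sum>v\<in>A. int (\<mu> v False) + int (\<mu> v True)) = (if x \<in> A then 1 else 0)"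
      using finsub[OF A(1)] by simp
    have TA: "T \<le> pt A" using A by (rule sparseD)
    have xA: "x \<in> A" using lt s TA by (auto split: if_splits)
    show False
    proof (cases "che C k \<subseteq> A")
      case True
      then have "{l \<in> {k} \<inter> chs C. che C l \<subseteq> A} = {k}" using k(1) by auto
      then show False using lt s TA xA by simp
    next
      \<comment> \<open>Now \<open>A\<close> misses the other end of \<open>k\<close>, so it is
        proper and \<open>low\<close> supplies the unit that the deletion of \<open>k\<close> does
        not.\<close>
      case False
      then have "A \<subset> cvs C" using A(1) D(6)[OF k(1)] by auto
      then have "T + 1 \<le> pt A" using low xA w by blast
      then show False using lt s xA by simp
    qed
  qed
  then obtain \<phi> \<omega> where c: "col {} ?M \<phi> \<omega>" by blast
  have fc: "full_clashes ?M \<phi> v = full_clashes C \<phi> v" for v by (auto simp: full_clashes_def)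
  have hh: "half_hits ?M \<phi> \<omega> v = half_hits C \<phi> \<omega> v - {k}" for v by (auto simp: half_hits_def)
  have cap: "int (card (full_clashes C \<phi> v) + card (half_hits C \<phi> \<omega> v - {k})) \<le> ccp C v (\<phi> v) - int (\<mu> v (\<phi> v))"
    if "v \<in> cvs C" for v
  proof -
    have "int (card (full_clashes C \<phi> v) + card (half_hits C \<phi> \<omega> v - {k})) \<le> max (-1) (ccp C v (\<phi> v) - int (\<mu> v (\<phi> v)))"
      using c that unfolding col_def fc hh by auto
    then show ?thesis by linarith
  qed
  have \<omega>: "\<omega> l \<in> che C l" if "l \<in> chs C" "l \<noteq> k" for l using c that unfolding col_def by auto
  have "\<phi> x = n"
  proof (rule ccontr)
    assume "\<phi> x \<noteq> n"
    then have "\<mu> x (\<phi> x) = 1" by (auto simp: \<mu>_def)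
    let ?\<omega> = "\<omega>(k := x)"
    have "int (card (full_clashes C \<phi> v) + card (half_hits C \<phi> ?\<omega> v)) \<le> ccp C v (\<phi> v)" if "v \<in> cvs C" for v
    proof (cases "v = x")
      case True
      have "half_hits C \<phi> ?\<omega> x \<subseteq> insert k (half_hits C \<phi> \<omega> x - {k})" by (auto simp: half_hits_def)
      then have "card (half_hits C \<phi> ?\<omega> x) \<le> card (insert k (half_hits C \<phi> \<omega> x - {k}))"
        using fin_cl(3) by (intro card_mono) auto
      also have "\<dots> = Suc (card (half_hits C \<phi> \<omega> x - {k}))"
        using fin_cl(3)[of \<phi> \<omega> x] by (subst card_insert_disjoint) auto
      finally show ?thesis using cap[OF that] \<open>\<mu> x (\<phi> x) = 1\<close> True by simp
    next
      case False
      then have "half_hits C \<phi> ?\<omega> v = half_hits C \<phi> \<omega> v - {k}" by (auto simp: half_hits_def)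
      then show ?thesis using cap[OF that] by simp
    qed
    then have "col {} C \<phi> ?\<omega>" using \<omega> k(2) unfolding col_def by auto
    then show False using nc unfolding conf_colorable_def by blast
  qed
  moreover have "col {} (drop_half k) \<phi> \<omega>"
    unfolding drop_half_iff using \<omega> cap by force
  ultimately show ?thesis by blast
qed

lemma drop_half_cap:
  assumes "col {} (drop_half k) \<phi> \<omega>" "v \<in> cvs C"
  shows "0 \<le> ccp C v (\<phi> v)"
proof -
  have "int (card (full_clashes C \<phi> v) + card (half_hits C \<phi> \<omega> v - {k})) \<le> ccp C v (\<phi> v)"
    using assms unfolding drop_half_iff by blast
  then show ?thesis by linarith
qed

text \<open>If \<open>x\<close> had weight \<open>T\<close>, its partner \<open>u\<close> would not,
  so \<open>u\<close> could be coloured at will in the absence of \<open>k\<close>. As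
  \<open>k\<close> clashes in all these colourings, \<open>x\<close> would take both colours; then
  both capacities are nonnegative, and its weight exceeds \<open>T\<close> after all.\<close>

lemma half_nontight:
  assumes k: "k \<in> chs C" "x \<in> che C k"
  shows "T < wt x"
proof (rule ccontr)
  assume n: "\<not> ?thesis"
  obtain u where u: "u \<noteq> x" "che C k = {x, u}" using card2_other[OF D(7)[OF k(1)] k(2)] .
  have v: "x \<in> cvs C" "u \<in> cvs C" using D(6)[OF k(1)] u by auto
  have wu: "T < wt u" using two_tight[of x u] n u v by auto
  have "0 \<le> ccp C x b" for b
  proof -
    obtain \<phi> \<omega> where c: "col {} (drop_half k) \<phi> \<omega>" "\<phi> u = (b = chsg C k)"
      using drop_half_col[OF k(1) _ wu] u by blast
    have "(\<phi> x = \<phi> u) = chsg C k"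
      using drop_half_clash[OF k(1) c(1)] u clash_insert[of x u] by simp
    then have "\<phi> x = b" using c(2) by auto
    then show ?thesis using drop_half_cap[OF c(1) v(1)] by simp
  qed
  from this[of True] this[of False] have "T < wt x" unfolding wgt_def by linarith
  then show False using n by simp
qed

lemma half_caps:
  assumes k: "k \<in> chs C" "x \<in> che C k"
  shows "0 \<le> ccp C x n"
proof -
  obtain \<phi> \<omega> where "col {} (drop_half k) \<phi> \<omega>" "\<phi> x = n"
    using drop_half_col[OF k half_nontight[OF k]] by blast
  then show ?thesis using drop_half_cap D(6)[OF k(1)] k(2) by blast
qed

text \<open>A neighbour \<open>y\<close> of weight \<open>T\<close> would have capacities
  \<open>0\<close> and \<open>-1\<close>, hence a fixed colour and no clash. But \<open>x\<close>
  can be given either colour in the absence of \<open>k\<close>, and one of them makes the full edge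
  to \<open>y\<close> clash.\<close>

lemma half_full_nontight:
  assumes k: "k \<in> chs C" "x \<in> che C k" and e: "e \<in> ces C" "x \<in> e" "y \<in> e" "y \<noteq> x"
  shows "T < wt y"
proof (rule ccontr)
  assume n: "\<not> ?thesis"
  have y: "y \<in> cvs C" using D(4)[OF e(1)] e(3) by auto
  have ex: "e = {x, y}" using card2_other[OF D(5)[OF e(1)] e(2)] e(3,4) by (metis insertE singletonD)
  have s: "ccp C y False + ccp C y True \<le> - 1" using n unfolding wgt_def by linarith
  have *: "ccp C y (\<phi> y) = 0 \<and> ccp C y (\<not> \<phi> y) = -1 \<and> (\<phi> x = \<phi> y) \<noteq> csg C e"
    if c: "col {} (drop_half k) \<phi> \<omega>" for \<phi> \<omega>
  proof -
    have h: "int (card (full_clashes C \<phi> y) + card (half_hits C \<phi> \<omega> y - {k})) \<le> ccp C y (\<phi> y)"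
      using c y unfolding drop_half_iff by blast
    have "ccp C y False \<ge> -1" "ccp C y True \<ge> -1" using D(8)[OF y] by auto
    then have 0: "ccp C y (\<phi> y) = 0 \<and> ccp C y (\<not> \<phi> y) = -1"
      using drop_half_cap[OF c y] s by (cases "\<phi> y") auto
    then have "card (full_clashes C \<phi> y) = 0" using h by linarith
    then have "full_clashes C \<phi> y = {}" using fin_cl(1) by simp
    then have "\<not> clash \<phi> (csg C e) {x, y}" using e(1) ex by (auto simp: full_clashes_def)
    then show ?thesis using 0 clash_insert[of x y] e(4) by auto
  qed
  obtain \<phi> \<omega> where 1: "col {} (drop_half k) \<phi> \<omega>" "\<phi> x = True"
    using drop_half_col[OF k half_nontight[OF k]] by blast
  obtain \<psi> \<nu> where 2: "col {} (drop_half k) \<psi> \<nu>" "\<psi> x = False"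
    using drop_half_col[OF k half_nontight[OF k]] by blast
  have "\<phi> y = \<psi> y" using *[OF 1(1)] *[OF 2(1)] by (cases "\<phi> y"; cases "\<psi> y") auto
  then show False using *[OF 1(1)] *[OF 2(1)] 1(2) 2(2) by auto
qed

text \<open>Start from a colouring without \<open>k\<close> in which \<open>x\<close> has colour
  \<open>n\<close>, and put \<open>x\<close> back charging all its half-edge clashes to
  \<open>x\<close>. With \<open>n\<close> this fails only by overloading \<open>x\<close>; with the
  other node it can also fail by a new clash on an edge of \<open>outer x\<close>.\<close>

lemma half_clashing:
  assumes k: "k \<in> chs C" "x \<in> che C k"
  shows "\<exists>\<phi>. ccp C x n < int (card (full_clashes C (\<phi>(x := n)) x) + card (half_clashes C (\<phi>(x := n)) x)) \<and>
    (ccp C x (\<not> n) < int (card (full_clashes C (\<phi>(x := (\<not> n))) x) + card (half_clashes C (\<phi>(x := (\<not> n))) x))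
      \<or> (\<exists>e \<in> full_clashes C (\<phi>(x := (\<not> n))) x. e \<in> outer x))"
proof -
  have x: "x \<in> cvs C" using D(6)[OF k(1)] k(2) by auto
  obtain \<phi> \<omega> where c: "col {} (drop_half k) \<phi> \<omega>" and n: "\<phi> x = n"
    using drop_half_col[OF k half_nontight[OF k]] by blast
  have \<phi>: "\<phi>(x := n) = \<phi>" using n by auto
  \<comment> \<open>The present clashes with \<open>x\<close> are reserved at the neighbours, so
    restoring the colour \<open>n\<close> costs them nothing.\<close>
  define \<mu> where "\<mu> y b = (if b = \<phi> y then card {e \<in> full_clashes C \<phi> x. y \<in> e} else 0)" for y b
  let ?M = "modify C {x} {} {} \<mu> {} (\<lambda>_. {}) (\<lambda>_. True)"
  have cM: "col {} ?M \<phi> \<omega>"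
  proof -
    have "\<omega> l \<in> che ?M l" if "l \<in> chs ?M" for l
    proof -
      have "l \<noteq> k" using that k(2) by auto
      then show ?thesis using c that unfolding drop_half_iff by auto
    qed
    moreover have "int (card (full_clashes ?M \<phi> v) + card (half_hits ?M \<phi> \<omega> v)) \<le> ccp ?M v (\<phi> v)" if v: "v \<in> cvs ?M - {}" for v
    proof -
      let ?F = "{e \<in> full_clashes C \<phi> x. v \<in> e}"
      have "full_clashes ?M \<phi> v \<inter> ?F = {}" by (auto simp: full_clashes_def)
      moreover have "full_clashes ?M \<phi> v \<union> ?F \<subseteq> full_clashes C \<phi> v" by (auto simp: full_clashes_def)
      then have "card (full_clashes ?M \<phi> v \<union> ?F) \<le> card (full_clashes C \<phi> v)"
        using fin_cl(1) by (intro card_mono)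
      moreover have "finite (full_clashes ?M \<phi> v)"
        using fin_cl(1)[of \<phi> v] by (rule rev_finite_subset) (auto simp: full_clashes_def)
      ultimately have 1: "card (full_clashes ?M \<phi> v) + card ?F \<le> card (full_clashes C \<phi> v)"
        using fin_cl(1)[of \<phi> x] by (simp add: card_Un_disjoint)
      have 2: "card (half_hits ?M \<phi> \<omega> v) \<le> card (half_hits C \<phi> \<omega> v - {k})"
        using fin_cl(3) k(2) by (intro card_mono) (auto simp: half_hits_def)
      have "int (card (full_clashes C \<phi> v) + card (half_hits C \<phi> \<omega> v - {k})) \<le> ccp C v (\<phi> v)"
        using c v unfolding drop_half_iff by auto
      then have "int (card (full_clashes ?M \<phi> v) + card (half_hits ?M \<phi> \<omega> v)) \<le> ccp C v (\<phi> v) - int (\<mu> v (\<phi> v))"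
        using 1 2 unfolding \<mu>_def by simp
      then show ?thesis by simp
    qed
    ultimately show ?thesis unfolding col_def by blast
  qed
  have "ccp C x n < int (card (full_clashes C (\<phi>(x := n)) x) + card (half_clashes C (\<phi>(x := n)) x))"
  proof (rule ccontr)
    assume a: "\<not> ?thesis"
    show False
      by (rule no_extension[OF x _ _ cM, of "{}" n]) (use a in \<open>auto simp: \<phi> \<mu>_def\<close>)
  qed
  moreover have "ccp C x (\<not> n) < int (card (full_clashes C (\<phi>(x := (\<not> n))) x) + card (half_clashes C (\<phi>(x := (\<not> n))) x))"
    if o: "\<not> (\<exists>e \<in> full_clashes C (\<phi>(x := (\<not> n))) x. e \<in> outer x)"
  proof (rule ccontr)
    assume a: "\<not> ?thesis"
    have e0: "{e \<in> full_clashes C (\<phi>(x := (\<not> n))) x. y \<in> e} = {}" if "y \<noteq> x" "y \<notin> Qs" for y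
      using o that unfolding outer_def fulls_def full_clashes_def by blast
    show False
      by (rule no_extension[OF x _ _ cM, of "{}" "\<not> n"]) (use a in \<open>auto simp: e0\<close>)
  qed
  ultimately show ?thesis by blast
qed

text \<open>Add up the clashes of the two nodes. If both are overloaded, the second bound follows.
  For the first, the poor node has at least one clash in any case: it exceeds a nonnegative capacity
  or clashes on an outer edge.\<close>

lemma half_degree:
  assumes k: "k \<in> chs C" "x \<in> che C k"
  shows "ccp C x True + 2 \<le> int (card (fulls C x) + card (halves C x))"
    and "outer x = {} \<Longrightarrow> ccp C x False + ccp C x True + 2 \<le> int (card (fulls C x) + card (halves C x))"
proof -
  have x: "x \<in> cvs C" using D(6)[OF k(1)] k(2) by auto
  obtain \<phi> where \<phi>: "ccp C x True < int (card (full_clashes C (\<phi>(x := True)) x) + card (half_clashes C (\<phi>(x := True)) x))"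
    "ccp C x False < int (card (full_clashes C (\<phi>(x := False)) x) + card (half_clashes C (\<phi>(x := False)) x))
      \<or> (\<exists>e \<in> full_clashes C (\<phi>(x := False)) x. e \<in> outer x)"
    using half_clashing[OF k, of True] by auto
  note sp = full_clashes_split[OF wf x, of \<phi> True] half_clashes_split[OF wf x, of \<phi> True]
  show "outer x = {} \<Longrightarrow> ccp C x False + ccp C x True + 2 \<le> int (card (fulls C x) + card (halves C x))"
    using \<phi> sp by auto
  show "ccp C x True + 2 \<le> int (card (fulls C x) + card (halves C x))"
  proof (cases "full_clashes C (\<phi>(x := False)) x = {}")
    case True then show ?thesis using \<phi> sp half_caps[OF k, of False] by auto
  next
    case False
    then have "1 \<le> card (full_clashes C (\<phi>(x := False)) x)"
      using fin_cl(1) by (simp add: Suc_le_eq card_gt_0_iff)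
    then show ?thesis using \<phi>(1) sp by auto
  qed
qed

end

section \<open>Double counting and orientations with bounded indegree\<close>

lemma double_count:
  assumes "finite V" "finite E"
  shows "(\<Sum>v\<in>V. card {e \<in> E. v \<in> g e}) = (\<Sum>e\<in>E. card (g e \<inter> V))"
proof -
  have "(\<Sum>v\<in>V. card {e \<in> E. v \<in> g e}) = (\<Sum>v\<in>V. \<Sum>e\<in>E. if v \<in> g e then 1 else 0)"
    using assms(2) by (intro sum.cong refl) (simp add: sum.If_cases Int_def)
  also have "\<dots> = (\<Sum>e\<in>E. \<Sum>v\<in>V. if v \<in> g e then 1 else 0)" by (rule sum.swap)
  also have "\<dots> = (\<Sum>e\<in>E. card (g e \<inter> V))"
    using assms(1) by (intro sum.cong refl) (simp add: sum.If_cases Int_commute Int_def conj_commute)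
  finally show ?thesis .
qed

text \<open>A Hakimi-type orientation theorem, by induction on the edges. If a new edge can be
  charged to neither of its ends, each end lies in a set with no room left that avoids the other
  end. These sets uncross, and their union spans the new edge as well, which is one edge too
  many.\<close>

lemma orientation_exists:
  fixes \<kappa> :: "'a \<Rightarrow> int"
  assumes "finite L" "finite V" "\<And>k. k \<in> L \<Longrightarrow> g k \<subseteq> V \<and> card (g k) = 2"
    and "\<And>B. B \<subseteq> V \<Longrightarrow> int (card {k \<in> L. g k \<subseteq> B}) \<le> (\<Sum>v\<in>B. \<kappa> v)"
  shows "\<exists>\<omega>. (\<forall>k\<in>L. \<omega> k \<in> g k) \<and> (\<forall>v\<in>V. int (card {k \<in> L. \<omega> k = v}) \<le> \<kappa> v)"
  using assms(1,3,4)
proof (induction L arbitrary: \<kappa> rule: finite_induct)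
  case empty
  have "0 \<le> \<kappa> v" if "v \<in> V" for v using empty(2)[of "{v}"] that by simp
  then show ?case by simp
next
  case (insert k L)
  obtain p q where pq: "p \<noteq> q" "g k = {p, q}" using insert.prems(1)[of k] by (auto simp: card_2_iff)
  have pV: "p \<in> V" "q \<in> V" using insert.prems(1)[of k] pq by auto
  have fB: "finite B" if "B \<subseteq> V" for B using that assms(2) by (rule finite_subset)
  let ?c = "\<lambda>B. int (card {l \<in> L. g l \<subseteq> B})"
  have cnt: "?c B + (if p \<in> B \<and> q \<in> B then 1 else 0) \<le> (\<Sum>v\<in>B. \<kappa> v)" if "B \<subseteq> V" for B
  proof (cases "p \<in> B \<and> q \<in> B")
    case True
    then have "{l \<in> insert k L. g l \<subseteq> B} = insert k {l \<in> L. g l \<subseteq> B}" using pq by auto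
    then show ?thesis using insert.prems(2)[OF that] insert.hyps True by simp
  next
    case False
    then have "{l \<in> insert k L. g l \<subseteq> B} = {l \<in> L. g l \<subseteq> B}" using pq by auto
    then have "?c B \<le> (\<Sum>v\<in>B. \<kappa> v)" using insert.prems(2)[OF that] by simp
    moreover have "(if p \<in> B \<and> q \<in> B then 1 else 0 :: int) = 0" using False by (rule if_not_P)
    ultimately show ?thesis by linarith
  qed
  have upd: "(\<Sum>v\<in>B. (\<kappa>(z := \<kappa> z - 1)) v) = (\<Sum>v\<in>B. \<kappa> v) - (if z \<in> B then 1 else 0)" if "B \<subseteq> V" for B z
  proof -
    have "(\<Sum>v\<in>B. (\<kappa>(z := \<kappa> z - 1)) v) = (\<Sum>v\<in>B. \<kappa> v - (if v = z then 1 else 0))"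
      by (intro sum.cong) auto
    also have "\<dots> = (\<Sum>v\<in>B. \<kappa> v) - (if z \<in> B then 1 else 0)"
      using fB[OF that] by (simp add: sum_subtractf)
    finally show ?thesis .
  qed
  have "\<exists>z\<in>{p, q}. \<forall>B\<subseteq>V. ?c B \<le> (\<Sum>v\<in>B. (\<kappa>(z := \<kappa> z - 1)) v)"
  proof (rule ccontr)
    assume "\<not> ?thesis"
    then obtain P R where P: "P \<subseteq> V" "(\<Sum>v\<in>P. (\<kappa>(p := \<kappa> p - 1)) v) < ?c P"
      and R: "R \<subseteq> V" "(\<Sum>v\<in>R. (\<kappa>(q := \<kappa> q - 1)) v) < ?c R"
      by (auto simp: not_le)
    have 1: "(\<Sum>v\<in>P. \<kappa> v) \<le> ?c P" "p \<in> P" "q \<notin> P"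
      using P(2) cnt[OF P(1)] unfolding upd[OF P(1)] by (auto split: if_splits)
    have 2: "(\<Sum>v\<in>R. \<kappa> v) \<le> ?c R" "q \<in> R" "p \<notin> R"
      using R(2) cnt[OF R(1)] unfolding upd[OF R(1)] by (auto split: if_splits)
    have "?c (P \<union> R) + 1 \<le> (\<Sum>v\<in>P \<union> R. \<kappa> v)" "?c (P \<inter> R) \<le> (\<Sum>v\<in>P \<inter> R. \<kappa> v)"
      using cnt[of "P \<union> R"] cnt[of "P \<inter> R"] P(1) R(1) 1 2 by (auto split: if_splits)
    moreover have "(\<Sum>v\<in>P \<union> R. \<kappa> v) + (\<Sum>v\<in>P \<inter> R. \<kappa> v) = (\<Sum>v\<in>P. \<kappa> v) + (\<Sum>v\<in>R. \<kappa> v)"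
      using fB P R by (intro sum.union_inter) auto
    moreover have "?c P + ?c R \<le> ?c (P \<union> R) + ?c (P \<inter> R)"
      using card_subset_supermodular[OF insert.hyps(1), of g P R] by linarith
    ultimately show False using 1 2 by linarith
  qed
  then obtain z where z: "z \<in> {p, q}" "\<And>B. B \<subseteq> V \<Longrightarrow> ?c B \<le> (\<Sum>v\<in>B. (\<kappa>(z := \<kappa> z - 1)) v)" by blast
  obtain \<omega> where \<omega>: "\<forall>l\<in>L. \<omega> l \<in> g l" "\<forall>v\<in>V. int (card {l \<in> L. \<omega> l = v}) \<le> (\<kappa>(z := \<kappa> z - 1)) v"
    using insert.IH[of "\<kappa>(z := \<kappa> z - 1)"] insert.prems(1) z(2) by blast
  let ?\<omega> = "\<omega>(k := z)"
  have "int (card {l \<in> insert k L. ?\<omega> l = v}) \<le> \<kappa> v" if "v \<in> V" for v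
  proof (cases "v = z")
    case True
    then have "{l \<in> insert k L. ?\<omega> l = v} = insert k {l \<in> L. \<omega> l = v}" using insert.hyps(2) by auto
    then show ?thesis using \<omega>(2) that True insert.hyps by auto
  next
    case False
    then have "{l \<in> insert k L. ?\<omega> l = v} = {l \<in> L. \<omega> l = v}" using insert.hyps(2) by auto
    then show ?thesis using \<omega>(2) that False by auto
  qed
  moreover have "\<forall>l\<in>insert k L. ?\<omega> l \<in> g l" using \<omega>(1) z(1) pq insert.hyps(2) by auto
  ultimately show ?case by blast
qed

section \<open>Discharging\<close>

context minimal_counterexample begin

text \<open>A full clash burdens both of its ends, a half clash only one; with these weights the
  change under recolouring one vertex is twice the change of its full clashes, plus that of its half
  clashes, minus twice that of its capacity. The summand \<open>int j\<close> makes the energy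
  nonnegative, so that a minimum exists.\<close>

definition energy :: "('a \<Rightarrow> bool) \<Rightarrow> int" where
  "energy \<phi> = 2 * int (card {e \<in> ces C. clash \<phi> (csg C e) e}) + int (card {k \<in> chs C. clash \<phi> (chsg C k) (che C k)})
     + 2 * (\<Sum>v\<in>cvs C. int j - ccp C v (\<phi> v))"

lemma cap_le_j: "v \<in> cvs C \<Longrightarrow> ccp C v b \<le> int j"
  using D(9,10)[of v] ji by (cases b) auto

lemma energy_nonneg: "0 \<le> energy \<phi>"
  using cap_le_j unfolding energy_def by (auto intro!: add_nonneg_nonneg sum_nonneg)

lemma energy_flip:
  assumes v: "v \<in> cvs C"
  shows "energy (\<phi>(v := (\<not> \<phi> v))) - energy \<phi> =
    2 * int (card (full_clashes C (\<phi>(v := (\<not> \<phi> v))) v)) - 2 * int (card (full_clashes C \<phi> v))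
    + int (card (half_clashes C (\<phi>(v := (\<not> \<phi> v))) v)) - int (card (half_clashes C \<phi> v))
    - 2 * ccp C v (\<not> \<phi> v) + 2 * ccp C v (\<phi> v)"
proof -
  let ?\<psi> = "\<phi>(v := (\<not> \<phi> v))"
  have E: "card {e \<in> ces C. clash \<psi> (csg C e) e} =
      card {e \<in> ces C. v \<notin> e \<and> clash \<phi> (csg C e) e} + card (full_clashes C \<psi> v)"
    if "\<psi> = \<phi> \<or> \<psi> = ?\<psi>" for \<psi>
  proof -
    have "{e \<in> ces C. clash \<psi> (csg C e) e} = {e \<in> ces C. v \<notin> e \<and> clash \<phi> (csg C e) e} \<union> full_clashes C \<psi> v"
      using that clash_upd_notin[of v] unfolding full_clashes_def by blast
    moreover have "{e \<in> ces C. v \<notin> e \<and> clash \<phi> (csg C e) e} \<inter> full_clashes C \<psi> v = {}"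
      by (auto simp: full_clashes_def)
    ultimately show ?thesis using D(3) fin_cl(1) by (simp add: card_Un_disjoint)
  qed
  have H: "card {k \<in> chs C. clash \<psi> (chsg C k) (che C k)} =
      card {k \<in> chs C. v \<notin> che C k \<and> clash \<phi> (chsg C k) (che C k)} + card (half_clashes C \<psi> v)"
    if "\<psi> = \<phi> \<or> \<psi> = ?\<psi>" for \<psi>
  proof -
    have "{k \<in> chs C. clash \<psi> (chsg C k) (che C k)} =
        {k \<in> chs C. v \<notin> che C k \<and> clash \<phi> (chsg C k) (che C k)} \<union> half_clashes C \<psi> v"
      using that clash_upd_notin[of v] unfolding half_clashes_def by blast
    moreover have "{k \<in> chs C. v \<notin> che C k \<and> clash \<phi> (chsg C k) (che C k)} \<inter> half_clashes C \<psi> v = {}"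
      by (auto simp: half_clashes_def)
    ultimately show ?thesis using D(2) fin_cl(2) by (simp add: card_Un_disjoint)
  qed
  have "(\<Sum>u\<in>cvs C. int j - ccp C u (?\<psi> u)) = int j - ccp C v (\<not> \<phi> v) + (\<Sum>u\<in>cvs C - {v}. int j - ccp C u (\<phi> u))"
    "(\<Sum>u\<in>cvs C. int j - ccp C u (\<phi> u)) = int j - ccp C v (\<phi> v) + (\<Sum>u\<in>cvs C - {v}. int j - ccp C u (\<phi> u))"
    using D(1) v by (simp_all add: sum.remove)
  then show ?thesis
    unfolding energy_def E[OF disjI1[OF refl]] E[OF disjI2[OF refl]] H[OF disjI1[OF refl]] H[OF disjI2[OF refl]]
    by simp
qed

text \<open>Take a colouring of minimum energy. No orientation of its clashing half-edges respects the
  capacities, so a Hall-type obstruction \<open>B\<close> exists; adding up the local optimality conditions over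
  \<open>B\<close> bounds the degrees from below.\<close>

lemma overloaded_set:
  "\<exists>B. B \<subseteq> cvs C \<and> B \<noteq> {} \<and>
    4 \<le> (\<Sum>v\<in>B. 2 * int (card (fulls C v)) + int (card (halves C v)) - 2 * (ccp C v False + ccp C v True))"
proof -
  obtain \<phi> where "\<forall>\<psi>. nat (energy \<phi>) \<le> nat (energy \<psi>)"
    using ex_has_least_nat[of "\<lambda>_. True" undefined "\<lambda>\<phi>. nat (energy \<phi>)"] by auto
  then have min: "energy \<phi> \<le> energy \<psi>" for \<psi> using energy_nonneg by (simp add: nat_le_eq_zle)
  define L where "L = {k \<in> chs C. clash \<phi> (chsg C k) (che C k)}"
  define \<kappa> where "\<kappa> v = ccp C v (\<phi> v) - int (card (full_clashes C \<phi> v))" for v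
  have fL: "finite L" using D(2) by (simp add: L_def)
  have "\<exists>B\<subseteq>cvs C. (\<Sum>v\<in>B. \<kappa> v) < int (card {k \<in> L. che C k \<subseteq> B})"
  proof (rule ccontr)
    assume "\<not> ?thesis"
    then have "\<exists>\<omega>. (\<forall>k\<in>L. \<omega> k \<in> che C k) \<and> (\<forall>v\<in>cvs C. int (card {k \<in> L. \<omega> k = v}) \<le> \<kappa> v)"
      using D(6,7) by (intro orientation_exists[OF fL D(1)]) (auto simp: L_def not_less)
    then obtain \<omega> where \<omega>: "\<forall>k\<in>L. \<omega> k \<in> che C k" "\<forall>v\<in>cvs C. int (card {k \<in> L. \<omega> k = v}) \<le> \<kappa> v" by blast
    define \<nu> where "\<nu> k = (if k \<in> L then \<omega> k else SOME y. y \<in> che C k)" for k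
    have "\<nu> k \<in> che C k" if "k \<in> chs C" for k
    proof -
      have "che C k \<noteq> {}" using D(7)[OF that] by auto
      then show ?thesis using \<omega>(1) some_in_eq by (auto simp: \<nu>_def)
    qed
    moreover have "half_hits C \<phi> \<nu> v = {k \<in> L. \<omega> k = v}" for v by (auto simp: half_hits_def L_def \<nu>_def)
    ultimately have "col {} C \<phi> \<nu>" using \<omega>(2) unfolding col_def \<kappa>_def by force
    then show False using nc unfolding conf_colorable_def by blast
  qed
  then obtain B where B: "B \<subseteq> cvs C" "(\<Sum>v\<in>B. \<kappa> v) < int (card {k \<in> L. che C k \<subseteq> B})" by blast
  have "B \<noteq> {}"
  proof
    assume "B = {}"
    moreover have "che C k \<noteq> {}" if "k \<in> L" for k using D(7)[of k] that by (auto simp: L_def)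
    ultimately have E: "{k \<in> L. che C k \<subseteq> B} = {}" by auto
    have "(\<Sum>v\<in>B. \<kappa> v) = 0" using \<open>B = {}\<close> by simp
    then show False using B(2) unfolding E by simp
  qed
  \<comment> \<open>By optimality the local cost at \<open>v\<close>,
    \<open>2 * full + half - 2 * capacity\<close>, is no larger than after recolouring. Hence twice
    its value is at most the sum for both colours, which does not depend on
    \<open>\<phi>\<close>.\<close>
  have flip: "4 * int (card (full_clashes C \<phi> v)) + 2 * int (card (half_clashes C \<phi> v)) - 4 * ccp C v (\<phi> v)
      \<le> 2 * int (card (fulls C v)) + int (card (halves C v)) - 2 * (ccp C v False + ccp C v True)" if v: "v \<in> cvs C" for v
  proof -
    have \<phi>: "\<phi>(v := \<phi> v) = \<phi>" by simp
    have "0 \<le> energy (\<phi>(v := (\<not> \<phi> v))) - energy \<phi>" using min by simp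
    moreover have "int (card (full_clashes C \<phi> v)) + int (card (full_clashes C (\<phi>(v := (\<not> \<phi> v))) v)) = int (card (fulls C v))"
      using full_clashes_split[OF wf v, of \<phi> "\<phi> v"] unfolding \<phi> by linarith
    moreover have "int (card (half_clashes C \<phi> v)) + int (card (half_clashes C (\<phi>(v := (\<not> \<phi> v))) v)) = int (card (halves C v))"
      using half_clashes_split[OF wf v, of \<phi> "\<phi> v"] unfolding \<phi> by linarith
    moreover have "ccp C v (\<not> \<phi> v) + ccp C v (\<phi> v) = ccp C v False + ccp C v True" by (cases "\<phi> v") auto
    moreover have "4 * a + 2 * c - 4 * p \<le> 2 * f + h - 2 * s"
      if "0 \<le> E" "E = 2 * b - 2 * a + d - c - 2 * q + 2 * p" "a + b = f" "c + d = h" "q + p = s"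
      for a b c d p q f h s E :: int using that by linarith
    ultimately show ?thesis using energy_flip[OF v, of \<phi>] by blast
  qed
  have fB: "finite B" using B(1) finsub by blast
  have "2 * card {k \<in> L. che C k \<subseteq> B} = (\<Sum>k\<in>{k \<in> L. che C k \<subseteq> B}. card (che C k \<inter> B))"
  proof -
    have "card (che C k \<inter> B) = 2" if "k \<in> {k \<in> L. che C k \<subseteq> B}" for k
      using that D(7) by (auto simp: L_def Int_absorb2)
    then show ?thesis by simp
  qed
  also have "\<dots> \<le> (\<Sum>k\<in>L. card (che C k \<inter> B))" using fL by (intro sum_mono2) auto
  also have "\<dots> = (\<Sum>v\<in>B. card {k \<in> L. v \<in> che C k})" using double_count[OF fB fL, of "che C"] by simp
  also have "\<dots> = (\<Sum>v\<in>B. card (half_clashes C \<phi> v))"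
    by (intro sum.cong refl arg_cong[where f = card]) (auto simp: half_clashes_def L_def)
  finally have h: "2 * int (card {k \<in> L. che C k \<subseteq> B}) \<le> (\<Sum>v\<in>B. int (card (half_clashes C \<phi> v)))"
    by (simp add: of_nat_sum[symmetric] del: of_nat_sum)
  have "(\<Sum>v\<in>B. 4 * int (card (full_clashes C \<phi> v)) + 2 * int (card (half_clashes C \<phi> v)) - 4 * ccp C v (\<phi> v))
      \<le> (\<Sum>v\<in>B. 2 * int (card (fulls C v)) + int (card (halves C v)) - 2 * (ccp C v False + ccp C v True))"
    using flip B(1) by (intro sum_mono) auto
  moreover have "(\<Sum>v\<in>B. 4 * int (card (full_clashes C \<phi> v)) + 2 * int (card (half_clashes C \<phi> v)) - 4 * ccp C v (\<phi> v))
      = 2 * (\<Sum>v\<in>B. int (card (half_clashes C \<phi> v))) - 4 * (\<Sum>v\<in>B. \<kappa> v)"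
    unfolding \<kappa>_def sum_distrib_left sum_subtractf[symmetric] by (intro sum.cong) auto
  \<comment> \<open>\<open>B\<close> violates the Hall condition by at least 1, which the factor 4
    turns into the stated constant.\<close>
  ultimately show ?thesis using B \<open>B \<noteq> {}\<close> h by (intro exI[of _ B]) linarith
qed

lemma pt_all: "2 * pt (cvs C) = (\<Sum>v\<in>cvs C. 2 * wt v - (int i + 1) * int (card (fulls C v)) - int (card (halves C v)))"
proof -
  have "(\<Sum>v\<in>cvs C. card (fulls C v)) = (\<Sum>e\<in>ces C. card (e \<inter> cvs C))"
    using double_count[OF D(1) D(3), of "\<lambda>e. e"] by (simp add: fulls_def)
  also have "\<dots> = (\<Sum>e\<in>ces C. 2)" using D(4,5) by (intro sum.cong refl) (simp add: Int_absorb2)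
  finally have f: "(\<Sum>v\<in>cvs C. int (card (fulls C v))) = 2 * int (card (ces C))"
    by (simp add: of_nat_sum[symmetric] del: of_nat_sum)
  have "(\<Sum>v\<in>cvs C. card (halves C v)) = (\<Sum>k\<in>chs C. card (che C k \<inter> cvs C))"
    using double_count[OF D(1) D(2), of "che C"] by (simp add: halves_def)
  also have "\<dots> = (\<Sum>k\<in>chs C. 2)" using D(6,7) by (intro sum.cong refl) (simp add: Int_absorb2)
  finally have h: "(\<Sum>v\<in>cvs C. int (card (halves C v))) = 2 * int (card (chs C))"
    by (simp add: of_nat_sum[symmetric] del: of_nat_sum)
  have e: "{e \<in> ces C. e \<subseteq> cvs C} = ces C" "{k \<in> chs C. che C k \<subseteq> cvs C} = chs C" using D(4,6) by auto
  show ?thesis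
    unfolding pot_def e sum_subtractf sum_distrib_left[symmetric] f h by (simp add: algebra_simps)
qed

definition qdeg :: "'a \<Rightarrow> nat" where
  "qdeg x = card {e \<in> fulls C x. e \<inter> Qs \<noteq> {}}"

text \<open>By independence an edge meeting \<open>Qs\<close> has exactly one end there, so the
  three edges at each vertex of \<open>Qs\<close> are counted once from outside.\<close>

lemma qdeg_sum: "(\<Sum>v\<in>cvs C - Qs. qdeg v) = 3 * card Qs"
proof -
  let ?E = "{e \<in> ces C. e \<inter> Qs \<noteq> {}}"
  have fin: "finite ?E" "finite Qs" "finite (cvs C - Qs)" using D(1,3) by (auto simp: Qs_def)
  have one: "card (e \<inter> Qs) = 1 \<and> card (e \<inter> (cvs C - Qs)) = 1" if eE: "e \<in> ?E" for e
  proof -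
    obtain q where q: "q \<in> e" "q \<in> Qs" using eE by auto
    have ec: "e \<in> ces C" using eE by simp
    obtain y where y: "y \<noteq> q" "e = {q, y}" using card2_other[OF D(5)[OF ec] q(1)] .
    have "y \<notin> Qs" using Qs_independent[OF q(2), of y] y ec by auto
    moreover have "y \<in> cvs C" using D(4)[OF ec] y by auto
    ultimately have "e \<inter> Qs = {q}" "e \<inter> (cvs C - Qs) = {y}" using q y by auto
    then show ?thesis by simp
  qed
  have "(\<Sum>v\<in>cvs C - Qs. qdeg v) = (\<Sum>v\<in>cvs C - Qs. card {e \<in> ?E. v \<in> e})"
    by (intro sum.cong refl) (auto simp: qdeg_def fulls_def intro!: arg_cong[where f = card])
  also have "\<dots> = (\<Sum>e\<in>?E. card (e \<inter> (cvs C - Qs)))" using double_count[OF fin(3,1), of "\<lambda>e. e"] by simp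
  also have "\<dots> = (\<Sum>e\<in>?E. card (e \<inter> Qs))" using one by (intro sum.cong) auto
  also have "\<dots> = (\<Sum>v\<in>Qs. card {e \<in> ?E. v \<in> e})" using double_count[OF fin(2,1), of "\<lambda>e. e"] by simp
  also have "\<dots> = (\<Sum>v\<in>Qs. 3)"
  proof (intro sum.cong refl)
    fix v assume v: "v \<in> Qs"
    then have "{e \<in> ?E. v \<in> e} = fulls C v" by (auto simp: fulls_def)
    moreover have "card (fulls C v) = 3" using v by (simp add: Qs_def)
    ultimately show "card {e \<in> ?E. v \<in> e} = 3" by simp
  qed
  finally show ?thesis by simp
qed

text \<open>Twice the potential of the whole is a sum of local charges. After \<open>Qs\<close> has
  given away its surplus they are nonpositive, while the set \<open>B\<close> from
  \<open>overloaded_set\<close> accounts for at most \<open>2 * T - 2\<close>. So the whole would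
  have potential below \<open>T\<close>.\<close>

lemma discharge:
  assumes "\<And>x. x \<in> cvs C \<Longrightarrow> i = 1 \<Longrightarrow> 2 * wt x \<le> 2 * int (card (fulls C x)) + int (card (halves C x))"
    and "\<And>x. x \<in> cvs C \<Longrightarrow> i = 2 \<Longrightarrow> x \<notin> Qs \<Longrightarrow>
      6 * wt x + int (qdeg x) \<le> 9 * int (card (fulls C x)) + 3 * int (card (halves C x))"
  shows False
proof -
  obtain B where B: "B \<subseteq> cvs C" "B \<noteq> {}" and
    B4: "4 \<le> (\<Sum>v\<in>B. 2 * int (card (fulls C v)) + int (card (halves C v)) - 2 * (ccp C v False + ccp C v True))"
    using overloaded_set by blast
  have fB: "finite B" using B(1) finsub by blast
  let ?c = "\<lambda>v. 2 * wt v - 2 * int (card (fulls C v)) - int (card (halves C v))"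
  have "(\<Sum>v\<in>B. ?c v) + (\<Sum>v\<in>B. 2 * int (card (fulls C v)) + int (card (halves C v)) - 2 * (ccp C v False + ccp C v True))
     = (\<Sum>v\<in>B. 2 * (T + 1))"
    unfolding sum.distrib[symmetric] by (intro sum.cong) (auto simp: wgt_def)
  also have "\<dots> = int (card B) * (2 * (T + 1))" by simp
  \<comment> \<open>As \<open>T + 1\<close> is not positive, the bound is weakest for a set
    \<open>B\<close> with a single vertex.\<close>
  also have "\<dots> \<le> 1 * (2 * (T + 1))"
  proof -
    have "1 \<le> int (card B)" using B(2) fB by (simp add: Suc_le_eq card_gt_0_iff)
    then show ?thesis using T_neg by (intro mult_right_mono_neg) auto
  qed
  finally have Bc: "(\<Sum>v\<in>B. ?c v) + (\<Sum>v\<in>B. 2 * int (card (fulls C v)) + int (card (halves C v))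
      - 2 * (ccp C v False + ccp C v True)) \<le> 1 * (2 * (T + 1))" .
  have "a \<le> 2 * t - 2" if "a + b \<le> 1 * (2 * (t + 1))" "4 \<le> b" for a b t :: int using that by presburger
  from this[OF Bc B4] have Bc: "(\<Sum>v\<in>B. ?c v) \<le> 2 * T - 2" .
  have TV: "T \<le> pt (cvs C)" using B sparseD[of "cvs C"] by auto
  show False
  proof (cases "i = 1")
    case True
    have "2 * pt (cvs C) = (\<Sum>v\<in>cvs C. ?c v)"
      unfolding pt_all using True by simp
    also have "\<dots> = (\<Sum>v\<in>B. ?c v) + (\<Sum>v\<in>cvs C - B. ?c v)"
      using D(1) B(1) by (simp add: sum.subset_diff add.commute)
    finally have s: "2 * pt (cvs C) = (\<Sum>v\<in>B. ?c v) + (\<Sum>v\<in>cvs C - B. ?c v)" .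
    have n: "(\<Sum>v\<in>cvs C - B. ?c v) \<le> 0"
    proof (intro sum_nonpos)
      fix v assume "v \<in> cvs C - B"
      then show "?c v \<le> 0" using assms(1)[of v] True by auto
    qed
    have False if "2 * p = a + b" "b \<le> 0" "a \<le> 2 * t - 2" "t \<le> p" for a b p t :: int
      using that by presburger
    from this[OF s n Bc TV] show False .
  next
    case False
    then have i2: "i = 2" using i12 by simp
    let ?P = "\<lambda>v. 6 * wt v - 9 * int (card (fulls C v)) - 3 * int (card (halves C v))"
    have fQ: "finite Qs" "Qs \<subseteq> cvs C" using D(1) unfolding Qs_def by simp_all
    have PQ: "?P q = 3" "0 \<le> ?c q" if q: "q \<in> Qs" for q
    proof -
      have "wt q = 5" "card (fulls C q) = 3" "halves C q = {}"
        using q unfolding Qs_def wgt_def by simp_all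
      then show "?P q = 3" "0 \<le> ?c q" by simp_all
    qed
    \<comment> \<open>Charges are tripled: a vertex of \<open>Qs\<close> then has charge 3 and sends
      1 along each of its three edges.\<close>
    have "3 * (2 * pt (cvs C)) = (\<Sum>v\<in>cvs C. ?P v)"
      unfolding pt_all sum_distrib_left using i2 by (intro sum.cong) (simp_all add: algebra_simps)
    also have "\<dots> = (\<Sum>v\<in>Qs. ?P v) + (\<Sum>v\<in>cvs C - Qs. ?P v)"
      using D(1) fQ(2) by (simp add: sum.subset_diff add.commute)
    also have "(\<Sum>v\<in>Qs. ?P v) = 3 * int (card Qs)" using PQ(1) by simp
    also have "3 * int (card Qs) = (\<Sum>v\<in>cvs C - Qs. int (qdeg v))"
      using qdeg_sum by (simp add: of_nat_sum[symmetric] del: of_nat_sum)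
    also have "(\<Sum>v\<in>cvs C - Qs. int (qdeg v)) + (\<Sum>v\<in>cvs C - Qs. ?P v) = (\<Sum>v\<in>cvs C - Qs. ?P v + int (qdeg v))"
      by (simp add: sum.distrib)
    also have "\<dots> = (\<Sum>v\<in>cvs C - Qs - (B - Qs). ?P v + int (qdeg v)) + (\<Sum>v\<in>B - Qs. ?P v + int (qdeg v))"
      using D(1) B(1) by (intro sum.subset_diff) auto
    finally have s: "3 * (2 * pt (cvs C)) =
      (\<Sum>v\<in>cvs C - Qs - (B - Qs). ?P v + int (qdeg v)) + (\<Sum>v\<in>B - Qs. ?P v + int (qdeg v))" .
    have n: "(\<Sum>v\<in>cvs C - Qs - (B - Qs). ?P v + int (qdeg v)) \<le> 0"
    proof (intro sum_nonpos)
      fix v assume "v \<in> cvs C - Qs - (B - Qs)"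
      then show "?P v + int (qdeg v) \<le> 0" using assms(2)[of v] i2 by auto
    qed
    \<comment> \<open>A full edge counts 9 in \<open>?P\<close> and 6 in the tripled
      \<open>?c\<close>; the difference absorbs the 1 received along it.\<close>
    have "(\<Sum>v\<in>B - Qs. ?P v + int (qdeg v)) \<le> (\<Sum>v\<in>B - Qs. 3 * ?c v)"
    proof (intro sum_mono)
      fix v
      have "qdeg v \<le> card (fulls C v)" unfolding qdeg_def using fin_cl(4) by (intro card_mono) auto
      then show "?P v + int (qdeg v) \<le> 3 * ?c v" by simp
    qed
    also have "(\<Sum>v\<in>B - Qs. 3 * ?c v) \<le> (\<Sum>v\<in>B. 3 * ?c v)"
    proof (rule sum_mono2[OF fB])
      fix b assume "b \<in> B - (B - Qs)"
      then have "0 \<le> ?c b" using PQ(2) by blast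
      then show "0 \<le> 3 * ?c b" by (intro mult_nonneg_nonneg) simp_all
    qed auto
    also have "(\<Sum>v\<in>B. 3 * ?c v) = 3 * (\<Sum>v\<in>B. ?c v)" by (simp only: sum_distrib_left)
    finally have m: "(\<Sum>v\<in>B - Qs. ?P v + int (qdeg v)) \<le> 3 * (\<Sum>v\<in>B. ?c v)" .
    have False if "3 * (2 * p) = b + d" "b \<le> 0" "d \<le> 3 * a" "a \<le> 2 * t - 2" "t \<le> p" for a b d p t :: int
      using that by presburger
    from this[OF s n m Bc TV] show False .
  qed
qed

end

section \<open>Submodular slack functions\<close>

lemma grow_to_all:
  assumes "finite K" "S \<subseteq> K" "P S"
    and "\<And>J. S \<subseteq> J \<Longrightarrow> J \<subset> K \<Longrightarrow> P J \<Longrightarrow> \<exists>z\<in>K - J. P (insert z J)"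
  shows "P K"
proof -
  have "P K" if "S \<subseteq> J" "J \<subseteq> K" "P J" for J
    using that
  proof (induction "card (K - J)" arbitrary: J rule: less_induct)
    case less
    show ?case
    proof (cases "J = K")
      case True then show ?thesis using less.prems by simp
    next
      case False
      then obtain z where z: "z \<in> K - J" "P (insert z J)" using assms(4)[of J] less.prems by blast
      have "K - insert z J \<subset> K - J" using z by auto
      then have "card (K - insert z J) < card (K - J)" using assms(1) by (intro psubset_card_mono) auto
      then show ?thesis using less.hyps[of "insert z J"] less.prems z by auto
    qed
  qed
  then show ?thesis using assms(2,3) by blast
qed

text \<open>The slack \<open>\<epsilon> J\<close> will be the least excess potential of a set containing the neighbours \<open>J\<close> of a
  vertex.\<close>

locale slack =
  fixes \<epsilon> :: "'k set \<Rightarrow> int" and K :: "'k set"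
  assumes finK: "finite K"
    and mono: "J \<subseteq> J' \<Longrightarrow> J' \<subseteq> K \<Longrightarrow> \<epsilon> J \<le> \<epsilon> J'"
    and nonneg: "J \<subseteq> K \<Longrightarrow> J \<noteq> {} \<Longrightarrow> 0 \<le> \<epsilon> J"
    and submod: "J \<subseteq> K \<Longrightarrow> J' \<subseteq> K \<Longrightarrow> J \<inter> J' \<noteq> {} \<Longrightarrow> \<epsilon> (J \<union> J') + \<epsilon> (J \<inter> J') \<le> \<epsilon> J + \<epsilon> J'"
begin

lemma join:
  assumes "J \<subseteq> K" "J' \<subseteq> K" "I \<subseteq> J \<inter> J'" "I \<noteq> {}" "\<epsilon> J + \<epsilon> J' - \<epsilon> I \<le> c"
  shows "\<epsilon> (J \<union> J') \<le> c"
proof -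
  have "\<epsilon> I \<le> \<epsilon> (J \<inter> J')" using assms by (intro mono) auto
  then show ?thesis using submod[of J J'] assms by fastforce
qed

text \<open>Pairs through one fixed element are joined one after another; the overlap contains that
  element, whose slack is nonnegative.\<close>

lemma pairs_zero:
  assumes L: "L \<subseteq> K" "2 \<le> card L" and p: "\<And>a b. a \<in> L \<Longrightarrow> b \<in> L \<Longrightarrow> a \<noteq> b \<Longrightarrow> \<epsilon> {a, b} \<le> 0"
  shows "\<epsilon> L \<le> 0"
proof -
  have fL: "finite L" using L finK finite_subset by blast
  obtain a b where ab: "a \<in> L" "b \<in> L" "a \<noteq> b"
    using L(2) fL by (metis card_2_iff' obtain_subset_with_card_n subset_iff)
  show ?thesis
  proof (rule grow_to_all[OF fL, of "{a, b}" "\<lambda>J. \<epsilon> J \<le> 0"])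
    show "\<exists>z\<in>L - J. \<epsilon> (insert z J) \<le> 0" if J: "{a, b} \<subseteq> J" "J \<subset> L" "\<epsilon> J \<le> 0" for J
    proof -
      obtain z where z: "z \<in> L - J" using J by auto
      have za: "\<epsilon> {z, a} \<le> 0" using p[of z a] z J by auto
      have "0 \<le> \<epsilon> {a}" using nonneg[of "{a}"] ab L by auto
      then have "\<epsilon> (J \<union> {z, a}) \<le> 0"
        using J z za L ab by (intro join[of _ _ "{a}"]) auto
      moreover have "J \<union> {z, a} = insert z J" using J by auto
      ultimately show ?thesis using z by auto
    qed
  qed (use p ab in auto)
qed

lemma max_small_set:
  assumes "J0 \<subseteq> K" "Q J0"
  obtains I where "I \<subseteq> K" "Q I" "\<And>z. z \<in> K - I \<Longrightarrow> \<not> Q (insert z I)" "card J0 \<le> card I"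
proof -
  have "\<exists>I. (I \<subseteq> K \<and> Q I) \<and> (\<forall>J. J \<subseteq> K \<and> Q J \<longrightarrow> card J \<le> card I)"
    using assms finK by (intro ex_has_greatest_nat[of _ J0 _ "Suc (card K)"]) (auto simp: less_Suc_eq_le intro: card_mono)
  then obtain I where I: "I \<subseteq> K" "Q I" and m: "\<And>J. J \<subseteq> K \<Longrightarrow> Q J \<Longrightarrow> card J \<le> card I"
    by blast
  have "\<not> Q (insert z I)" if "z \<in> K - I" for z
  proof
    assume "Q (insert z I)"
    then have "card (insert z I) \<le> card I" using m[of "insert z I"] that I by auto
    then show False using that finite_subset[OF I(1) finK] by simp
  qed
  then show ?thesis using that I m[OF assms] by blast
qed

text \<open>Read contrapositively: some two disjoint pairs have slack at least 1 each and at least 3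
  together, so that two modifications as in \<open>pair_plan\<close> are affordable simultaneously.
  If all pairs have slack at least 2, quadruples of slack at most 2 can be joined along pairs until
  they exhaust \<open>K\<close>. Otherwise a maximal set \<open>I\<close> of slack at most 1 serves
  as the common core.\<close>

lemma no_four_plan:
  assumes big: "3 \<le> \<epsilon> K" "\<And>z. z \<in> K \<Longrightarrow> 2 \<le> \<epsilon> (K - {z})" and cK: "4 \<le> card K"
    and plan: "\<And>a b c d. {a, b, c, d} \<subseteq> K \<Longrightarrow> distinct [a, b, c, d] \<Longrightarrow>
      \<epsilon> {a, b} \<le> 0 \<or> \<epsilon> {c, d} \<le> 0 \<or> \<epsilon> {a, b, c, d} \<le> 2"
  shows False
proof -
  have "\<exists>J0. J0 \<subseteq> K \<and> \<epsilon> J0 \<le> 1 \<and> 2 \<le> card J0"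
  proof (rule ccontr)
    assume "\<not> ?thesis"
    then have n: "\<not> (J \<subseteq> K \<and> \<epsilon> J \<le> 1 \<and> 2 \<le> card J)" for J by blast
    have two: "2 \<le> \<epsilon> {a, b}" if "a \<in> K" "b \<in> K" "a \<noteq> b" for a b
      using n[of "{a, b}"] that by simp
    obtain S where S: "S \<subseteq> K" "card S = 4" using cK obtain_subset_with_card_n by metis
    then obtain a b c d where abcd: "S = {a, b, c, d}" "distinct [a, b, c, d]"
      by (auto simp: numeral_eq_Suc card_Suc_eq)
    have "\<epsilon> K \<le> 2"
    proof (rule grow_to_all[OF finK, of "{a, b, c, d}" "\<lambda>J. \<epsilon> J \<le> 2"])
      show "\<epsilon> {a, b, c, d} \<le> 2" using plan[of a b c d] two[of a b] two[of c d] S abcd by auto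
      show "\<exists>z\<in>K - J. \<epsilon> (insert z J) \<le> 2" if J: "{a, b, c, d} \<subseteq> J" "J \<subset> K" "\<epsilon> J \<le> 2" for J
      proof -
        obtain z where z: "z \<in> K - J" using J by auto
        have zne: "z \<notin> {a, b, c, d}" "z \<in> K" using z J(1) by auto
        have "\<epsilon> {z, a, b, c} \<le> 2"
          using plan[of z a b c] two[of z a] two[of b c] zne S(1) abcd by auto
        then have "\<epsilon> (J \<union> {z, a, b, c}) \<le> 2"
          using J(1,3) psubset_imp_subset[OF J(2)] zne two[of a b] abcd S(1) by (intro join[of _ _ "{a, b}"]) auto
        moreover have "J \<union> {z, a, b, c} = insert z J" using J by auto
        ultimately show ?thesis using z by auto
      qed
    qed (use S abcd in auto)
    then show False using big by simp
  qed
  then obtain J0 where J0: "J0 \<subseteq> K" "\<epsilon> J0 \<le> 1" "2 \<le> card J0" by blast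
  obtain I where I: "I \<subseteq> K" "\<epsilon> I \<le> 1" "\<And>z. z \<in> K - I \<Longrightarrow> \<not> \<epsilon> (insert z I) \<le> 1" "2 \<le> card I"
    by (rule max_small_set[of J0 "\<lambda>J. \<epsilon> J \<le> 1"]) (use J0 in auto)
  have fI: "finite I" using I(1) finK finite_subset by blast
  have cross: "1 \<le> \<epsilon> {z, a}" if "z \<in> K - I" "a \<in> I" for z a
  proof (rule ccontr)
    assume n: "\<not> ?thesis"
    have "0 \<le> \<epsilon> {a}" using nonneg[of "{a}"] that I by auto
    then have "\<epsilon> (I \<union> {z, a}) \<le> 1"
      using n I that by (intro join[of _ _ "{a}"]) auto
    moreover have "I \<union> {z, a} = insert z I" using that by auto
    ultimately show False using I(3)[OF that(1)] by simp
  qed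
  obtain a b where ab: "a \<in> I" "b \<in> I" "a \<noteq> b" "\<epsilon> I \<le> \<epsilon> {a, b}"
  proof (cases "\<epsilon> I \<le> 0")
    case True
    obtain a b where "a \<in> I" "b \<in> I" "a \<noteq> b"
      using I(4) fI by (metis card_2_iff' obtain_subset_with_card_n subset_iff)
    moreover from this have "0 \<le> \<epsilon> {a, b}" using I(1) by (intro nonneg) auto
    ultimately show thesis using that[of a b] True by simp
  next
    case False
    then have "\<exists>a b. a \<in> I \<and> b \<in> I \<and> a \<noteq> b \<and> \<not> \<epsilon> {a, b} \<le> 0"
      using pairs_zero[OF I(1,4)] by blast
    then obtain a b where "a \<in> I" "b \<in> I" "a \<noteq> b" "\<not> \<epsilon> {a, b} \<le> 0" by blast
    then show thesis using that[of a b] I(2) by auto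
  qed
  have two: "\<epsilon> (insert z (insert z' I)) \<le> 2" if z: "z \<in> K - I" "z' \<in> K - I" "z \<noteq> z'" for z z'
  proof -
    have "\<epsilon> {z, a, z', b} \<le> 2"
      using plan[of z a z' b] cross[OF z(1) ab(1)] cross[OF z(2) ab(2)] z ab I(1) by auto
    then have "\<epsilon> (I \<union> {z, a, z', b}) \<le> 2"
      using ab z I(1) by (intro join[of _ _ "{a, b}"]) auto
    moreover have "I \<union> {z, a, z', b} = insert z (insert z' I)" using ab by auto
    ultimately show ?thesis by simp
  qed
  have "I \<noteq> K" using I(2) big(1) by auto
  then obtain z where z: "z \<in> K - I" using I(1) by auto
  have "I \<noteq> K - {z}"
  proof
    assume "I = K - {z}"
    then show False using big(2)[of z] I(2) z by auto
  qed
  then obtain z' where z': "z' \<in> K - I" "z' \<noteq> z" using I(1) z by auto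
  have "\<epsilon> K \<le> 2"
  proof (rule grow_to_all[OF finK, of "insert z (insert z' I)" "\<lambda>J. \<epsilon> J \<le> 2"])
    show "\<epsilon> (insert z (insert z' I)) \<le> 2" using two z z' by blast
    show "\<exists>y\<in>K - J. \<epsilon> (insert y J) \<le> 2" if J: "insert z (insert z' I) \<subseteq> J" "J \<subset> K" "\<epsilon> J \<le> 2" for J
    proof -
      obtain y where y: "y \<in> K - J" using J by auto
      have "\<epsilon> (insert y (insert z I)) \<le> 2" using two[of y z] y z J by auto
      moreover have "2 \<le> \<epsilon> (insert z I)" using I(3)[OF z] by simp
      ultimately have "\<epsilon> (J \<union> insert y (insert z I)) \<le> 2"
        using J y z I(1) by (intro join[of _ _ "insert z I"]) auto
      moreover have "J \<union> insert y (insert z I) = insert y J" using J by auto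
      ultimately show ?thesis using y by auto
    qed
  qed (use z z' I(1) in auto)
  then show False using big by simp
qed

text \<open>Read contrapositively: for some \<open>a\<close> and \<open>b\<close>, the three pairs
  among \<open>s\<close>, \<open>a\<close>, \<open>b\<close> have slack at least 1 and the triple at
  least 2, which affords three single reserves. Otherwise a maximal set of slack at most 1
  containing \<open>s\<close> has in fact slack at most 0 and at most two further elements; the
  pairs outside it have slack at most 0 as well, and the weak union bound contradicts slack 3 on
  \<open>K\<close>.\<close>

lemma no_star_plan:
  assumes s: "s \<in> K" and L: "L = K - {s}" "5 \<le> card L"
    and weak: "\<And>J J'. J \<subseteq> K \<Longrightarrow> J' \<subseteq> K \<Longrightarrow> \<epsilon> (J \<union> J') \<le> \<epsilon> J + \<epsilon> J' + 1"
    and big: "3 \<le> \<epsilon> K" "1 \<le> \<epsilon> L" "\<And>J. J \<subseteq> L \<Longrightarrow> 3 \<le> card J \<Longrightarrow> 1 \<le> \<epsilon> (insert s J)"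
    and plan: "\<And>a b. a \<in> L \<Longrightarrow> b \<in> L \<Longrightarrow> a \<noteq> b \<Longrightarrow>
      \<epsilon> {s, a} \<le> 0 \<or> \<epsilon> {s, b} \<le> 0 \<or> \<epsilon> {a, b} \<le> 0 \<or> \<epsilon> {s, a, b} \<le> 1"
  shows False
proof -
  have fL: "finite L" using L finK by simp
  have LK: "L \<subseteq> K" "s \<notin> L" using L by auto
  have "\<exists>a\<in>L. \<epsilon> {s, a} \<le> 1"
  proof (rule ccontr)
    assume n: "\<not> ?thesis"
    have pz: "\<epsilon> {a, b} \<le> 0" if "a \<in> L" "b \<in> L" "a \<noteq> b" for a b
    proof -
      have "\<epsilon> {s, a} \<le> \<epsilon> {s, a, b}" using that LK s by (intro mono) auto
      then show ?thesis using plan[OF that] n that by fastforce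
    qed
    have "2 \<le> card L" using L(2) by simp
    from pairs_zero[OF LK(1) this pz] have "\<epsilon> L \<le> 0" .
    then show False using big(2) by simp
  qed
  then obtain a0 where a0: "a0 \<in> L" "\<epsilon> {s, a0} \<le> 1" by blast
  obtain I' where I': "I' \<subseteq> K" "s \<in> I' \<and> \<epsilon> I' \<le> 1" "\<And>z. z \<in> K - I' \<Longrightarrow> \<not> (s \<in> insert z I' \<and> \<epsilon> (insert z I') \<le> 1)"
    "card {s, a0} \<le> card I'"
    by (rule max_small_set[of "{s, a0}" "\<lambda>J. s \<in> J \<and> \<epsilon> J \<le> 1"]) (use a0 LK s in auto)
  have max: "\<not> \<epsilon> (insert z I') \<le> 1" if "z \<in> K - I'" for z using I'(2,3) that by blast
  have sI: "s \<in> I'" "\<epsilon> I' \<le> 1" using I'(2) by auto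
  have fI: "finite I'" using I'(1) finK finite_subset by blast
  have join1: "\<not> \<epsilon> (I' \<union> J) \<le> 1" if "z \<in> J" "z \<in> K - I'" "J \<subseteq> K" for z J
  proof -
    have "\<epsilon> (insert z I') \<le> \<epsilon> (I' \<union> J)" using that I'(1) by (intro mono) auto
    then show ?thesis using max[OF that(2)] by simp
  qed
  have out_s: "\<not> \<epsilon> {s, c} \<le> 0" if c: "c \<in> K - I'" for c
  proof
    assume "\<epsilon> {s, c} \<le> 0"
    then have "\<epsilon> (I' \<union> {s, c}) \<le> 1"
      using sI c I'(1) s nonneg[of "{s}"] by (intro join[of _ _ "{s}"]) auto
    then show False using join1[of c "{s, c}"] c s by auto
  qed
  have "I' \<noteq> K" using sI(2) big(1) by auto
  then obtain c where c: "c \<in> K - I'" using I'(1) by auto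
  have cL: "c \<in> L" using c sI L by auto
  have zero: "\<epsilon> {s, a} \<le> 0" if a: "a \<in> I' - {s}" for a
  proof (rule ccontr)
    assume n: "\<not> ?thesis"
    have aL: "a \<in> L" "a \<noteq> c" using a I'(1) L c by auto
    consider "\<epsilon> {a, c} \<le> 0" | "\<epsilon> {s, a, c} \<le> 1"
      using plan[OF aL(1) cL aL(2)] n out_s[OF c] by blast
    then show False
    proof cases
      case 1
      then have "\<epsilon> (I' \<union> {a, c}) \<le> 1"
        using sI a c I'(1) nonneg[of "{a}"] by (intro join[of _ _ "{a}"]) auto
      then show False using join1[of c "{a, c}"] c a I'(1) by auto
    next
      case 2
      then have "\<epsilon> (I' \<union> {s, a, c}) \<le> 1"
        using sI a c I'(1) n s by (intro join[of _ _ "{s, a}"]) auto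
      then show False using join1[of c "{s, a, c}"] c a s I'(1) by auto
    qed
  qed
  have "I' \<noteq> {s}"
  proof
    assume "I' = {s}"
    then have "a0 \<in> K - I'" using a0 L by auto
    then show False using max[of a0] a0 \<open>I' = {s}\<close> by (simp add: insert_commute)
  qed
  then obtain a where a: "a \<in> I' - {s}" using sI by auto
  have I0: "\<epsilon> I' \<le> 0"
  proof (rule grow_to_all[OF fI, of "{s, a}" "\<lambda>J. \<epsilon> J \<le> 0"])
    show "\<exists>z\<in>I' - J. \<epsilon> (insert z J) \<le> 0" if J: "{s, a} \<subseteq> J" "J \<subset> I'" "\<epsilon> J \<le> 0" for J
    proof -
      obtain z where z: "z \<in> I' - J" using J by auto
      have "\<epsilon> {s, z} \<le> 0" by (rule zero) (use z J(1) in auto)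
      then have "\<epsilon> (J \<union> {s, z}) \<le> 0"
        using J(1,3) psubset_imp_subset[OF J(2)] z I'(1) nonneg[of "{s}"] s
        by (intro join[of _ _ "{s}"]) auto
      moreover have "J \<union> {s, z} = insert z J" using J by auto
      ultimately show ?thesis using z by auto
    qed
  qed (use zero a sI in auto)
  have card3: "card (I' - {s}) \<le> 2"
  proof (rule ccontr)
    assume "\<not> ?thesis"
    then have "1 \<le> \<epsilon> (insert s (I' - {s}))" using I'(1) L by (intro big(3)) auto
    moreover have "insert s (I' - {s}) = I'" using sI by auto
    ultimately show False using I0 by simp
  qed
  have KI: "K - I' = L - (I' - {s})" using sI L by auto
  have "card L - card (I' - {s}) \<le> card (L - (I' - {s}))" using fI by (intro diff_card_le_card_Diff) auto
  then have c2: "2 \<le> card (K - I')" using card3 L(2) unfolding KI by linarith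
  have pz: "\<epsilon> {c, d} \<le> 0" if cd: "c \<in> K - I'" "d \<in> K - I'" "c \<noteq> d" for c d
  proof (rule ccontr)
    assume n: "\<not> ?thesis"
    have "c \<in> L" "d \<in> L" using cd KI by auto
    then have "\<epsilon> {s, c, d} \<le> 1" using plan[of c d] out_s[OF cd(1)] out_s[OF cd(2)] n cd(3) by blast
    then have "\<epsilon> (I' \<union> {s, c, d}) \<le> 1"
      using I0 cd I'(1) s sI nonneg[of "{s}"] by (intro join[of _ _ "{s}"]) auto
    then show False using join1[of c "{s, c, d}"] cd s by auto
  qed
  from pairs_zero[OF Diff_subset c2 pz] have "\<epsilon> (K - I') \<le> 0" .
  moreover have "I' \<union> (K - I') = K" using I'(1) by auto
  ultimately show False using weak[of I' "K - I'"] I0 I'(1) big(1) by auto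
qed

end

section \<open>Spare potential around a deleted vertex\<close>

context minimal_counterexample begin

text \<open>Every set that avoids \<open>x\<close> and contains \<open>W\<close> can lose
  \<open>excess x W + 1\<close> and keep potential \<open>T\<close>. The shift by 1 makes the excess
  nonnegative once \<open>W\<close> contains a vertex of weight above \<open>T\<close>, by
  \<open>low\<close>.\<close>

definition excess :: "'a \<Rightarrow> 'a set \<Rightarrow> int" where
  "excess x W = Min ((\<lambda>U. pt U - T - 1) ` {U. U \<subseteq> cvs C - {x} \<and> U \<noteq> {} \<and> W \<subseteq> U})"

definition ends :: "'a \<Rightarrow> ('k \<Rightarrow> 'a set) \<Rightarrow> 'k set \<Rightarrow> 'a set" where
  "ends x g J = (\<Union>k\<in>J. g k) - {x}"

lemma finite_U: "finite {U. U \<subseteq> cvs C - {x} \<and> U \<noteq> {} \<and> W \<subseteq> U}"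
  using D(1) by (auto intro: finite_subset[of _ "Pow (cvs C)"])

lemma excess_le: "U \<subseteq> cvs C - {x} \<Longrightarrow> U \<noteq> {} \<Longrightarrow> W \<subseteq> U \<Longrightarrow> excess x W \<le> pt U - T - 1"
  unfolding excess_def using finite_U by (intro Min_le) auto

lemma excess_obtain:
  assumes "W \<subseteq> cvs C - {x}" "cvs C - {x} \<noteq> {}"
  obtains U where "U \<subseteq> cvs C - {x}" "U \<noteq> {}" "W \<subseteq> U" "pt U = T + 1 + excess x W"
proof -
  have "{U. U \<subseteq> cvs C - {x} \<and> U \<noteq> {} \<and> W \<subseteq> U} \<noteq> {}" using assms by blast
  then have "excess x W \<in> (\<lambda>U. pt U - T - 1) ` {U. U \<subseteq> cvs C - {x} \<and> U \<noteq> {} \<and> W \<subseteq> U}"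
    unfolding excess_def using finite_U by (intro Min_in) auto
  then obtain U where "U \<subseteq> cvs C - {x}" "U \<noteq> {}" "W \<subseteq> U" "excess x W = pt U - T - 1" by auto
  then show ?thesis using that[of U] by simp
qed

lemma excess_mono:
  assumes "W \<subseteq> W'" "W' \<subseteq> cvs C - {x}" "cvs C - {x} \<noteq> {}"
  shows "excess x W \<le> excess x W'"
proof -
  obtain U where "U \<subseteq> cvs C - {x}" "U \<noteq> {}" "W' \<subseteq> U" "pt U = T + 1 + excess x W'"
    using excess_obtain[OF assms(2,3)] .
  then show ?thesis using excess_le[of U x W] assms(1) by auto
qed

lemma excess_nonneg:
  assumes "W \<subseteq> cvs C - {x}" "y \<in> W" "T < wt y" "x \<in> cvs C"
  shows "0 \<le> excess x W"
proof -
  obtain U where U: "U \<subseteq> cvs C - {x}" "U \<noteq> {}" "W \<subseteq> U" "pt U = T + 1 + excess x W"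
    using excess_obtain[OF assms(1)] assms(1,2) by blast
  then have "T + 1 \<le> pt U" using assms(2-4) by (intro low[of U y]) auto
  then show ?thesis using U(4) by simp
qed

text \<open>Uncross the minimisers for \<open>W\<close> and \<open>W'\<close>; the nonempty
  \<open>I\<close> makes their intersection an admissible set.\<close>

lemma excess_submod:
  assumes "W \<subseteq> cvs C - {x}" "W' \<subseteq> cvs C - {x}" "I \<subseteq> W \<inter> W'" "I \<noteq> {}"
  shows "excess x (W \<union> W') + excess x I \<le> excess x W + excess x W'"
proof -
  have ne: "cvs C - {x} \<noteq> {}" using assms by auto
  obtain U where U: "U \<subseteq> cvs C - {x}" "U \<noteq> {}" "W \<subseteq> U" "pt U = T + 1 + excess x W"
    using excess_obtain[OF assms(1) ne] .
  obtain U' where U': "U' \<subseteq> cvs C - {x}" "U' \<noteq> {}" "W' \<subseteq> U'" "pt U' = T + 1 + excess x W'"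
    using excess_obtain[OF assms(2) ne] .
  have f: "finite U" "finite U'" using U(1) U'(1) finsub[of U] finsub[of U'] by auto
  have "excess x (W \<union> W') \<le> pt (U \<union> U') - T - 1" using U U' by (intro excess_le) auto
  moreover have "excess x I \<le> pt (U \<inter> U') - T - 1"
  proof (rule excess_le)
    show I: "I \<subseteq> U \<inter> U'" using assms(3) U(3) U'(3) by blast
    show "U \<inter> U' \<noteq> {}" using I assms(4) by blast
    show "U \<inter> U' \<subseteq> cvs C - {x}" using U(1) by blast
  qed
  ultimately show ?thesis using pot_submodular[OF wf f] U(4) U'(4) by linarith
qed

text \<open>Without a common part the minimisers may be disjoint. Their intersection still has
  potential at least \<open>T\<close>, one below the base value of the excess; hence the additional
  1.\<close>

lemma excess_weak:
  assumes "W \<subseteq> cvs C - {x}" "W' \<subseteq> cvs C - {x}" "cvs C - {x} \<noteq> {}"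
  shows "excess x (W \<union> W') \<le> excess x W + excess x W' + 1"
proof -
  obtain U where U: "U \<subseteq> cvs C - {x}" "U \<noteq> {}" "W \<subseteq> U" "pt U = T + 1 + excess x W"
    using excess_obtain[OF assms(1,3)] .
  obtain U' where U': "U' \<subseteq> cvs C - {x}" "U' \<noteq> {}" "W' \<subseteq> U'" "pt U' = T + 1 + excess x W'"
    using excess_obtain[OF assms(2,3)] .
  have f: "finite U" "finite U'" using U(1) U'(1) finsub[of U] finsub[of U'] by auto
  have "T \<le> pt (U \<inter> U')"
  proof (cases "U \<inter> U' = {}")
    case True then show ?thesis using T_neg wf by simp
  next
    case False then show ?thesis using U(1) by (intro sparseD) auto
  qed
  moreover have "excess x (W \<union> W') \<le> pt (U \<union> U') - T - 1" using U U' by (intro excess_le) auto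
  ultimately show ?thesis using pot_submodular[OF wf f] U(4) U'(4) by linarith
qed

lemma slack_excess:
  assumes x: "x \<in> cvs C" and K: "finite K" "K \<noteq> {}"
    and g: "\<And>k. k \<in> K \<Longrightarrow> card (g k) = 2 \<and> x \<in> g k \<and> g k \<subseteq> cvs C"
    and nt: "\<And>k y. k \<in> K \<Longrightarrow> y \<in> g k \<Longrightarrow> y \<noteq> x \<Longrightarrow> T < wt y"
  shows "slack (\<lambda>J. excess x (ends x g J)) K"
    and "\<And>J. J \<subseteq> K \<Longrightarrow> ends x g J \<subseteq> cvs C - {x}" "cvs C - {x} \<noteq> {}"
proof -
  have W: "ends x g J \<subseteq> cvs C - {x}" if "J \<subseteq> K" for J using that g unfolding ends_def by blast
  have y: "\<exists>y. y \<in> ends x g J \<and> T < wt y" if J: "J \<subseteq> K" "J \<noteq> {}" for J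
  proof -
    obtain k where k: "k \<in> J" using J by auto
    then have kK: "k \<in> K" using J by auto
    obtain y where "y \<noteq> x" "g k = {x, y}" using card2_other[of "g k" x] g[OF kK] by blast
    then show ?thesis using k nt[OF kK, of y] by (auto simp: ends_def)
  qed
  obtain y0 where "y0 \<in> ends x g K" using y[of K] K(2) by auto
  then have ne: "cvs C - {x} \<noteq> {}" using W[of K] by auto
  show "slack (\<lambda>J. excess x (ends x g J)) K"
  proof
    show "excess x (ends x g J) \<le> excess x (ends x g J')" if "J \<subseteq> J'" "J' \<subseteq> K" for J J'
      using that W ne by (intro excess_mono) (auto simp: ends_def)
    show "0 \<le> excess x (ends x g J)" if J: "J \<subseteq> K" "J \<noteq> {}" for J
      using y[OF J] excess_nonneg[OF W[OF J(1)] _ _ x] by blast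
    show "excess x (ends x g (J \<union> J')) + excess x (ends x g (J \<inter> J')) \<le> excess x (ends x g J) + excess x (ends x g J')"
      if J: "J \<subseteq> K" "J' \<subseteq> K" "J \<inter> J' \<noteq> {}" for J J'
    proof -
      have "ends x g (J \<union> J') = ends x g J \<union> ends x g J'" by (auto simp: ends_def)
      moreover have "ends x g (J \<inter> J') \<noteq> {}" using y[of "J \<inter> J'"] J by auto
      moreover have "ends x g (J \<inter> J') \<subseteq> ends x g J \<inter> ends x g J'" by (auto simp: ends_def)
      ultimately show ?thesis using excess_submod[OF W[OF J(1)] W[OF J(2)]] by auto
    qed
  qed (rule K(1))
  show "ends x g J \<subseteq> cvs C - {x}" if "J \<subseteq> K" for J using W[OF that] .
  show "cvs C - {x} \<noteq> {}" by (rule ne)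
qed

lemma slack_halves:
  assumes x: "x \<in> cvs C" "halves C x \<noteq> {}"
  shows "slack (\<lambda>J. excess x (ends x (che C) J)) (halves C x)"
    and "\<And>J. J \<subseteq> halves C x \<Longrightarrow> ends x (che C) J \<subseteq> cvs C - {x}" "cvs C - {x} \<noteq> {}"
proof -
  have g: "card (che C k) = 2 \<and> x \<in> che C k \<and> che C k \<subseteq> cvs C" if "k \<in> halves C x" for k
    using D(6,7)[of k] that by (auto simp: halves_def)
  have nt: "T < wt y" if "k \<in> halves C x" "y \<in> che C k" "y \<noteq> x" for k y
    using half_nontight[of k y] that by (auto simp: halves_def)
  note * = slack_excess[of x "halves C x" "che C", OF x(1) fin_cl(5) x(2)]
  show "slack (\<lambda>J. excess x (ends x (che C) J)) (halves C x)" by (rule *(1)) (use g nt in blast)+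
  show "ends x (che C) J \<subseteq> cvs C - {x}" if "J \<subseteq> halves C x" for J by (rule *(2)) (use g nt that in blast)+
  show "cvs C - {x} \<noteq> {}" by (rule *(3)) (use g nt in blast)+
qed

text \<open>Adding \<open>x\<close> to a minimiser for \<open>W\<close> brings in all edges of
  \<open>F\<close> and \<open>H\<close>, and the result still has potential at least
  \<open>T\<close>. If it is not the whole vertex set, \<open>gap'\<close> improves this by one;
  this is the second alternative.\<close>

lemma excess_bound:
  assumes x: "x \<in> cvs C" and W: "W \<subseteq> cvs C - {x}" "cvs C - {x} \<noteq> {}"
    and F: "F \<subseteq> fulls C x" "\<And>e. e \<in> F \<Longrightarrow> e - {x} \<subseteq> W"
    and H: "H \<subseteq> halves C x" "\<And>k. k \<in> H \<Longrightarrow> che C k - {x} \<subseteq> W"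
  shows "(int i + 1) * int (card F) + int (card H) \<le> wt x + 1 + excess x W"
    and "(int i + 1) * int (card F) + int (card H) \<le> wt x + excess x W \<or> excess x (cvs C - {x}) \<le> excess x W"
proof -
  obtain U where U: "U \<subseteq> cvs C - {x}" "U \<noteq> {}" "W \<subseteq> U" "pt U = T + 1 + excess x W"
    using excess_obtain[OF W] .
  have "pt (insert x U) \<le> pt U + wt x - (int i + 1) * int (card F) - int (card H)"
  proof (rule pt_insert_le[OF U(1) F(1) _ H(1)])
    show "e \<subseteq> insert x U" if "e \<in> F" for e using F(2)[OF that] U(3) by blast
    show "che C k \<subseteq> insert x U" if "k \<in> H" for k using H(2)[OF that] U(3) by blast
  qed
  then have le: "pt (insert x U) \<le> T + 1 + excess x W + wt x - (int i + 1) * int (card F) - int (card H)"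
    using U(4) by linarith
  have sub: "insert x U \<subseteq> cvs C" using U(1) x by blast
  have "T \<le> pt (insert x U)" using sub by (intro sparseD) auto
  then show "(int i + 1) * int (card F) + int (card H) \<le> wt x + 1 + excess x W" using le by linarith
  show "(int i + 1) * int (card F) + int (card H) \<le> wt x + excess x W \<or> excess x (cvs C - {x}) \<le> excess x W"
  proof (cases "U = cvs C - {x}")
    case True
    then have "excess x (cvs C - {x}) \<le> pt U - T - 1" using U(1,2) by (intro excess_le) auto
    then show ?thesis using U(4) by linarith
  next
    case False
    then have ps: "insert x U \<subset> cvs C" using U(1) x by blast
    have fU: "finite U" "x \<notin> U" using U(1) finsub[of U] by auto
    then have "0 < card U" using U(2) by (simp add: card_gt_0_iff)
    then have "2 \<le> card (insert x U)" using fU by simp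
    then have "T + 1 \<le> pt (insert x U)" using gap'[OF ps] by blast
    then show ?thesis using le by linarith
  qed
qed

text \<open>Joining the other ends of two half-edges at \<open>x\<close> by two half-edges of opposite sign costs two units of
  potential and makes one of the two ends tolerate an additional clash (if the ends coincide, lower both
  its capacities).\<close>

lemma pair_plan:
  fixes a b :: "nat \<Rightarrow> nat"
  assumes x: "x \<in> cvs C" and outer: "outer x = {}"
    and ab: "\<And>p. p < m \<Longrightarrow> a p \<in> halves C x \<and> b p \<in> halves C x"
    and free: "\<And>A. A \<subseteq> cvs C - {x} \<Longrightarrow> A \<noteq> {} \<Longrightarrow>
      T + 2 * int (card {p. p < m \<and> (che C (a p) \<union> che C (b p)) - {x} \<subseteq> A}) \<le> pt A"
  shows "\<exists>\<phi> \<kappa>. (\<forall>p<m. \<kappa> p \<in> {a p, b p}) \<and> (\<forall>n P. P \<subseteq> \<kappa> ` {..<m} \<longrightarrow> P \<subseteq> half_clashes C (\<phi>(x := n)) x \<longrightarrow>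
      ccp C x n < int (card (full_clashes C (\<phi>(x := n)) x) + card (half_clashes C (\<phi>(x := n)) x) - card P))"
proof -
  define Y where "Y p = (che C (a p) \<union> che C (b p)) - {x}" for p
  have Y: "\<exists>u v. Y p = {u, v} \<and> che C (a p) = {x, u} \<and> che C (b p) = {x, v} \<and> u \<noteq> x \<and> v \<noteq> x \<and> {u, v} \<subseteq> cvs C"
    if p: "p < m" for p
  proof -
    have h: "a p \<in> chs C" "x \<in> che C (a p)" "b p \<in> chs C" "x \<in> che C (b p)" using ab[OF p] by (auto simp: halves_def)
    obtain u where u: "u \<noteq> x" "che C (a p) = {x, u}" using card2_other[OF D(7)[OF h(1)] h(2)] .
    obtain v where v: "v \<noteq> x" "che C (b p) = {x, v}" using card2_other[OF D(7)[OF h(3)] h(4)] .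
    have "Y p = {u, v}" unfolding Y_def u(2) v(2) using u(1) v(1) by blast
    moreover have "{u, v} \<subseteq> cvs C" using D(6)[OF h(1)] D(6)[OF h(3)] unfolding u(2) v(2) by blast
    ultimately show ?thesis using u v by blast
  qed
  \<comment> \<open>Pair \<open>p\<close> gets the fresh indices \<open>N + 2 * p\<close> and
    \<open>N + 2 * p + 1\<close>; the parity carries the sign.\<close>
  define N where "N = Suc (Max (insert 0 (chs C)))"
  have N: "k < N" if "k \<in> chs C" for k using that D(2) by (simp add: N_def less_Suc_eq_le)
  define K where "K = {k. N \<le> k \<and> k < N + 2 * m \<and> card (Y ((k - N) div 2)) = 2}"
  define hn where "hn k = Y ((k - N) div 2)" for k
  define hg where "hg k = even (k - N)" for k
  define \<mu> where "\<mu> y b = card {p \<in> {..<m}. Y p = {y}}" for y and b :: bool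
  have finK: "finite K" "K \<inter> chs C = {}" using N by (auto simp: K_def dest: leD)
  have hn: "hn k \<subseteq> cvs C - {x} \<and> card (hn k) = 2" if k: "k \<in> K" for k
  proof -
    have "(k - N) div 2 < m" using k by (auto simp: K_def)
    then show ?thesis using Y[of "(k - N) div 2"] k by (auto simp: hn_def K_def)
  qed
  have "\<exists>\<phi> \<omega>. col {} (modify C {x} {} {} \<mu> K hn hg) \<phi> \<omega>"
  proof (rule del_col[OF x finK hn])
    fix A assume A: "A \<subseteq> cvs C - {x}" "A \<noteq> {}"
    then have fA: "finite A" using finsub by blast
    let ?S = "{p. p < m \<and> card (Y p) = 2 \<and> Y p \<subseteq> A}" and ?R = "{p. p < m \<and> card (Y p) = 1 \<and> Y p \<subseteq> A}"
    have "{k \<in> K. hn k \<subseteq> A} \<subseteq> (\<lambda>p. N + 2 * p) ` ?S \<union> (\<lambda>p. N + 2 * p + 1) ` ?S"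
    proof
      fix k assume k: "k \<in> {k \<in> K. hn k \<subseteq> A}"
      then have p: "(k - N) div 2 \<in> ?S" by (auto simp: K_def hn_def)
      have "k = N + 2 * ((k - N) div 2) \<or> k = N + 2 * ((k - N) div 2) + 1" using k by (auto simp: K_def)
      then show "k \<in> (\<lambda>p. N + 2 * p) ` ?S \<union> (\<lambda>p. N + 2 * p + 1) ` ?S" using p by blast
    qed
    then have "card {k \<in> K. hn k \<subseteq> A} \<le> card ((\<lambda>p. N + 2 * p) ` ?S \<union> (\<lambda>p. N + 2 * p + 1) ` ?S)"
      by (intro card_mono) auto
    also have "\<dots> \<le> card ?S + card ?S" by (intro le_trans[OF card_Un_le] add_mono card_image_le) auto
    finally have 1: "card {k \<in> K. hn k \<subseteq> A} \<le> 2 * card ?S" by simp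
    have "(\<Sum>v\<in>A. card {p \<in> {..<m}. v \<in> {y. Y p = {y}}}) = (\<Sum>p\<in>{..<m}. card ({y. Y p = {y}} \<inter> A))"
      by (rule double_count[OF fA]) simp
    also have "\<dots> \<le> (\<Sum>p\<in>{..<m}. if p \<in> ?R then 1 else 0)"
    proof (rule sum_mono)
      fix p assume p: "p \<in> {..<m}"
      show "card ({y. Y p = {y}} \<inter> A) \<le> (if p \<in> ?R then 1 else 0)"
      proof (cases "{y. Y p = {y}} \<inter> A = {}")
        case True then show ?thesis by simp
      next
        case False
        then obtain y where "Y p = {y}" "y \<in> A" by auto
        then have "{y. Y p = {y}} \<inter> A = {y}" "p \<in> ?R" using p by auto
        then show ?thesis by simp
      qed
    qed
    also have "\<dots> = card ?R" by (simp add: sum.If_cases Int_def conj_ac lessThan_def)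
    finally have 2: "(\<Sum>v\<in>A. card {p \<in> {..<m}. Y p = {v}}) \<le> card ?R" by simp
    have "(\<Sum>v\<in>A. int (\<mu> v False) + int (\<mu> v True)) = 2 * int (\<Sum>v\<in>A. card {p \<in> {..<m}. Y p = {v}})"
      by (simp add: \<mu>_def sum_distrib_left)
    then have 3: "(\<Sum>v\<in>A. int (\<mu> v False) + int (\<mu> v True)) \<le> 2 * int (card ?R)" using 2 by linarith
    have "?R \<inter> ?S = {}" by auto
    then have "card ?R + card ?S = card (?R \<union> ?S)" by (simp add: card_Un_disjoint)
    also have "\<dots> \<le> card {p. p < m \<and> Y p \<subseteq> A}" by (intro card_mono) auto
    finally have "2 * int (card ?R) + 2 * int (card ?S) \<le> 2 * int (card {p. p < m \<and> Y p \<subseteq> A})" by linarith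
    then show "T + (\<Sum>v\<in>A. int (\<mu> v False) + int (\<mu> v True)) + int (card {k \<in> K. hn k \<subseteq> A}) \<le> pt A"
      using free[OF A] 1 3 unfolding Y_def by linarith
  qed
  then obtain \<phi> \<omega> where col: "col {} (modify C {x} {} {} \<mu> K hn hg) \<phi> \<omega>" by blast
  \<comment> \<open>Of the two parallel half-edges of opposite sign exactly one clashes; the end
    charged with it has a clash to spare once they are removed.\<close>
  define cl where "cl p = (if clash \<phi> True (Y p) then N + 2 * p else N + 2 * p + 1)" for p
  have cl: "cl p \<in> K \<and> hn (cl p) = Y p \<and> clash \<phi> (hg (cl p)) (Y p) \<and> (cl p - N) div 2 = p" if "p < m" "card (Y p) = 2" for p
  proof -
    have "clash \<phi> False (Y p) = (\<not> clash \<phi> True (Y p))" by (simp add: clash_def)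
    then show ?thesis using that by (auto simp: cl_def K_def hn_def hg_def)
  qed
  define ys where "ys p = (if card (Y p) = 2 then \<omega> (cl p) else (SOME y. y \<in> Y p))" for p
  have ys: "ys p \<in> Y p" if "p < m" for p
  proof (cases "card (Y p) = 2")
    case True
    have "cl p \<in> chs (modify C {x} {} {} \<mu> K hn hg)" using cl[OF that True] by simp
    then have "\<omega> (cl p) \<in> hn (cl p)" using col cl[OF that True] unfolding col_def by fastforce
    then show ?thesis using cl[OF that True] True by (simp add: ys_def)
  next
    case False
    have "Y p \<noteq> {}" using Y[OF that] by auto
    then show ?thesis using False some_in_eq by (auto simp: ys_def)
  qed
  have spare: "card {p. p < m \<and> ys p = y} \<le> \<mu> y (\<phi> y) + card {k \<in> K. \<omega> k = y \<and> clash \<phi> (hg k) (hn k)}" for y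
  proof -
    let ?A = "{p \<in> {..<m}. Y p = {y}}" and ?B = "{p. p < m \<and> card (Y p) = 2 \<and> ys p = y}"
    have "{p. p < m \<and> ys p = y} \<subseteq> ?A \<union> ?B"
    proof
      fix p assume "p \<in> {p. p < m \<and> ys p = y}"
      then have p: "p < m" "ys p = y" by auto
      obtain u v where uv: "Y p = {u, v}" using Y[OF p(1)] by blast
      show "p \<in> ?A \<union> ?B"
      proof (cases "u = v")
        case True then show ?thesis using uv p ys[OF p(1)] by auto
      next
        case False then show ?thesis using uv p by auto
      qed
    qed
    then have "card {p. p < m \<and> ys p = y} \<le> card (?A \<union> ?B)" by (intro card_mono) auto
    also have "\<dots> \<le> card ?A + card ?B" by (rule card_Un_le)
    also have "card ?B \<le> card {k \<in> K. \<omega> k = y \<and> clash \<phi> (hg k) (hn k)}"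
    proof (rule card_inj_on_le[of cl])
      show "inj_on cl ?B" by (rule inj_on_inverseI[of _ "\<lambda>k. (k - N) div 2"]) (use cl in auto)
      show "cl ` ?B \<subseteq> {k \<in> K. \<omega> k = y \<and> clash \<phi> (hg k) (hn k)}"
      proof
        fix k assume "k \<in> cl ` ?B"
        then obtain p where p: "p < m" "card (Y p) = 2" "ys p = y" "k = cl p" by auto
        then show "k \<in> {k \<in> K. \<omega> k = y \<and> clash \<phi> (hg k) (hn k)}" using cl[OF p(1,2)] by (simp add: ys_def)
      qed
    qed (use finK in auto)
    finally show ?thesis by (simp add: \<mu>_def)
  qed
  \<comment> \<open>The half-edge of the pair that leads to the end with the spare clash, and so can
    be charged there.\<close>
  define \<kappa> where "\<kappa> p = (if ys p \<in> che C (a p) then a p else b p)" for p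
  have \<kappa>: "che C (\<kappa> p) = {x, ys p}" if "p < m" for p
    using Y[OF that] ys[OF that] by (auto simp: \<kappa>_def)
  have "ccp C x n < int (card (full_clashes C (\<phi>(x := n)) x) + card (half_clashes C (\<phi>(x := n)) x) - card P)"
    if P: "P \<subseteq> \<kappa> ` {..<m}" "P \<subseteq> half_clashes C (\<phi>(x := n)) x" for n P
  proof (rule ccontr)
    assume "\<not> ?thesis"
    then have self: "int (card (full_clashes C (\<phi>(x := n)) x) + card (half_clashes C (\<phi>(x := n)) x) - card P) \<le> ccp C x n"
      by simp
    have oth: "card {e \<in> full_clashes C (\<phi>(x := n)) x. y \<in> e} + card {k \<in> P. y \<in> che C k}
        \<le> \<mu> y (\<phi> y) + card {k \<in> K. \<omega> k = y \<and> clash \<phi> (hg k) (hn k)}" if y: "y \<noteq> x" "y \<notin> Qs" for y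
    proof -
      have 0: "{e \<in> full_clashes C (\<phi>(x := n)) x. y \<in> e} = {}"
        using outer y unfolding outer_def fulls_def full_clashes_def by blast
      have "{k \<in> P. y \<in> che C k} \<subseteq> \<kappa> ` {p. p < m \<and> ys p = y}"
      proof
        fix k assume k: "k \<in> {k \<in> P. y \<in> che C k}"
        then obtain p where p: "p < m" "k = \<kappa> p" using P(1) by auto
        then have "y = ys p" using k \<kappa>[OF p(1)] y(1) by auto
        then show "k \<in> \<kappa> ` {p. p < m \<and> ys p = y}" using p by auto
      qed
      then have "card {k \<in> P. y \<in> che C k} \<le> card (\<kappa> ` {p. p < m \<and> ys p = y})" by (intro card_mono) auto
      also have "\<dots> \<le> card {p. p < m \<and> ys p = y}" by (intro card_image_le) auto
      finally show ?thesis using spare[of y] unfolding 0 by simp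
    qed
    show False by (rule no_extension[OF x finK col P(2) oth self])
  qed
  moreover have "\<forall>p<m. \<kappa> p \<in> {a p, b p}" by (simp add: \<kappa>_def)
  ultimately show ?thesis by blast
qed

text \<open>A clash in conflict with a rich \<open>x\<close> is reserved at the far end of
  \<open>e\<close> and of each half-edge in \<open>H\<close>. So a rich \<open>x\<close> may charge
  \<open>H\<close> elsewhere, and a poor \<open>x\<close> does no harm to neighbours outside
  \<open>Qs\<close> if \<open>e\<close> does not clash; the failure of both extensions gives the
  inequalities.\<close>

lemma unit_plan:
  assumes x: "x \<in> cvs C" and e: "e \<in> fulls C x" and H: "H \<subseteq> halves C x"
    and outer: "outer x \<subseteq> {e}"
    and free: "\<And>A. A \<subseteq> cvs C - {x} \<Longrightarrow> A \<noteq> {} \<Longrightarrow>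
      T + (if e \<subseteq> insert x A then 1 else 0) + int (card {k \<in> H. che C k \<subseteq> insert x A}) \<le> pt A"
  shows "\<exists>\<phi>. (\<forall>P. P \<subseteq> H \<longrightarrow> P \<subseteq> half_clashes C (\<phi>(x := True)) x \<longrightarrow>
      ccp C x True < int (card (full_clashes C (\<phi>(x := True)) x) + card (half_clashes C (\<phi>(x := True)) x) - card P))
    \<and> (e \<notin> full_clashes C (\<phi>(x := False)) x \<longrightarrow>
      ccp C x False < int (card (full_clashes C (\<phi>(x := False)) x) + card (half_clashes C (\<phi>(x := False)) x)))"
proof -
  have e2: "card e = 2" "x \<in> e" using e D(5)[of e] by (auto simp: fulls_def)
  have k2: "card (che C k) = 2" "x \<in> che C k" if "k \<in> H" for k using H D(7)[of k] that by (auto simp: halves_def)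
  have fH: "finite H" using H fin_cl(5) finite_subset by blast
  define \<mu> where "\<mu> y b = unit_at x e (csg C e) y b + (\<Sum>k\<in>H. unit_at x (che C k) (chsg C k) y b)" for y b
  have "\<exists>\<phi> \<omega>. col {} (modify C {x} {} {} \<mu> {} (\<lambda>_. {}) (\<lambda>_. True)) \<phi> \<omega>"
  proof (rule del_col[OF x])
    fix A assume A: "A \<subseteq> cvs C - {x}" "A \<noteq> {}"
    then have fA: "finite A" "x \<notin> A" using finsub[of A] by auto
    have "(\<Sum>v\<in>A. int (\<mu> v False) + int (\<mu> v True)) =
      (\<Sum>v\<in>A. (int (unit_at x e (csg C e) v False) + int (unit_at x e (csg C e) v True)) +
        (\<Sum>k\<in>H. int (unit_at x (che C k) (chsg C k) v False) + int (unit_at x (che C k) (chsg C k) v True)))"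
      by (intro sum.cong refl) (simp add: \<mu>_def sum.distrib)
    also have "\<dots> = (if e \<subseteq> insert x A then 1 else 0) +
      (\<Sum>v\<in>A. \<Sum>k\<in>H. int (unit_at x (che C k) (chsg C k) v False) + int (unit_at x (che C k) (chsg C k) v True))"
      unfolding sum.distrib[of _ _ A] using unit_at_sum[OF e2 fA(2,1)] by (simp add: sum.distrib)
    also have "(\<Sum>v\<in>A. \<Sum>k\<in>H. int (unit_at x (che C k) (chsg C k) v False) + int (unit_at x (che C k) (chsg C k) v True))
      = (\<Sum>k\<in>H. \<Sum>v\<in>A. int (unit_at x (che C k) (chsg C k) v False) + int (unit_at x (che C k) (chsg C k) v True))"
      by (rule sum.swap)
    also have "\<dots> = (\<Sum>k\<in>H. if che C k \<subseteq> insert x A then 1 else 0)"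
      by (intro sum.cong refl unit_at_sum[OF k2 fA(2,1)])
    also have "\<dots> = int (card {k \<in> H. che C k \<subseteq> insert x A})"
      using fH by (simp add: sum.If_cases Int_def)
    finally show "T + (\<Sum>v\<in>A. int (\<mu> v False) + int (\<mu> v True)) + int (card {k \<in> {}::nat set. {} \<subseteq> A}) \<le> pt A"
      using free[OF A] by simp
  qed auto
  then obtain \<phi> \<omega> where col: "col {} (modify C {x} {} {} \<mu> {} (\<lambda>_. {}) (\<lambda>_. True)) \<phi> \<omega>" by blast
  have only_e: "d = e" if "d \<in> full_clashes C \<psi> x" "y \<in> d" "y \<noteq> x" "y \<notin> Qs" for d y \<psi>
  proof -
    have "d \<in> outer x" using that unfolding outer_def fulls_def full_clashes_def by blast
    then show ?thesis using outer by blast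
  qed
  have "ccp C x True < int (card (full_clashes C (\<phi>(x := True)) x) + card (half_clashes C (\<phi>(x := True)) x) - card P)"
    if P: "P \<subseteq> H" "P \<subseteq> half_clashes C (\<phi>(x := True)) x" for P
  proof (rule ccontr)
    assume "\<not> ?thesis"
    then have self: "int (card (full_clashes C (\<phi>(x := True)) x) + card (half_clashes C (\<phi>(x := True)) x) - card P)
        \<le> ccp C x True" by simp
    have oth: "card {d \<in> full_clashes C (\<phi>(x := True)) x. y \<in> d} + card {k \<in> P. y \<in> che C k}
        \<le> \<mu> y (\<phi> y) + card {k \<in> {}::nat set. \<omega> k = y \<and> clash \<phi> True {}}" if y: "y \<noteq> x" "y \<notin> Qs" for y
    proof -
      have 1: "card {d \<in> full_clashes C (\<phi>(x := True)) x. y \<in> d} \<le> unit_at x e (csg C e) y (\<phi> y)"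
      proof (cases "{d \<in> full_clashes C (\<phi>(x := True)) x. y \<in> d} = {}")
        case True then show ?thesis unfolding True by simp
      next
        case False
        then obtain d where d: "d \<in> full_clashes C (\<phi>(x := True)) x" "y \<in> d" by auto
        then have "d = e" using only_e y by blast
        then have "y \<in> e" "clash (\<phi>(x := True)) (csg C e) e" using d by (auto simp: full_clashes_def)
        then have "unit_at x e (csg C e) y (\<phi> y) = 1" using unit_at_clash[OF e2 _ y(1)] by blast
        then show ?thesis using full_card_le[OF y(1), of "\<phi>(x := True)"] by simp
      qed
      have "card {k \<in> P. y \<in> che C k} = (\<Sum>k\<in>{k \<in> P. y \<in> che C k}. 1)" by simp
      also have "\<dots> = (\<Sum>k\<in>{k \<in> P. y \<in> che C k}. unit_at x (che C k) (chsg C k) y (\<phi> y))"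
      proof (rule sum.cong[OF refl])
        fix k assume "k \<in> {k \<in> P. y \<in> che C k}"
        then have k: "k \<in> H" "y \<in> che C k" "clash (\<phi>(x := True)) (chsg C k) (che C k)"
          using P by (auto simp: half_clashes_def)
        show "1 = unit_at x (che C k) (chsg C k) y (\<phi> y)"
          using unit_at_clash[OF k2[OF k(1)] k(2) y(1) k(3)] by simp
      qed
      also have "\<dots> \<le> (\<Sum>k\<in>H. unit_at x (che C k) (chsg C k) y (\<phi> y))"
        using fH P(1) by (intro sum_mono2) auto
      finally show ?thesis using 1 unfolding \<mu>_def by linarith
    qed
    show False by (rule no_extension[OF x _ _ col P(2) oth self]) auto
  qed
  moreover have "ccp C x False < int (card (full_clashes C (\<phi>(x := False)) x) + card (half_clashes C (\<phi>(x := False)) x))"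
    if ne: "e \<notin> full_clashes C (\<phi>(x := False)) x"
  proof (rule ccontr)
    assume "\<not> ?thesis"
    then have self: "int (card (full_clashes C (\<phi>(x := False)) x) + card (half_clashes C (\<phi>(x := False)) x) - card ({}::nat set))
        \<le> ccp C x False" by simp
    have oth: "card {d \<in> full_clashes C (\<phi>(x := False)) x. y \<in> d} + card {k \<in> {}. y \<in> che C k}
        \<le> \<mu> y (\<phi> y) + card {k \<in> {}::nat set. \<omega> k = y \<and> clash \<phi> True {}}" if y: "y \<noteq> x" "y \<notin> Qs" for y
    proof -
      have 0: "{d \<in> full_clashes C (\<phi>(x := False)) x. y \<in> d} = {}" using only_e ne y by blast
      show ?thesis unfolding 0 by simp
    qed
    show False by (rule no_extension[OF x _ _ col _ oth self]) auto
  qed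
  ultimately show ?thesis by blast
qed

section \<open>Vertices with many half-edges and at most one outer edge\<close>

lemma half_clash_iff:
  assumes "k \<in> halves C x"
  shows "k \<in> half_clashes C (\<phi>(x := b)) x \<longleftrightarrow> k \<notin> half_clashes C (\<phi>(x := \<not> b)) x"
proof -
  have k: "k \<in> chs C" "x \<in> che C k" using assms by (auto simp: halves_def)
  show ?thesis using k clash_flip[OF D(7)[OF k(1)] k(2), of \<phi> b] unfolding half_clashes_def by blast
qed

text \<open>Otherwise a pair could be bought by \<open>pair_plan\<close>, and one of the two
  half-edges charged away from \<open>x\<close>. It clashes with one of the nodes, so the failures
  of the two nodes need a total degree of at least the capacities plus 3.\<close>

lemma pair_excess:
  assumes x: "x \<in> cvs C" and outer: "outer x = {}" and ab: "a \<in> halves C x" "b \<in> halves C x"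
    and s: "int (card (fulls C x) + card (halves C x)) = ccp C x False + ccp C x True + 2"
  shows "excess x (ends x (che C) {a, b}) \<le> 0"
proof (rule ccontr)
  assume e: "\<not> ?thesis"
  have free: "T + 2 * int (card {p. p < (1::nat) \<and> (che C a \<union> che C b) - {x} \<subseteq> A}) \<le> pt A"
    if A: "A \<subseteq> cvs C - {x}" "A \<noteq> {}" for A
  proof (cases "(che C a \<union> che C b) - {x} \<subseteq> A")
    case True
    then have "excess x (ends x (che C) {a, b}) \<le> pt A - T - 1" by (intro excess_le A) (auto simp: ends_def)
    moreover have "card {p. p < (1::nat) \<and> (che C a \<union> che C b) - {x} \<subseteq> A} \<le> card {..<1::nat}" by (intro card_mono) auto
    then have "card {p. p < (1::nat) \<and> (che C a \<union> che C b) - {x} \<subseteq> A} \<le> 1" by simp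
    ultimately show ?thesis using e by linarith
  next
    case False
    then have "{p. p < (1::nat) \<and> (che C a \<union> che C b) - {x} \<subseteq> A} = {}" by blast
    moreover have "T \<le> pt A" using A by (intro sparseD) auto
    ultimately show ?thesis by (metis card.empty int_ops(1) add_0_right mult_zero_right)
  qed
  have ex: "\<exists>\<phi> \<kappa>. (\<forall>p<(1::nat). \<kappa> p \<in> {a, b}) \<and> (\<forall>n P. P \<subseteq> \<kappa> ` {..<1} \<longrightarrow> P \<subseteq> half_clashes C (\<phi>(x := n)) x \<longrightarrow>
      ccp C x n < int (card (full_clashes C (\<phi>(x := n)) x) + card (half_clashes C (\<phi>(x := n)) x) - card P))"
    by (rule pair_plan[of x 1 "\<lambda>_. a" "\<lambda>_. b", OF x outer]) (rule conjI[OF ab], rule free, assumption+)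
  obtain \<phi> \<kappa> where k1: "\<And>p::nat. p < 1 \<Longrightarrow> \<kappa> p \<in> {a, b}"
    and c: "\<And>n P. P \<subseteq> \<kappa> ` {..<1} \<Longrightarrow> P \<subseteq> half_clashes C (\<phi>(x := n)) x \<Longrightarrow>
      ccp C x n < int (card (full_clashes C (\<phi>(x := n)) x) + card (half_clashes C (\<phi>(x := n)) x) - card P)"
    using ex by (elim exE conjE) blast
  have kh: "\<kappa> 0 \<in> halves C x" using k1[of 0] ab by auto
  obtain n where n: "\<kappa> 0 \<in> half_clashes C (\<phi>(x := n)) x" using half_clash_iff[OF kh, of \<phi> True] by blast
  have 1: "ccp C x n < int (card (full_clashes C (\<phi>(x := n)) x) + card (half_clashes C (\<phi>(x := n)) x) - 1)"
    using c[of "{\<kappa> 0}" n] n by simp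
  have 2: "ccp C x (\<not> n) < int (card (full_clashes C (\<phi>(x := \<not> n)) x) + card (half_clashes C (\<phi>(x := \<not> n)) x))"
    using c[of "{}" "\<not> n"] by simp
  have "0 < card (half_clashes C (\<phi>(x := n)) x)" using n fin_cl(2) card_gt_0_iff by blast
  moreover have "ccp C x n + ccp C x (\<not> n) = ccp C x False + ccp C x True" by (cases n) auto
  ultimately show False
    using 1 2 s full_clashes_split[OF wf x, of \<phi> n] half_clashes_split[OF wf x, of \<phi> n] by linarith
qed

text \<open>If no pair has positive excess, neither has the set of all neighbours, although
  \<open>excess_bound\<close> demands it for so many half-edges.\<close>

lemma no_outer_crowded:
  assumes x: "x \<in> cvs C" and outer: "outer x = {}"
    and s: "int (card (fulls C x) + card (halves C x)) = ccp C x False + ccp C x True + 2"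
    and h: "2 \<le> card (halves C x)" "wt x + 2 \<le> int (card (halves C x))"
  shows False
proof -
  have ne: "halves C x \<noteq> {}" using h(1) by auto
  interpret sl: slack "\<lambda>J. excess x (ends x (che C) J)" "halves C x" by (rule slack_halves[OF x ne])
  note W = slack_halves(2)[OF x ne order_refl] slack_halves(3)[OF x ne]
  have "excess x (ends x (che C) (halves C x)) \<le> 0"
    by (rule sl.pairs_zero[OF order_refl h(1)]) (rule pair_excess[OF x outer _ _ s])
  moreover have "(int i + 1) * int (card ({} :: 'a set set)) + int (card (halves C x))
      \<le> wt x + 1 + excess x (ends x (che C) (halves C x))"
    by (rule excess_bound(1)[OF x W]) (auto simp: ends_def)
  ultimately show False using h(2) by simp
qed

text \<open>The count of \<open>pair_excess\<close> with two pairs: each of the two half-edges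
  charged away clashes with exactly one node, so the degree would have to be at least the capacities
  plus 4.\<close>

lemma four_excess:
  assumes x: "x \<in> cvs C" and outer: "outer x = {}" and abcd: "{a, b, c, d} \<subseteq> halves C x" "distinct [a, b, c, d]"
    and s: "int (card (fulls C x) + card (halves C x)) = ccp C x False + ccp C x True + 3"
  shows "excess x (ends x (che C) {a, b}) \<le> 0 \<or> excess x (ends x (che C) {c, d}) \<le> 0
    \<or> excess x (ends x (che C) {a, b, c, d}) \<le> 2"
proof (rule ccontr)
  assume e: "\<not> ?thesis"
  define f where "f p = (if p = (0::nat) then a else c)" for p
  define g where "g p = (if p = (0::nat) then b else d)" for p
  have free: "T + 2 * int (card {p. p < 2 \<and> (che C (f p) \<union> che C (g p)) - {x} \<subseteq> A}) \<le> pt A"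
    if A: "A \<subseteq> cvs C - {x}" "A \<noteq> {}" for A
  proof -
    let ?Z = "{p. p < 2 \<and> (che C (f p) \<union> che C (g p)) - {x} \<subseteq> A}"
    have p2: "p < 2 \<longleftrightarrow> p = 0 \<or> p = 1" for p :: nat by auto
    have e1: "ends x (che C) {a, b} \<subseteq> A" if "0 \<in> ?Z" using that by (auto simp: ends_def f_def g_def)
    have e2: "ends x (che C) {c, d} \<subseteq> A" if "1 \<in> ?Z" using that by (auto simp: ends_def f_def g_def)
    have e3: "ends x (che C) {a, b, c, d} = ends x (che C) {a, b} \<union> ends x (che C) {c, d}" by (auto simp: ends_def)
    have t: "T \<le> pt A" using A by (intro sparseD) auto
    have "Pow {0, 1} = {{}, {0}, {1}, {0, 1 :: nat}}" unfolding Pow_insert Pow_empty by auto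
    moreover have "?Z \<in> Pow {0, 1}" using p2 by auto
    ultimately have "?Z = {} \<or> ?Z = {0} \<or> ?Z = {1} \<or> ?Z = {0, 1}" by (simp only: insert_iff empty_iff simp_thms)
    then show ?thesis
    proof (elim disjE)
      assume 1: "?Z = {}" then show ?thesis using t by (metis card.empty int_ops(1) add_0_right mult_zero_right)
    next
      assume 2: "?Z = {0}"
      then have "excess x (ends x (che C) {a, b}) \<le> pt A - T - 1" using e1 by (intro excess_le A) simp
      then show ?thesis unfolding 2 using e by simp
    next
      assume 3: "?Z = {1}"
      then have "excess x (ends x (che C) {c, d}) \<le> pt A - T - 1" using e2 by (intro excess_le A) simp
      then show ?thesis unfolding 3 using e by simp
    next
      assume 4: "?Z = {0, 1}"
      then have "excess x (ends x (che C) {a, b, c, d}) \<le> pt A - T - 1"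
        unfolding e3 using e1 e2 by (intro excess_le A Un_least) simp_all
      then show ?thesis unfolding 4 using e by simp
    qed
  qed
  have fg: "f p \<in> halves C x \<and> g p \<in> halves C x" for p using abcd by (auto simp: f_def g_def)
  have ex: "\<exists>\<phi> \<kappa>. (\<forall>p<2. \<kappa> p \<in> {f p, g p}) \<and> (\<forall>n P. P \<subseteq> \<kappa> ` {..<2} \<longrightarrow> P \<subseteq> half_clashes C (\<phi>(x := n)) x \<longrightarrow>
      ccp C x n < int (card (full_clashes C (\<phi>(x := n)) x) + card (half_clashes C (\<phi>(x := n)) x) - card P))"
    by (rule pair_plan[of x 2 f g, OF x outer]) (rule fg, rule free, assumption+)
  obtain \<phi> \<kappa> where k: "\<And>p. p < 2 \<Longrightarrow> \<kappa> p \<in> {f p, g p}"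
    and col: "\<And>n P. P \<subseteq> \<kappa> ` {..<2} \<Longrightarrow> P \<subseteq> half_clashes C (\<phi>(x := n)) x \<Longrightarrow>
      ccp C x n < int (card (full_clashes C (\<phi>(x := n)) x) + card (half_clashes C (\<phi>(x := n)) x) - card P)"
    using ex by (elim exE conjE) blast
  have k01: "\<kappa> 0 \<in> halves C x" "\<kappa> 1 \<in> halves C x" "\<kappa> 0 \<noteq> \<kappa> 1"
    using k[of 0] k[of 1] abcd by (auto simp: f_def g_def)
  define P where "P n = {\<kappa> 0, \<kappa> 1} \<inter> half_clashes C (\<phi>(x := n)) x" for n
  have P: "ccp C x n < int (card (full_clashes C (\<phi>(x := n)) x) + card (half_clashes C (\<phi>(x := n)) x) - card (P n))" for n
    by (rule col) (auto simp: P_def)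
  have le: "card (P n) \<le> card (half_clashes C (\<phi>(x := n)) x)" for n
    using fin_cl(2) by (intro card_mono) (auto simp: P_def)
  have "P True \<union> P False = {\<kappa> 0, \<kappa> 1}" "P True \<inter> P False = {}"
    using half_clash_iff[OF k01(1), of \<phi> True] half_clash_iff[OF k01(2), of \<phi> True] by (auto simp: P_def)
  moreover have "finite (P n)" for n by (simp add: P_def)
  ultimately have "card (P True) + card (P False) = card {\<kappa> 0, \<kappa> 1}"
    using card_Un_disjoint[of "P True" "P False"] by simp
  then have "card (P True) + card (P False) = 2" using k01(3) by simp
  then show False
    using P[of True] P[of False] le[of True] le[of False] s full_clashes_split[OF wf x, of \<phi> True]
      half_clashes_split[OF wf x, of \<phi> True] by simp
qed

text \<open>The number of half-edges forces excess 3 on all of them and 2 after omitting one, which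
  is the input of \<open>no_four_plan\<close>.\<close>

lemma no_nine_halves:
  assumes x: "x \<in> cvs C" and outer: "outer x = {}"
    and s: "int (card (fulls C x) + card (halves C x)) = ccp C x False + ccp C x True + 3"
    and h: "4 \<le> card (halves C x)" "wt x + 4 \<le> int (card (halves C x))"
  shows False
proof -
  have ne: "halves C x \<noteq> {}" using h(1) by auto
  interpret sl: slack "\<lambda>J. excess x (ends x (che C) J)" "halves C x" by (rule slack_halves[OF x ne])
  note W = slack_halves(2)[OF x ne] slack_halves(3)[OF x ne]
  have all: "3 \<le> excess x (ends x (che C) (halves C x))"
  proof -
    have "(int i + 1) * int (card ({} :: 'a set set)) + int (card (halves C x))
      \<le> wt x + 1 + excess x (ends x (che C) (halves C x))"
      by (rule excess_bound(1)[OF x W(1)[OF order_refl] W(2)]) (auto simp: ends_def)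
    then show ?thesis using h(2) by simp
  qed
  show False
  proof (rule sl.no_four_plan[OF all _ h(1)])
    fix z assume z: "z \<in> halves C x"
    let ?H = "halves C x - {z}"
    have H: "?H \<subseteq> halves C x" by blast
    have "(int i + 1) * int (card ({} :: 'a set set)) + int (card ?H)
      \<le> wt x + 1 + excess x (ends x (che C) ?H)"
      by (rule excess_bound(1)[OF x W(1)[OF H] W(2)]) (auto simp: ends_def)
    then show "2 \<le> excess x (ends x (che C) ?H)" using h z fin_cl(5)[of x] by (simp add: card_Diff_singleton)
  qed (rule four_excess[OF x outer _ _ s])
qed

text \<open>The edges of a star at \<open>x\<close> under one index type: \<open>None\<close> is the
  outer edge, \<open>Some k\<close> a half-edge.\<close>

definition arm :: "'a set \<Rightarrow> nat option \<Rightarrow> 'a set" where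
  "arm e = case_option e (che C)"

lemma slack_arm:
  assumes x: "x \<in> cvs C" and e: "e \<in> fulls C x" and h: "halves C x \<noteq> {}"
  defines "K \<equiv> insert None (Some ` halves C x)"
  shows "slack (\<lambda>J. excess x (ends x (arm e) J)) K"
    and "\<And>J. J \<subseteq> K \<Longrightarrow> ends x (arm e) J \<subseteq> cvs C - {x}" "cvs C - {x} \<noteq> {}"
    and "\<And>k y. k \<in> K \<Longrightarrow> y \<in> arm e k \<Longrightarrow> y \<noteq> x \<Longrightarrow> T < wt y"
    and "\<And>k. k \<in> K \<Longrightarrow> card (arm e k) = 2 \<and> x \<in> arm e k \<and> arm e k \<subseteq> cvs C"
proof -
  obtain k0 where k0: "k0 \<in> chs C" "x \<in> che C k0" using h by (auto simp: halves_def)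
  have e': "e \<in> ces C" "x \<in> e" using e by (auto simp: fulls_def)
  have fK: "finite K" "K \<noteq> {}" using fin_cl(5) by (auto simp: K_def)
  have g: "card (arm e k) = 2 \<and> x \<in> arm e k \<and> arm e k \<subseteq> cvs C" if k: "k \<in> K" for k
  proof (cases k)
    case None then show ?thesis using D(4,5)[OF e'(1)] e'(2) by (simp add: arm_def)
  next
    case (Some l)
    then have "l \<in> chs C" "x \<in> che C l" using k by (auto simp: K_def halves_def)
    then show ?thesis using Some D(6,7)[of l] by (simp add: arm_def)
  qed
  have nt: "T < wt y" if k: "k \<in> K" "y \<in> arm e k" "y \<noteq> x" for k y
  proof (cases k)
    case None then show ?thesis using half_full_nontight[OF k0 e' _ k(3)] k(2) by (simp add: arm_def)
  next
    case (Some l)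
    then have "l \<in> chs C" "y \<in> che C l" using k by (auto simp: K_def halves_def arm_def)
    then show ?thesis by (rule half_nontight)
  qed
  note * = slack_excess[of x K "arm e", OF x fK]
  show "slack (\<lambda>J. excess x (ends x (arm e) J)) K" by (rule *(1)) (use g nt in blast)+
  show "ends x (arm e) J \<subseteq> cvs C - {x}" if "J \<subseteq> K" for J by (rule *(2)) (use g nt that in blast)+
  show "cvs C - {x} \<noteq> {}" by (rule *(3)) (use g nt in blast)+
  show "\<And>k y. k \<in> K \<Longrightarrow> y \<in> arm e k \<Longrightarrow> y \<noteq> x \<Longrightarrow> T < wt y" by (rule nt)
  show "\<And>k. k \<in> K \<Longrightarrow> card (arm e k) = 2 \<and> x \<in> arm e k \<and> arm e k \<subseteq> cvs C" by (rule g)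
qed

lemma arm_free:
  assumes x: "x \<in> cvs C" and e: "e \<in> fulls C x" and k: "k \<in> insert None (Some ` halves C x)" and h: "halves C x \<noteq> {}"
    and A: "A \<subseteq> cvs C - {x}" "arm e k \<subseteq> insert x A"
  shows "T + 1 \<le> pt A"
proof -
  have g: "card (arm e k) = 2" "x \<in> arm e k" using slack_arm(5)[OF x e h k] by auto
  obtain y where y: "y \<noteq> x" "arm e k = {x, y}" by (rule card2_other[OF g])
  then have "y \<in> A" "T < wt y" using A slack_arm(4)[OF x e h k, of y] by auto
  then show ?thesis using A x by (intro low[of A y]) auto
qed

lemma ends_arm_le: "(\<And>k. k \<in> J \<Longrightarrow> arm e k \<subseteq> insert x A) \<Longrightarrow> ends x (arm e) J \<subseteq> A"
  unfolding ends_def by blast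

text \<open>Otherwise clashes can be reserved for \<open>e\<close> and \<open>k\<close>. The rich
  node is overloaded, so by the exact degree the poor node has at most one clash; it tolerates this,
  so the clash must be on \<open>e\<close> and not on \<open>k\<close>. Then \<open>k\<close>
  clashes with the rich node, and charging it away requires one more edge than there is.\<close>

lemma arm_pair_excess:
  assumes x: "x \<in> cvs C" and e: "e \<in> fulls C x" and outer: "outer x \<subseteq> {e}" and k: "k \<in> halves C x"
    and s: "int (card (fulls C x) + card (halves C x)) = ccp C x True + 2" and c: "1 \<le> ccp C x False"
  shows "excess x (ends x (arm e) {None, Some k}) \<le> 0"
proof (rule ccontr)
  assume ex: "\<not> ?thesis"
  have h: "halves C x \<noteq> {}" using k by blast
  have H: "{k} \<subseteq> halves C x" using k by blast
  have free: "T + (if e \<subseteq> insert x A then 1 else 0) + int (card {k' \<in> {k}. che C k' \<subseteq> insert x A}) \<le> pt A"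
    if A: "A \<subseteq> cvs C - {x}" "A \<noteq> {}" for A
  proof -
    have t: "T \<le> pt A" using A by (intro sparseD) auto
    have te: "T + 1 \<le> pt A" if "e \<subseteq> insert x A" using arm_free[OF x e _ h A(1), of None] that by (simp add: arm_def)
    have tk: "T + 1 \<le> pt A" if "che C k \<subseteq> insert x A" using arm_free[OF x e _ h A(1), of "Some k"] that k by (simp add: arm_def)
    have b: "T + 2 \<le> pt A" if "e \<subseteq> insert x A" "che C k \<subseteq> insert x A"
    proof -
      have "ends x (arm e) {None, Some k} \<subseteq> A" by (rule ends_arm_le) (use that in \<open>auto simp: arm_def\<close>)
      then show ?thesis using excess_le[OF A, of "ends x (arm e) {None, Some k}"] ex by linarith
    qed
    have eq: "{k' \<in> {k}. che C k' \<subseteq> insert x A} = (if che C k \<subseteq> insert x A then {k} else {})" by auto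
    show ?thesis unfolding eq using t te tk b
      by (cases "e \<subseteq> insert x A"; cases "che C k \<subseteq> insert x A") auto
  qed
  obtain \<phi> where
    1: "\<And>P. P \<subseteq> {k} \<Longrightarrow> P \<subseteq> half_clashes C (\<phi>(x := True)) x \<Longrightarrow>
      ccp C x True < int (card (full_clashes C (\<phi>(x := True)) x) + card (half_clashes C (\<phi>(x := True)) x) - card P)"
    and 2: "e \<notin> full_clashes C (\<phi>(x := False)) x \<Longrightarrow>
      ccp C x False < int (card (full_clashes C (\<phi>(x := False)) x) + card (half_clashes C (\<phi>(x := False)) x))"
    using unit_plan[OF x e H outer free] by blast
  have sp: "card (full_clashes C (\<phi>(x := True)) x) + card (full_clashes C (\<phi>(x := False)) x) = card (fulls C x)"
    "card (half_clashes C (\<phi>(x := True)) x) + card (half_clashes C (\<phi>(x := False)) x) = card (halves C x)"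
    using full_clashes_split[OF wf x, of \<phi> True] half_clashes_split[OF wf x, of \<phi> True] by simp_all
  have le: "card (full_clashes C (\<phi>(x := False)) x) + card (half_clashes C (\<phi>(x := False)) x) \<le> 1"
    using 1[of "{}"] sp s by simp
  have "e \<in> full_clashes C (\<phi>(x := False)) x" using 2 le c by linarith
  then have "0 < card (full_clashes C (\<phi>(x := False)) x)" using fin_cl(1) card_gt_0_iff by blast
  then have "card (half_clashes C (\<phi>(x := False)) x) = 0" using le by linarith
  then have "k \<notin> half_clashes C (\<phi>(x := False)) x" using fin_cl(2) by auto
  then have kt: "k \<in> half_clashes C (\<phi>(x := True)) x" using half_clash_iff[OF k, of \<phi> True] by simp
  then have "0 < card (half_clashes C (\<phi>(x := True)) x)" using fin_cl(2) card_gt_0_iff by blast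
  then show False
    using 1[of "{k}"] kt sp s \<open>0 < card (full_clashes C (\<phi>(x := False)) x)\<close> by simp
qed

text \<open>Pairs of half-edges inherit excess 0 through the outer edge, so the whole star has it,
  contrary to \<open>excess_bound\<close>.\<close>

lemma no_outer_edge_crowded:
  assumes x: "x \<in> cvs C" and e: "e \<in> fulls C x" and outer: "outer x \<subseteq> {e}" and h: "halves C x \<noteq> {}"
    and s: "int (card (fulls C x) + card (halves C x)) = ccp C x True + 2" and c: "1 \<le> ccp C x False"
    and w: "wt x + 2 \<le> int i + 1 + int (card (halves C x))"
  shows False
proof -
  let ?K = "insert None (Some ` halves C x)"
  interpret sl: slack "\<lambda>J. excess x (ends x (arm e) J)" ?K by (rule slack_arm[OF x e h])
  note W = slack_arm(2)[OF x e h order_refl] slack_arm(3)[OF x e h]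
  have star: "excess x (ends x (arm e) {None, Some k}) \<le> 0" if "k \<in> halves C x" for k
    by (rule arm_pair_excess[OF x e outer that s c])
  have two: "excess x (ends x (arm e) {Some k, Some l}) \<le> 0" if kl: "k \<in> halves C x" "l \<in> halves C x" for k l
  proof -
    have "0 \<le> excess x (ends x (arm e) {None})" by (rule sl.nonneg) auto
    then have "excess x (ends x (arm e) ({None, Some k} \<union> {None, Some l})) \<le> 0"
      using star[OF kl(1)] star[OF kl(2)] kl by (intro sl.join[of _ _ "{None}"]) auto
    moreover have "excess x (ends x (arm e) {Some k, Some l}) \<le> excess x (ends x (arm e) ({None, Some k} \<union> {None, Some l}))"
      using kl by (intro sl.mono) auto
    ultimately show ?thesis by linarith
  qed
  have cK: "2 \<le> card ?K"
  proof -
    have "0 < card (Some ` halves C x)" using h fin_cl(5) by (simp add: card_gt_0_iff)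
    then show ?thesis using fin_cl(5) by simp
  qed
  have "excess x (ends x (arm e) ?K) \<le> 0"
  proof (rule sl.pairs_zero[OF order_refl cK])
    fix a b assume ab: "a \<in> ?K" "b \<in> ?K" "a \<noteq> b"
    show "excess x (ends x (arm e) {a, b}) \<le> 0"
    proof (cases a)
      case None
      then obtain k where "b = Some k" "k \<in> halves C x" using ab by auto
      then show ?thesis using star None by simp
    next
      case (Some k)
      then have k: "k \<in> halves C x" using ab by auto
      show ?thesis
      proof (cases b)
        case None then show ?thesis using star[OF k] Some by (simp add: insert_commute)
      next
        case (Some l)
        then have "l \<in> halves C x" using ab by auto
        then show ?thesis using two[OF k] Some \<open>a = Some k\<close> by simp
      qed
    qed
  qed
  moreover have "(int i + 1) * int (card {e}) + int (card (halves C x)) \<le> wt x + 1 + excess x (ends x (arm e) ?K)"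
    by (rule excess_bound(1)[OF x W]) (use e in \<open>auto simp: ends_def arm_def\<close>)
  ultimately show False using w by simp
qed

text \<open>With reserves for \<open>e\<close>, \<open>a\<close> and \<open>b\<close> the poor node
  has at most two clashes, which it tolerates, so \<open>e\<close> is one of them. Those of
  \<open>a\<close> and \<open>b\<close> that clash with the rich node are charged away, the others
  add to the clash on \<open>e\<close>; in total this exceeds the degree by one.\<close>

lemma arm_triple_excess:
  assumes x: "x \<in> cvs C" and e: "e \<in> fulls C x" and outer: "outer x \<subseteq> {e}"
    and ab: "a \<in> halves C x" "b \<in> halves C x" "a \<noteq> b"
    and s: "int (card (fulls C x) + card (halves C x)) = ccp C x True + 3" and c: "2 \<le> ccp C x False"
  shows "excess x (ends x (arm e) {None, Some a}) \<le> 0 \<or> excess x (ends x (arm e) {None, Some b}) \<le> 0 \<or>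
    excess x (ends x (arm e) {Some a, Some b}) \<le> 0 \<or> excess x (ends x (arm e) {None, Some a, Some b}) \<le> 1"
proof (rule ccontr)
  assume ex: "\<not> ?thesis"
  have h: "halves C x \<noteq> {}" using ab by blast
  have H: "{a, b} \<subseteq> halves C x" using ab by blast
  have free: "T + (if e \<subseteq> insert x A then 1 else 0) + int (card {k' \<in> {a, b}. che C k' \<subseteq> insert x A}) \<le> pt A"
    if A: "A \<subseteq> cvs C - {x}" "A \<noteq> {}" for A
  proof -
    have t: "T \<le> pt A" using A by (intro sparseD) auto
    have te: "T + 1 \<le> pt A" if "e \<subseteq> insert x A" using arm_free[OF x e _ h A(1), of None] that by (simp add: arm_def)
    have ta: "T + 1 \<le> pt A" if "che C a \<subseteq> insert x A" using arm_free[OF x e _ h A(1), of "Some a"] that ab by (simp add: arm_def)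
    have tb: "T + 1 \<le> pt A" if "che C b \<subseteq> insert x A" using arm_free[OF x e _ h A(1), of "Some b"] that ab by (simp add: arm_def)
    have b: "excess x (ends x (arm e) J) \<le> pt A - T - 1" if "\<forall>k\<in>J. arm e k \<subseteq> insert x A" for J
      using excess_le[OF A ends_arm_le] that by blast
    have tea: "T + 2 \<le> pt A" if "e \<subseteq> insert x A" "che C a \<subseteq> insert x A"
      using b[of "{None, Some a}"] that ex by (auto simp: arm_def)
    have teb: "T + 2 \<le> pt A" if "e \<subseteq> insert x A" "che C b \<subseteq> insert x A"
      using b[of "{None, Some b}"] that ex by (auto simp: arm_def)
    have tab: "T + 2 \<le> pt A" if "che C a \<subseteq> insert x A" "che C b \<subseteq> insert x A"
      using b[of "{Some a, Some b}"] that ex by (auto simp: arm_def)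
    have teab: "T + 3 \<le> pt A" if "e \<subseteq> insert x A" "che C a \<subseteq> insert x A" "che C b \<subseteq> insert x A"
      using b[of "{None, Some a, Some b}"] that ex by (auto simp: arm_def)
    have eq: "{k' \<in> {a, b}. che C k' \<subseteq> insert x A} =
        (if che C a \<subseteq> insert x A then {a} else {}) \<union> (if che C b \<subseteq> insert x A then {b} else {})" by auto
    show ?thesis unfolding eq using t te ta tb tea teb tab teab ab(3)
      by (cases "e \<subseteq> insert x A"; cases "che C a \<subseteq> insert x A"; cases "che C b \<subseteq> insert x A") auto
  qed
  obtain \<phi> where
    1: "\<And>P. P \<subseteq> {a, b} \<Longrightarrow> P \<subseteq> half_clashes C (\<phi>(x := True)) x \<Longrightarrow>
      ccp C x True < int (card (full_clashes C (\<phi>(x := True)) x) + card (half_clashes C (\<phi>(x := True)) x) - card P)"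
    and 2: "e \<notin> full_clashes C (\<phi>(x := False)) x \<Longrightarrow>
      ccp C x False < int (card (full_clashes C (\<phi>(x := False)) x) + card (half_clashes C (\<phi>(x := False)) x))"
    using unit_plan[OF x e H outer free] by blast
  have sp: "card (full_clashes C (\<phi>(x := True)) x) + card (full_clashes C (\<phi>(x := False)) x) = card (fulls C x)"
    "card (half_clashes C (\<phi>(x := True)) x) + card (half_clashes C (\<phi>(x := False)) x) = card (halves C x)"
    using full_clashes_split[OF wf x, of \<phi> True] half_clashes_split[OF wf x, of \<phi> True] by simp_all
  have le: "card (full_clashes C (\<phi>(x := False)) x) + card (half_clashes C (\<phi>(x := False)) x) \<le> 2"
    using 1[of "{}"] sp s by simp
  have "e \<in> full_clashes C (\<phi>(x := False)) x" using 2 le c by linarith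
  then have eF: "0 < card (full_clashes C (\<phi>(x := False)) x)" using fin_cl(1) card_gt_0_iff by blast
  define P where "P n = {a, b} \<inter> half_clashes C (\<phi>(x := n)) x" for n
  have leP: "card (P n) \<le> card (half_clashes C (\<phi>(x := n)) x)" for n
    using fin_cl(2) by (intro card_mono) (auto simp: P_def)
  have "P True \<union> P False = {a, b}" "P True \<inter> P False = {}"
    using half_clash_iff[OF ab(1), of \<phi> True] half_clash_iff[OF ab(2), of \<phi> True] by (auto simp: P_def)
  moreover have "finite (P n)" for n by (simp add: P_def)
  ultimately have "card (P True) + card (P False) = card {a, b}"
    using card_Un_disjoint[of "P True" "P False"] by simp
  then have "card (P True) + card (P False) = 2" using ab(3) by simp
  moreover have "ccp C x True < int (card (full_clashes C (\<phi>(x := True)) x) + card (half_clashes C (\<phi>(x := True)) x) - card (P True))"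
    by (rule 1) (auto simp: P_def)
  ultimately show False using eF leP[of True] leP[of False] sp s by simp
qed

text \<open>Weight 5 against the outer edge and six half-edges forces total excess 3. The second
  part of \<open>excess_bound\<close> then bounds the smaller sets as \<open>no_star_plan\<close>
  requires.\<close>

lemma no_six_halves:
  assumes x: "x \<in> cvs C" and e: "e \<in> fulls C x" and outer: "outer x \<subseteq> {e}"
    and s: "int (card (fulls C x) + card (halves C x)) = ccp C x True + 3" and c: "2 \<le> ccp C x False"
    and h: "card (halves C x) = 6" and i: "i = 2" and w: "wt x = 5"
  shows False
proof -
  have hne: "halves C x \<noteq> {}" using h by auto
  let ?K = "insert None (Some ` halves C x)"
  let ?L = "Some ` halves C x"
  interpret sl: slack "\<lambda>J. excess x (ends x (arm e) J)" ?K by (rule slack_arm[OF x e hne])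
  note W = slack_arm(2)[OF x e hne]
  note ne = slack_arm(3)[OF x e hne]
  have all: "3 \<le> excess x (ends x (arm e) ?K)"
  proof -
    have "(int i + 1) * int (card {e}) + int (card (halves C x)) \<le> wt x + 1 + excess x (ends x (arm e) ?K)"
      by (rule excess_bound(1)[OF x W[OF order_refl] ne]) (use e in \<open>auto simp: ends_def arm_def\<close>)
    then show ?thesis using w h i by simp
  qed
  have total: "3 \<le> excess x (cvs C - {x})"
    using all excess_mono[OF W[OF order_refl] order_refl ne] by linarith
  show False
  proof (rule sl.no_star_plan[of None ?L])
    show "?L = ?K - {None}" by auto
    show "5 \<le> card ?L" using h by (simp add: card_image)
    show "excess x (ends x (arm e) (J \<union> J')) \<le> excess x (ends x (arm e) J) + excess x (ends x (arm e) J') + 1"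
      if "J \<subseteq> ?K" "J' \<subseteq> ?K" for J J'
    proof -
      have "ends x (arm e) (J \<union> J') = ends x (arm e) J \<union> ends x (arm e) J'" by (auto simp: ends_def)
      then show ?thesis using excess_weak[OF W[OF that(1)] W[OF that(2)] ne] by simp
    qed
    have L: "?L \<subseteq> ?K" by blast
    have "(int i + 1) * int (card ({} :: 'a set set)) + int (card (halves C x)) \<le> wt x + excess x (ends x (arm e) ?L) \<or>
        excess x (cvs C - {x}) \<le> excess x (ends x (arm e) ?L)"
      by (rule excess_bound(2)[OF x W[OF L] ne]) (auto simp: ends_def arm_def)
    then show "1 \<le> excess x (ends x (arm e) ?L)" using total w h by auto
    show "1 \<le> excess x (ends x (arm e) (insert None J))" if J: "J \<subseteq> ?L" "3 \<le> card J" for J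
    proof -
      have sub: "insert None J \<subseteq> ?K" using J by blast
      obtain H where H: "H \<subseteq> halves C x" "J = Some ` H" using J(1) by (rule subset_imageE)
      then have cH: "3 \<le> card H" using J(2) by (simp add: card_image)
      have "(int i + 1) * int (card {e}) + int (card H) \<le> wt x + excess x (ends x (arm e) (insert None J)) \<or>
          excess x (cvs C - {x}) \<le> excess x (ends x (arm e) (insert None J))"
        by (rule excess_bound(2)[OF x W[OF sub] ne _ _ H(1)]) (use e H(2) in \<open>auto simp: ends_def arm_def\<close>)
      then show ?thesis using total w cH i by auto
    qed
    show "excess x (ends x (arm e) {None, a}) \<le> 0 \<or> excess x (ends x (arm e) {None, b}) \<le> 0 \<or>
        excess x (ends x (arm e) {a, b}) \<le> 0 \<or> excess x (ends x (arm e) {None, a, b}) \<le> 1"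
      if "a \<in> ?L" "b \<in> ?L" "a \<noteq> b" for a b
      using that arm_triple_excess[OF x e outer _ _ _ s c] by auto
  qed (use all in auto)
qed

section \<open>The degree balance at every vertex\<close>

lemma outer_qdeg:
  assumes "x \<in> cvs C" "x \<notin> Qs"
  shows "card (fulls C x) = card (outer x) + qdeg x"
proof -
  have "fulls C x = outer x \<union> {e \<in> fulls C x. e \<inter> Qs \<noteq> {}}"
  proof
    show "fulls C x \<subseteq> outer x \<union> {e \<in> fulls C x. e \<inter> Qs \<noteq> {}}"
    proof
      fix e assume e: "e \<in> fulls C x"
      then have "card e = 2" "x \<in> e" using D(5) by (auto simp: fulls_def)
      then obtain y where "y \<noteq> x" "e = {x, y}" by (rule card2_other)
      then show "e \<in> outer x \<union> {e \<in> fulls C x. e \<inter> Qs \<noteq> {}}" using e unfolding outer_def by blast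
    qed
  qed (auto simp: outer_def)
  moreover have "outer x \<inter> {e \<in> fulls C x. e \<inter> Qs \<noteq> {}} = {}"
  proof -
    have "e \<inter> Qs = {}" if eo: "e \<in> outer x" for e
    proof -
      obtain y where y: "e \<in> fulls C x" "y \<in> e" "y \<noteq> x" "y \<notin> Qs" using eo unfolding outer_def by blast
      then have "card e = 2" "x \<in> e" using D(5) by (auto simp: fulls_def)
      then obtain z where "z \<noteq> x" "e = {x, z}" by (rule card2_other)
      then show ?thesis using y assms(2) by blast
    qed
    then show ?thesis by blast
  qed
  moreover have "finite (outer x)" "finite {e \<in> fulls C x. e \<inter> Qs \<noteq> {}}"
    using fin_cl(4)[of x] by (auto simp: outer_def)
  ultimately show ?thesis unfolding qdeg_def by (metis card_Un_disjoint)
qed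

lemma outer_single:
  assumes "card (outer x) = 1"
  obtains e where "e \<in> fulls C x" "outer x \<subseteq> {e}"
proof -
  obtain e where e: "outer x = {e}" using assms by (rule card_1_singletonE)
  then have "e \<in> outer x" by simp
  then have "e \<in> fulls C x" by (simp add: outer_def)
  then show ?thesis using that e by simp
qed

lemma outer_none: "card (outer x) = 0 \<Longrightarrow> outer x = {}"
proof -
  assume c: "card (outer x) = 0"
  have "finite (outer x)" using fin_cl(4)[of x] by (simp add: outer_def)
  then show ?thesis using c by simp
qed

lemma cap_facts:
  assumes "x \<in> cvs C"
  shows "- 1 \<le> ccp C x False" "ccp C x False \<le> int i" "- 1 \<le> ccp C x True" "ccp C x True \<le> int j"
    "wt x = int i - int j + 1 + ccp C x False + ccp C x True"
  using D(8-10)[OF assms] by (auto simp: wgt_def)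

lemma half_vertex_facts:
  assumes x: "x \<in> cvs C" and h: "card (halves C x) \<noteq> 0"
  shows "0 \<le> ccp C x False" "0 \<le> ccp C x True"
    "ccp C x True + 2 \<le> int (card (fulls C x)) + int (card (halves C x))"
    "card (outer x) = 0 \<Longrightarrow> ccp C x False + ccp C x True + 2 \<le> int (card (fulls C x)) + int (card (halves C x))"
proof -
  have "halves C x \<noteq> {}" using h by auto
  then obtain k where k: "k \<in> chs C" "x \<in> che C k" by (auto simp: halves_def)
  show "0 \<le> ccp C x False" "0 \<le> ccp C x True" using half_caps[OF k] by auto
  show "ccp C x True + 2 \<le> int (card (fulls C x)) + int (card (halves C x))" using half_degree(1)[OF k] by simp
  show "ccp C x False + ccp C x True + 2 \<le> int (card (fulls C x)) + int (card (halves C x))" if "card (outer x) = 0"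
    using half_degree(2)[OF k outer_none[OF that]] by simp
qed

lemma few_fulls:
  assumes x: "x \<in> cvs C" and h: "card (halves C x) = 0"
  shows "card (fulls C x) \<noteq> 0"
    and "card (fulls C x) = 1 \<Longrightarrow> 0 \<le> ccp C x False \<Longrightarrow> 0 \<le> ccp C x True \<Longrightarrow> False"
    and "card (fulls C x) = 1 \<Longrightarrow> 1 \<le> ccp C x True \<Longrightarrow> wt x \<le> int i \<Longrightarrow> False"
    and "card (fulls C x) = 2 \<Longrightarrow> 1 \<le> ccp C x False \<Longrightarrow> 1 \<le> ccp C x True \<Longrightarrow> False"
    and "card (fulls C x) = 2 \<Longrightarrow> 2 \<le> ccp C x True \<Longrightarrow> wt x \<le> int i + 1 \<Longrightarrow> False"
proof -
  have h0: "halves C x = {}" using h fin_cl(5) by simp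
  show "card (fulls C x) \<noteq> 0" using not_isolated[OF x] h0 fin_cl(4) by auto
  show False if "card (fulls C x) = 1" "0 \<le> ccp C x False" "0 \<le> ccp C x True"
    using that(1) by (rule card_1_singletonE) (rule no_leaf[OF x _ h0 that(2,3)])
  show False if "card (fulls C x) = 1" "1 \<le> ccp C x True" "wt x \<le> int i"
    using that(1) by (rule card_1_singletonE) (rule no_poor_leaf[OF x _ h0 that(2,3)])
  show False if "card (fulls C x) = 2" "1 \<le> ccp C x False" "1 \<le> ccp C x True"
  proof -
    obtain e e' where "fulls C x = {e, e'}" "e \<noteq> e'" using \<open>card (fulls C x) = 2\<close> card_2_iff by metis
    then show False by (rule no_path_vertex[OF x _ _ h0 that(2,3)])
  qed
  show False if "card (fulls C x) = 2" "2 \<le> ccp C x True" "wt x \<le> int i + 1"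
  proof -
    obtain e e' where "fulls C x = {e, e'}" "e \<noteq> e'" using \<open>card (fulls C x) = 2\<close> card_2_iff by metis
    then show False by (rule no_rich_path_vertex[OF x _ _ h0 that(2,3)])
  qed
qed

lemma balance_one:
  assumes x: "x \<in> cvs C" and i: "i = 1"
  shows "2 * wt x \<le> 2 * int (card (fulls C x)) + int (card (halves C x))"
proof (rule ccontr)
  assume n: "\<not> ?thesis"
  define f h a b J w where defs: "f = int (card (fulls C x))" "h = int (card (halves C x))" "a = ccp C x False"
    "b = ccp C x True" "J = int j" "w = wt x"
  have xQ: "x \<notin> Qs" unfolding Qs_def using i by simp
  have "qdeg x = 0" unfolding qdeg_def Qs_def using i by simp
  then have g: "card (outer x) = card (fulls C x)" using outer_qdeg[OF x xQ] by simp
  have c: "- 1 \<le> a" "a \<le> 1" "- 1 \<le> b" "b \<le> J" "w = 2 - J + a + b" "2 \<le> J" "0 \<le> f" "0 \<le> h" "2 * f + h < 2 * w"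
    using cap_facts[OF x] ji n i by (simp_all add: defs)
  show False
  proof (cases "card (halves C x) = 0")
    case True
    then have h: "h = 0" by (simp add: defs)
    note ff = few_fulls[OF x True]
    have f1: "card (fulls C x) = 1" if "f = 1" using that by (simp add: defs)
    have f2: "card (fulls C x) = 2" if "f = 2" using that by (simp add: defs)
    have "f \<noteq> 0" using ff(1) by (simp add: defs)
    moreover have "f \<noteq> 1 \<or> a < 0 \<or> b < 0"
    proof (rule ccontr)
      assume "\<not> ?thesis"
      then have "f = 1" "0 \<le> a" "0 \<le> b" by auto
      then show False using ff(2)[OF f1] by (simp add: defs)
    qed
    moreover have "f \<noteq> 2 \<or> a < 1 \<or> b < 1"
    proof (rule ccontr)
      assume "\<not> ?thesis"
      then have "f = 2" "1 \<le> a" "1 \<le> b" by auto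
      then show False using ff(4)[OF f2] by (simp add: defs)
    qed
    ultimately show False using c h by linarith
  next
    case False
    note hf = half_vertex_facts[OF x False]
    have hn: "halves C x \<noteq> {}" using False by auto
    have h1: "1 \<le> h" using False by (simp add: defs)
    have d: "0 \<le> a" "0 \<le> b" "b + 2 \<le> f + h" using hf(1-3) by (simp_all add: defs)
    show False
    proof (cases "card (fulls C x) = 0")
      case True
      have f: "f = 0" using True by (simp add: defs)
      have "a + b + 2 \<le> f + h" using hf(4) g True by (simp add: defs)
      then have "f + h = a + b + 2 \<and> w + 2 \<le> h \<and> 2 \<le> h" using c f by linarith
      then show False using no_outer_crowded[OF x outer_none] g True by (simp add: defs)
    next
      case f0: False
      then have f1: "1 \<le> f" by (simp add: defs)
      \<comment> \<open>The remaining vertices have one full edge and meet the degree bound of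
        \<open>half_degree\<close> with equality.\<close>
      then have "w = 3" using c d h1 by linarith
      then have *: "f = 1 \<and> f + h = b + 2 \<and> 1 \<le> a \<and> w + 2 \<le> 2 + h" using c d h1 f1 by linarith
      then have "card (outer x) = 1" using g by (simp add: defs)
      then obtain e where e: "e \<in> fulls C x" "outer x \<subseteq> {e}" by (rule outer_single)
      show False using no_outer_edge_crowded[OF x e hn] * i by (simp add: defs)
    qed
  qed
qed

lemma balance_two:
  assumes x: "x \<in> cvs C" and i: "i = 2" and xQ: "x \<notin> Qs"
  shows "6 * wt x + int (qdeg x) \<le> 9 * int (card (fulls C x)) + 3 * int (card (halves C x))"
proof (rule ccontr)
  assume n: "\<not> ?thesis"
  define f h a b J w q g where defs: "f = int (card (fulls C x))" "h = int (card (halves C x))" "a = ccp C x False"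
    "b = ccp C x True" "J = int j" "w = wt x" "q = int (qdeg x)" "g = int (card (outer x))"
  have fg: "f = g + q" using outer_qdeg[OF x xQ] by (simp add: defs)
  have c: "- 1 \<le> a" "a \<le> 2" "- 1 \<le> b" "b \<le> J" "w = 3 - J + a + b" "4 \<le> J" "0 \<le> g" "0 \<le> q" "0 \<le> h"
      "9 * f + 3 * h < 6 * w + q"
    using cap_facts[OF x] ji n i by (simp_all add: defs)
  show False
  proof (cases "card (halves C x) = 0")
    case True
    then have h: "h = 0" by (simp add: defs)
    note ff = few_fulls[OF x True]
    have f1: "card (fulls C x) = 1" if "f = 1" using that by (simp add: defs)
    have f2: "card (fulls C x) = 2" if "f = 2" using that by (simp add: defs)
    have 1: "f \<noteq> 0" using ff(1) by (simp add: defs)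
    have 2: "f \<noteq> 1 \<or> a < 0 \<or> b < 0"
    proof (rule ccontr)
      assume "\<not> ?thesis"
      then have "f = 1" "0 \<le> a" "0 \<le> b" by auto
      then show False using ff(2)[OF f1] by (simp add: defs)
    qed
    have 3: "f \<noteq> 1 \<or> b < 1 \<or> 2 < w"
    proof (rule ccontr)
      assume "\<not> ?thesis"
      then have "f = 1" "1 \<le> b" "w \<le> 2" by auto
      then show False using ff(3)[OF f1] i by (simp add: defs)
    qed
    have 4: "f \<noteq> 2 \<or> a < 1 \<or> b < 1"
    proof (rule ccontr)
      assume "\<not> ?thesis"
      then have "f = 2" "1 \<le> a" "1 \<le> b" by auto
      then show False using ff(4)[OF f2] by (simp add: defs)
    qed
    have 5: "f \<noteq> 2 \<or> b < 2 \<or> 3 < w"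
    proof (rule ccontr)
      assume "\<not> ?thesis"
      then have "f = 2" "2 \<le> b" "w \<le> 3" by auto
      then show False using ff(5)[OF f2] i by (simp add: defs)
    qed
    have f3: "f \<le> 3" using c fg h by linarith
    have "f \<noteq> 1" using 2 3 c fg h by linarith
    moreover have "f \<noteq> 2" using 4 5 c fg h by linarith
    ultimately have f: "f = 3" using f3 1 c fg by linarith
    \<comment> \<open>Three full edges without half-edges violate the balance only at weight 5,
      hence at full capacities: exactly the vertices in \<open>Qs\<close>.\<close>
    then have "w = 5" using c fg h by linarith
    then have "a = 2 \<and> b = J" using c by linarith
    then have "x \<in> Qs" using f True x i fin_cl(5)[of x] unfolding Qs_def defs by simp
    then show False using xQ by blast
  next
    case False
    note hf = half_vertex_facts[OF x False]
    have hn: "halves C x \<noteq> {}" using False by auto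
    have h1: "1 \<le> h" using False by (simp add: defs)
    have d: "0 \<le> a" "0 \<le> b" "b + 2 \<le> f + h" using hf(1-3) by (simp_all add: defs)
    have "w \<le> 5" using c by linarith
    have "g \<le> 2" using c fg h1 \<open>w \<le> 5\<close> by linarith
    have "g \<noteq> 2"
    proof
      assume "g = 2"
      moreover have "q = 0 \<or> 1 \<le> q" using c by linarith
      moreover have "w = 4 \<or> w = 5" using c fg h1 \<open>w \<le> 5\<close> \<open>g = 2\<close> by linarith
      ultimately show False using c d h1 fg by linarith
    qed
    then consider "g = 0" | "g = 1" using \<open>g \<le> 2\<close> c by linarith
    then show False
    proof cases
      case 1
      then have o: "outer x = {}" by (intro outer_none) (simp add: defs)
      have s: "a + b + 2 \<le> f + h" using hf(4) 1 by (simp add: defs)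
      have w: "w = 4 \<or> w = 5" using c s fg 1 \<open>w \<le> 5\<close> by linarith
      have q: "q = 0 \<or> q = 1" using c s fg 1 w by linarith
      have B: "w + J - 1 \<le> q + h" "8 * q + 3 * h < 6 * w" using c s fg 1 by linarith+
      have J: "J = 4 \<or> J = 5" using B w q c(6) by (elim disjE) linarith+
      have h: "h = 7 \<or> h = 8 \<or> h = 9" using B w q J by (elim disjE) linarith+
      \<comment> \<open>The second alternative arises only for \<open>h = 9\<close> and
        \<open>w = 5\<close>, with \<open>J = 4\<close> and \<open>q = 0\<close>.\<close>
      have "q + h = w + J - 1 \<and> w + 2 \<le> h \<and> 2 \<le> h \<or> q + h = w + J \<and> w + 4 \<le> h \<and> 4 \<le> h"
        using w q J h B by (elim disjE) simp_all
      then have "f + h = a + b + 2 \<and> w + 2 \<le> h \<and> 2 \<le> h \<or> f + h = a + b + 3 \<and> w + 4 \<le> h \<and> 4 \<le> h"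
        using c(5) fg 1 by auto
      then show False
      proof
        assume "f + h = a + b + 2 \<and> w + 2 \<le> h \<and> 2 \<le> h"
        then show False using no_outer_crowded[OF x o] by (simp add: defs)
      next
        assume "f + h = a + b + 3 \<and> w + 4 \<le> h \<and> 4 \<le> h"
        then show False using no_nine_halves[OF x o] by (simp add: defs)
      qed
    next
      case 2
      then have "card (outer x) = 1" by (simp add: defs)
      then obtain e where e: "e \<in> fulls C x" "outer x \<subseteq> {e}" by (rule outer_single)
      have w: "w = 4 \<or> w = 5" using c d fg 2 \<open>w \<le> 5\<close> by linarith
      have q: "q = 0 \<or> q = 1" using c d fg 2 w by linarith
      have B: "w + J \<le> q + h + a + 2" "9 + 8 * q + 3 * h < 6 * w" "w - 3 \<le> a" using c d fg 2 by linarith+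
      have a: "a = 0 \<or> a = 1 \<or> a = 2" using c(2) d(1) by linarith
      have J: "J = 4 \<or> J = 5" using B w q c(2,6) by (elim disjE) linarith+
      have h: "h = 4 \<or> h = 5 \<or> h = 6" using B w q J c(2) by (elim disjE) linarith+
      have "q + h + a + 2 = w + J \<and> 1 \<le> a \<and> w + 2 \<le> 3 + h \<or> q + h + a + 1 = w + J \<and> 2 \<le> a \<and> h = 6 \<and> w = 5"
        using w q J h a B by (elim disjE) simp_all
      then have "f + h = b + 2 \<and> 1 \<le> a \<and> w + 2 \<le> 3 + h \<or> f + h = b + 3 \<and> 2 \<le> a \<and> h = 6 \<and> w = 5"
        using c(5) fg 2 by auto
      then show False
      proof
        assume "f + h = b + 2 \<and> 1 \<le> a \<and> w + 2 \<le> 3 + h"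
        then show False using no_outer_edge_crowded[OF x e hn] i by (simp add: defs)
      next
        assume "f + h = b + 3 \<and> 2 \<le> a \<and> h = 6 \<and> w = 5"
        then show False using no_six_halves[OF x e] i by (simp add: defs)
      qed
    qed
  qed
qed

lemma contradiction: False
  using discharge[OF balance_one balance_two] by blast

end

theorem sparse_colorable:
  fixes C :: "'a config"
  assumes ij: "i = 1 \<or> i = 2" "2 * i \<le> j"
  shows "conf_wf i j C \<Longrightarrow> sparse i j C \<Longrightarrow> conf_colorable C"
proof (induction C rule: wf_induct_rule[OF wf_measures[of "[\<lambda>C. card (cvs C), \<lambda>C. card (ces C) + card (chs C)]"]])
  case (1 C)
  show ?case
  proof (rule ccontr)
    assume "\<not> conf_colorable C"
    then interpret minimal_counterexample i j C
      using ij 1 by unfold_locales auto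
    show False by (rule contradiction)
  qed
qed

section \<open>The edge bound\<close>

definition plain :: "nat \<Rightarrow> nat \<Rightarrow> 'a set \<Rightarrow> 'a set set \<Rightarrow> ('a set \<Rightarrow> bool) \<Rightarrow> 'a config" where
  "plain i j V E sg = \<lparr>cvs = V, ces = E, csg = sg, chs = {}, che = (\<lambda>_. {}), chsg = (\<lambda>_. True),
     ccp = (\<lambda>_ b. if b then int j else int i)\<rparr>"

lemma plain_simps [simp]:
  "cvs (plain i j V E sg) = V" "ces (plain i j V E sg) = E" "csg (plain i j V E sg) = sg"
  "chs (plain i j V E sg) = {}" "che (plain i j V E sg) = (\<lambda>_. {})" "chsg (plain i j V E sg) = (\<lambda>_. True)"
  "ccp (plain i j V E sg) v b = (if b then int j else int i)"
  by (auto simp: plain_def)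

lemma plain_colorable:
  "conf_colorable (plain i j V E sg) \<longleftrightarrow>
    (\<exists>\<phi>. \<forall>v\<in>V. card {e \<in> E. v \<in> e \<and> clash \<phi> (sg e) e} \<le> (if \<phi> v then j else i))"
proof -
  have "half_hits (plain i j V E sg) \<phi> \<omega> v = {}" for \<phi> \<omega> v by (simp add: half_hits_def)
  moreover have "full_clashes (plain i j V E sg) \<phi> v = {e \<in> E. v \<in> e \<and> clash \<phi> (sg e) e}" for \<phi> v
    by (simp add: full_clashes_def)
  ultimately show ?thesis by (simp add: conf_colorable_def col_def)
qed

lemma plain_wf: "simple_graph G \<Longrightarrow> conf_wf i j (plain i j (verts G) (edges G) sg)"
  by (auto simp: simple_graph_def conf_wf_def)

lemma plain_pot:
  "pot i j (plain i j V E sg) A = (2 * int i + 1) * int (card A) - (int i + 1) * int (card {e \<in> E. e \<subseteq> A})"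
  by (simp add: pot_def wgt_def algebra_simps)

lemma plain_restr: "restr (plain i j V E sg) S = plain i j S {e \<in> E. e \<subseteq> S} sg"
  by (simp add: restr_def plain_def)

lemma simple_edge:
  assumes "simple_graph G" "e \<in> edges G" "v \<in> e"
  obtains u where "u \<noteq> v" "e = {v, u}" "u \<in> verts G" "v \<in> verts G"
proof -
  have e: "card e = 2" "e \<subseteq> verts G" using assms(1,2) by (auto simp: simple_graph_def)
  obtain u where u: "u \<noteq> v" "e = {v, u}" using card2_other[OF e(1) assms(3)] .
  then show ?thesis using that[OF u] e(2) by blast
qed

text \<open>A matching between two lists joins nodes of equal kind only, or nodes of different kind only:
  this is the sign of the edge.\<close>

lemma noncolorable_plain:
  assumes G: "simple_graph G" and nc: "\<not> colorable i j G"
  obtains sg where "\<not> conf_colorable (plain i j (verts G) (edges G) sg)"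
proof -
  obtain \<H> :: "('a, nat) cover" where H: "cover_of G \<H>" and no: "\<And>\<phi>. \<not> cover_coloring i j G \<H> \<phi>"
    using nc unfolding colorable_def by blast
  define nd where "nd v b = (if b then rich \<H> v else poor \<H> v)" for v b
  note H' = H[unfolded cover_of_def]
  have simpH: "simple_graph (cover_graph \<H>)" and dis: "disjoint_family_on (nodes \<H>) (verts G)"
    and un: "(\<Union>u\<in>verts G. nodes \<H> u) = verts (cover_graph \<H>)"
    and c2': "\<forall>u\<in>verts G. card (nodes \<H> u) = 2"
    and pr': "\<forall>u\<in>verts G. nodes \<H> u = {poor \<H> u, rich \<H> u}"
    and adj': "\<forall>u\<in>verts G. \<forall>v\<in>verts G.
      edges_between (cover_graph \<H>) (nodes \<H> u) (nodes \<H> v) \<noteq> {} \<longrightarrow> u = v \<or> {u, v} \<in> edges G"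
    and mat': "\<forall>u\<in>verts G. \<forall>v\<in>verts G. {u, v} \<in> edges G \<longrightarrow>
      disjoint (edges_between (cover_graph \<H>) (nodes \<H> u) (nodes \<H> v))"
    using H' by - (elim conjE, assumption)+
  note c2 = c2'[rule_format] and pr = pr'[rule_format] and adj = adj'[rule_format] and mat = mat'[rule_format]
  have pner: "poor \<H> u \<noteq> rich \<H> u" if "u \<in> verts G" for u
  proof
    assume "poor \<H> u = rich \<H> u"
    then show False using c2[OF that] pr[OF that] by simp
  qed
  have ndn: "nd u b \<in> nodes \<H> u" if "u \<in> verts G" for u b using pr[OF that] by (auto simp: nd_def)
  have ndv: "nd u b = nd v c \<longleftrightarrow> u = v \<and> b = c" if "u \<in> verts G" "v \<in> verts G" for u v b c
  proof
    assume eq: "nd u b = nd v c"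
    have uv: "u = v"
    proof (rule ccontr)
      assume "u \<noteq> v"
      then have "nodes \<H> u \<inter> nodes \<H> v = {}" using dis that unfolding disjoint_family_on_def by blast
      then show False using ndn[OF that(1), of b] ndn[OF that(2), of c] eq by auto
    qed
    then show "u = v \<and> b = c" using eq pner[OF that(1)] by (auto simp: nd_def split: if_splits)
  qed auto
  \<comment> \<open>An edge with empty matching also gets the sign \<open>True\<close>; this only
    adds clashes, which is the safe direction here.\<close>
  define cross where "cross e \<longleftrightarrow> (\<exists>u v. e = {u, v} \<and> {nd u False, nd v True} \<in> edges (cover_graph \<H>))" for e
  define sg where "sg e \<longleftrightarrow> \<not> cross e" for e
  have btw: "{nd u b, nd v c} \<in> edges_between (cover_graph \<H>) (nodes \<H> u) (nodes \<H> v)"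
    if "{nd u b, nd v c} \<in> edges (cover_graph \<H>)" "u \<in> verts G" "v \<in> verts G" for u v b c
    using that ndn unfolding edges_between_def by blast
  have key: "{u, v} \<in> edges G \<and> (b = c) = sg {u, v}"
    if e: "{nd u b, nd v c} \<in> edges (cover_graph \<H>)" and uv: "u \<in> verts G" "v \<in> verts G" "u \<noteq> v" for u v b c
  proof -
    have ed: "{u, v} \<in> edges G" using adj[OF uv(1,2)] btw[OF e uv(1,2)] uv(3) by blast
    have ed': "{v, u} \<in> edges G" using ed by (simp add: insert_commute)
    have "cross {u, v}" if bc: "b \<noteq> c"
    proof (cases b)
      case True
      then have "{nd v False, nd u True} \<in> edges (cover_graph \<H>)" using e bc by (simp add: insert_commute)
      then show ?thesis unfolding cross_def by (intro exI[of _ v] exI[of _ u]) (auto simp: insert_commute)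
    next
      case False
      then show ?thesis using e bc unfolding cross_def by (intro exI[of _ u] exI[of _ v]) simp
    qed
    moreover have "\<not> cross {u, v}" if bc: "b = c"
    proof
      assume "cross {u, v}"
      then obtain u' v' where w: "{u, v} = {u', v'}" "{nd u' False, nd v' True} \<in> edges (cover_graph \<H>)"
        unfolding cross_def by blast
      then have uv': "u' \<in> verts G" "v' \<in> verts G" "u' \<noteq> v'" using uv by (auto simp: doubleton_eq_iff)
      have e': "{nd u' b, nd v' b} \<in> edges (cover_graph \<H>)"
        using e bc w(1) by (auto simp: doubleton_eq_iff insert_commute)
      have dj: "disjoint (edges_between (cover_graph \<H>) (nodes \<H> u') (nodes \<H> v'))"
        using mat[OF uv'(1,2)] ed w(1) by simp
      have "{nd u' b, nd v' b} \<inter> {nd u' False, nd v' True} \<noteq> {}" by (cases b) auto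
      then have "{nd u' b, nd v' b} = {nd u' False, nd v' True}"
        using disjointD[OF dj btw[OF e' uv'(1,2)] btw[OF w(2) uv'(1,2)]] by blast
      then show False using ndv[of u' u'] ndv[of v' v'] ndv[of u' v'] uv' by (cases b) (auto simp: doubleton_eq_iff)
    qed
    ultimately show ?thesis using ed by (auto simp: sg_def)
  qed
  have "\<not> conf_colorable (plain i j (verts G) (edges G) sg)"
  proof
    assume "conf_colorable (plain i j (verts G) (edges G) sg)"
    then obtain \<phi> where phi: "\<And>v. v \<in> verts G \<Longrightarrow>
        card {e \<in> edges G. v \<in> e \<and> clash \<phi> (sg e) e} \<le> (if \<phi> v then j else i)"
      unfolding plain_colorable by blast
    define \<Phi> where "\<Phi> v = nd v (\<phi> v)" for v
    have deg: "degree (map_graph G \<H> \<Phi>) (\<Phi> v) \<le> (if \<phi> v then j else i)" if v: "v \<in> verts G" for v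
    proof -
      have "{e \<in> edges (map_graph G \<H> \<Phi>). \<Phi> v \<in> e} \<subseteq> (\<lambda>e. \<Phi> ` e) ` {e \<in> edges G. v \<in> e \<and> clash \<phi> (sg e) e}"
      proof
        fix f assume f: "f \<in> {e \<in> edges (map_graph G \<H> \<Phi>). \<Phi> v \<in> e}"
        then have fe: "f \<in> edges (cover_graph \<H>)" "f \<subseteq> \<Phi> ` verts G" "\<Phi> v \<in> f"
          by (auto simp: map_graph_def induced_subgraph_def)
        obtain y where y: "y \<noteq> \<Phi> v" "f = {\<Phi> v, y}" using simple_edge[OF simpH fe(1,3)] by metis
        then obtain u where u: "u \<in> verts G" "y = \<Phi> u" using fe(2) by auto
        then have uv: "v \<noteq> u" using y by auto
        have k: "{v, u} \<in> edges G \<and> (\<phi> v = \<phi> u) = sg {v, u}"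
          using key[OF _ v u(1) uv] fe(1) y(2) u(2) unfolding \<Phi>_def by blast
        then have "clash \<phi> (sg {v, u}) {v, u}" using clash_insert[OF uv] by simp
        moreover have "f = \<Phi> ` {v, u}" using y(2) u(2) by simp
        ultimately show "f \<in> (\<lambda>e. \<Phi> ` e) ` {e \<in> edges G. v \<in> e \<and> clash \<phi> (sg e) e}" using k by blast
      qed
      moreover have fin: "finite {e \<in> edges G. v \<in> e \<and> clash \<phi> (sg e) e}"
        using wf_D(3)[OF plain_wf[OF G, of i j sg]] by simp
      ultimately have "degree (map_graph G \<H> \<Phi>) (\<Phi> v) \<le> card {e \<in> edges G. v \<in> e \<and> clash \<phi> (sg e) e}"
        unfolding degree_def by (meson card_image_le card_mono finite_imageI le_trans)
      then show ?thesis using phi[OF v] by linarith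
    qed
    have pick: "\<exists>v\<in>verts G. x = \<Phi> v \<and> \<phi> v = b"
      if x: "x \<in> verts (map_graph G \<H> \<Phi>)" "x = nd w b" "w \<in> verts G" for x w b
    proof -
      obtain v where v: "v \<in> verts G" "x = \<Phi> v" using x(1) by (auto simp: map_graph_def induced_subgraph_def)
      then show ?thesis using x ndv[OF v(1) x(3)] unfolding \<Phi>_def by metis
    qed
    have "cover_coloring i j G \<H> \<Phi>"
      unfolding cover_coloring_def
    proof (intro conjI ballI)
      show "cover_map G \<H> \<Phi>" using ndn by (auto simp: cover_map_def \<Phi>_def)
      fix x assume "x \<in> verts (map_graph G \<H> \<Phi>) \<inter> poor \<H> ` verts G"
      then obtain w where "x \<in> verts (map_graph G \<H> \<Phi>)" "x = nd w False" "w \<in> verts G" by (auto simp: nd_def)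
      then obtain v where "v \<in> verts G" "x = \<Phi> v" "\<phi> v = False" using pick by blast
      then show "degree (map_graph G \<H> \<Phi>) x \<le> i" using deg[of v] by simp
    next
      fix x assume "x \<in> verts (map_graph G \<H> \<Phi>) \<inter> rich \<H> ` verts G"
      then obtain w where "x \<in> verts (map_graph G \<H> \<Phi>)" "x = nd w True" "w \<in> verts G" by (auto simp: nd_def)
      then obtain v where "v \<in> verts G" "x = \<Phi> v" "\<phi> v = True" using pick by blast
      then show "degree (map_graph G \<H> \<Phi>) x \<le> j" using deg[of v] by simp
    qed
    then show False using no by blast
  qed
  then show ?thesis using that by blast
qed

text \<open>The signs are turned into a cover all of whose matchings are perfect; the last bit of a
  natural number tells the rich node from the poor one.\<close>

lemma colorable_plain:
  assumes G: "simple_graph G" and co: "colorable i j G"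
  shows "conf_colorable (plain i j (verts G) (edges G) sg)"
proof -
  have "finite (verts G)" using G by (simp add: simple_graph_def)
  then obtain f :: "'a \<Rightarrow> nat" where f: "inj_on f (verts G)" using finite_imp_inj_to_nat_seg by metis
  define nd where "nd v b = 2 * f v + (if b then 1 else 0)" for v b
  have ndv: "nd u b = nd v c \<longleftrightarrow> u = v \<and> b = c" if "u \<in> verts G" "v \<in> verts G" for u v b c
  proof
    assume e: "nd u b = nd v c"
    have "f u = f v \<and> b = c" using e unfolding nd_def by (cases b; cases c) (simp_all, presburger+)
    then show "u = v \<and> b = c" using f that by (auto dest: inj_onD)
  qed auto
  define L where "L v = {nd v False, nd v True}" for v
  define E1 where "E1 = L ` verts G"
  define E2 where "E2 = {{nd u b, nd v c} | u v b c. {u, v} \<in> edges G \<and> (b = c) = sg {u, v}}"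
  define \<H> :: "('a, nat) cover" where
    "\<H> = \<lparr>nodes = L, cover_graph = Graph (\<Union>v\<in>verts G. L v) (E1 \<union> E2), poor = (\<lambda>v. nd v False), rich = (\<lambda>v. nd v True)\<rparr>"
  have ed: "u \<in> verts G \<and> v \<in> verts G \<and> u \<noteq> v" if "{u, v} \<in> edges G" for u v
    using that G unfolding simple_graph_def by (metis card_1_singleton_iff insert_absorb2 insert_subset numeral_eq_one_iff semiring_norm(85) One_nat_def)
  have inL: "x \<in> L v \<longleftrightarrow> (\<exists>b. x = nd v b)" for x v unfolding L_def by (metis (full_types) insert_iff singletonD)
  have E1': "nd u b \<noteq> nd v c \<and> {nd u b, nd v c} \<notin> E1" if "u \<in> verts G" "v \<in> verts G" "u \<noteq> v" for u v b c
  proof -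
    have "{nd u b, nd v c} \<noteq> L w" if w: "w \<in> verts G" for w
    proof
      assume "{nd u b, nd v c} = L w"
      then have "nd u b \<in> L w" "nd v c \<in> L w" by blast+
      then show False using inL ndv[OF _ w] \<open>u \<in> verts G\<close> \<open>v \<in> verts G\<close> \<open>u \<noteq> v\<close> by metis
    qed
    then show ?thesis using ndv that unfolding E1_def by blast
  qed
  have E2': "{u, v} \<in> edges G \<and> (b = c) = sg {u, v}"
    if e: "{nd u b, nd v c} \<in> E2" and uv: "u \<in> verts G" "v \<in> verts G" for u v b c
  proof -
    obtain u' v' b' c' where w: "{nd u b, nd v c} = {nd u' b', nd v' c'}" "{u', v'} \<in> edges G" "(b' = c') = sg {u', v'}"
      using e unfolding E2_def by blast
    have v': "u' \<in> verts G" "v' \<in> verts G" using ed[OF w(2)] by auto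
    from w(1) have "nd u b = nd u' b' \<and> nd v c = nd v' c' \<or> nd u b = nd v' c' \<and> nd v c = nd u' b'"
      by (auto simp: doubleton_eq_iff)
    then have "u = u' \<and> b = b' \<and> v = v' \<and> c = c' \<or> u = v' \<and> b = c' \<and> v = u' \<and> c = b'"
      using ndv uv v' by metis
    then show ?thesis using w(2,3) by (auto simp: insert_commute)
  qed
  have cov: "cover_of G \<H>"
    unfolding cover_of_def
  proof (intro conjI ballI impI)
    show "simple_graph (cover_graph \<H>)"
      unfolding simple_graph_def
    proof (intro conjI ballI)
      show "finite (verts (cover_graph \<H>))" using G by (simp add: \<H>_def L_def simple_graph_def)
      fix e assume "e \<in> edges (cover_graph \<H>)"
      then have "e \<in> E1 \<or> e \<in> E2" by (simp add: \<H>_def)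
      then obtain u v b c where e: "u \<in> verts G" "v \<in> verts G" "e = {nd u b, nd v c}" "nd u b \<noteq> nd v c"
      proof
        assume "e \<in> E1"
        then obtain u where "u \<in> verts G" "e = L u" by (auto simp: E1_def)
        then show thesis using that[of u u False True] ndv by (auto simp: L_def)
      next
        assume "e \<in> E2"
        then obtain u v b c where "{u, v} \<in> edges G" "e = {nd u b, nd v c}" unfolding E2_def by blast
        then show thesis using that[of u v b c] ndv ed by metis
      qed
      then have "nd u b \<in> L u" "nd v c \<in> L v" using inL by blast+
      then show "e \<subseteq> verts (cover_graph \<H>)" using e by (auto simp: \<H>_def)
      show "card e = 2" using e by simp
    qed
    show "(\<Union>u\<in>verts G. nodes \<H> u) = verts (cover_graph \<H>)" by (simp add: \<H>_def)
    show "disjoint_family_on (nodes \<H>) (verts G)"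
      unfolding disjoint_family_on_def
    proof (intro ballI impI)
      fix u v assume "u \<in> verts G" "v \<in> verts G" "u \<noteq> v"
      then show "nodes \<H> u \<inter> nodes \<H> v = {}" using ndv inL by (fastforce simp: \<H>_def)
    qed
    fix u assume u: "u \<in> verts G"
    show "card (nodes \<H> u) = 2" using ndv[OF u u] by (simp add: \<H>_def L_def)
    show "complete_graph (induced_subgraph (cover_graph \<H>) (nodes \<H> u))"
      unfolding complete_graph_def
    proof (intro ballI impI)
      fix x y
      assume x: "x \<in> verts (induced_subgraph (cover_graph \<H>) (nodes \<H> u))"
        and y: "y \<in> verts (induced_subgraph (cover_graph \<H>) (nodes \<H> u))" and xy: "x \<noteq> y"
      have "x \<in> L u" "y \<in> L u" using x y by (auto simp: induced_subgraph_def \<H>_def)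
      then have "{x, y} = L u" using xy by (auto simp: L_def)
      then show "{x, y} \<in> edges (induced_subgraph (cover_graph \<H>) (nodes \<H> u))"
        using u by (simp add: induced_subgraph_def \<H>_def E1_def)
    qed
    show "nodes \<H> u = {poor \<H> u, rich \<H> u}" by (simp add: \<H>_def L_def)
    fix v assume v: "v \<in> verts G"
    show "u = v \<or> {u, v} \<in> edges G" if ne: "edges_between (cover_graph \<H>) (nodes \<H> u) (nodes \<H> v) \<noteq> {}"
    proof -
      obtain x y where "{x, y} \<in> E1 \<union> E2" "x \<in> L u" "y \<in> L v"
        using ne by (auto simp: edges_between_def \<H>_def)
      then obtain b c where "{nd u b, nd v c} \<in> E1 \<union> E2" using inL by metis
      then show ?thesis using E1'[OF u v] E2'[OF _ u v] by blast
    qed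
    show "disjoint (edges_between (cover_graph \<H>) (nodes \<H> u) (nodes \<H> v))" if uv: "{u, v} \<in> edges G"
    proof (rule disjointI)
      have shape: "\<exists>b c. e = {nd u b, nd v c} \<and> (b = c) = sg {u, v}"
        if eb: "e \<in> edges_between (cover_graph \<H>) (nodes \<H> u) (nodes \<H> v)" for e
      proof -
        obtain x y where "{x, y} \<in> E1 \<union> E2" "x \<in> L u" "y \<in> L v" "e = {x, y}"
          using eb by (auto simp: edges_between_def \<H>_def)
        then obtain b c where "e = {nd u b, nd v c}" "{nd u b, nd v c} \<in> E1 \<union> E2" using inL by metis
        then show ?thesis using E1'[OF u v] E2'[OF _ u v] ed[OF uv] by blast
      qed
      fix e e' assume ee: "e \<in> edges_between (cover_graph \<H>) (nodes \<H> u) (nodes \<H> v)"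
        "e' \<in> edges_between (cover_graph \<H>) (nodes \<H> u) (nodes \<H> v)" "e \<noteq> e'"
      obtain b c where bc: "e = {nd u b, nd v c}" "(b = c) = sg {u, v}" using shape[OF ee(1)] by blast
      obtain b' c' where bc': "e' = {nd u b', nd v c'}" "(b' = c') = sg {u, v}" using shape[OF ee(2)] by blast
      have bb: "b = b' \<longleftrightarrow> c = c'" using bc(2) bc'(2) by argo
      have "b \<noteq> b'"
      proof
        assume "b = b'"
        then show False using bb bc(1) bc'(1) ee(3) by simp
      qed
      then have "nd u b \<noteq> nd u b'" "nd v c \<noteq> nd v c'" "nd u b \<noteq> nd v c'" "nd v c \<noteq> nd u b'"
        using bb ndv[OF u u] ndv[OF v v] ndv[OF u v] ndv[OF v u] ed[OF uv] by auto
      then show "e \<inter> e' = {}" unfolding bc(1) bc'(1) by simp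
    qed
  qed
  then obtain \<Phi> where c: "cover_coloring i j G \<H> \<Phi>" using co unfolding colorable_def by blast
  define \<phi> where "\<phi> v \<longleftrightarrow> \<Phi> v = nd v True" for v
  have P: "\<Phi> v = nd v (\<phi> v)" if "v \<in> verts G" for v
  proof -
    have "\<Phi> v \<in> L v" using c that by (auto simp: cover_coloring_def cover_map_def \<H>_def)
    then show ?thesis using ndv[OF that that, of False True] by (auto simp: L_def \<phi>_def)
  qed
  have injP: "inj_on \<Phi> (verts G)" using P ndv by (metis inj_onI)
  have "card {e \<in> edges G. v \<in> e \<and> clash \<phi> (sg e) e} \<le> (if \<phi> v then j else i)" if v: "v \<in> verts G" for v
  proof -
    have "inj_on (\<lambda>e. \<Phi> ` e) {e \<in> edges G. v \<in> e \<and> clash \<phi> (sg e) e}"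
    proof (rule inj_onI)
      fix e e' assume "e \<in> {e \<in> edges G. v \<in> e \<and> clash \<phi> (sg e) e}" "e' \<in> {e \<in> edges G. v \<in> e \<and> clash \<phi> (sg e) e}"
        and eq: "\<Phi> ` e = \<Phi> ` e'"
      then have "e \<subseteq> verts G" "e' \<subseteq> verts G" using G by (auto simp: simple_graph_def)
      then show "e = e'" using inj_on_image_eq_iff[OF injP] eq by blast
    qed
    moreover have "(\<lambda>e. \<Phi> ` e) ` {e \<in> edges G. v \<in> e \<and> clash \<phi> (sg e) e} \<subseteq> {e \<in> edges (map_graph G \<H> \<Phi>). \<Phi> v \<in> e}"
    proof
      fix d assume "d \<in> (\<lambda>e. \<Phi> ` e) ` {e \<in> edges G. v \<in> e \<and> clash \<phi> (sg e) e}"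
      then obtain e where e: "e \<in> edges G" "v \<in> e" "clash \<phi> (sg e) e" "d = \<Phi> ` e" by blast
      obtain u where u: "u \<noteq> v" "e = {v, u}" "u \<in> verts G" using simple_edge[OF G e(1,2)] by metis
      have d: "d = {nd v (\<phi> v), nd u (\<phi> u)}" using e(4) u(2) P[OF v] P[OF u(3)] by simp
      have "(\<phi> v = \<phi> u) = sg {v, u}" using e(3) u clash_insert[of v u \<phi> "sg {v, u}"] by auto
      moreover have "{v, u} \<in> edges G" using e(1) u(2) by simp
      ultimately have "d \<in> E2" unfolding E2_def d by blast
      then show "d \<in> {e \<in> edges (map_graph G \<H> \<Phi>). \<Phi> v \<in> e}"
        using e(4) u v by (auto simp: map_graph_def induced_subgraph_def \<H>_def)
    qed
    moreover have "finite {e \<in> edges (map_graph G \<H> \<Phi>). \<Phi> v \<in> e}"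
    proof -
      have "simple_graph (cover_graph \<H>)" using cov by (simp add: cover_of_def)
      then have "finite (edges (cover_graph \<H>))" using wf_D(3)[OF plain_wf] by fastforce
      then show ?thesis by (simp add: map_graph_def induced_subgraph_def)
    qed
    ultimately have "card {e \<in> edges G. v \<in> e \<and> clash \<phi> (sg e) e} \<le> degree (map_graph G \<H> \<Phi>) (\<Phi> v)"
      unfolding degree_def by (rule card_inj_on_le)
    also have "\<dots> \<le> (if \<phi> v then j else i)"
    proof -
      have "\<Phi> v \<in> nodes \<H> v" using c v by (simp add: cover_coloring_def cover_map_def)
      then have vm: "\<Phi> v \<in> verts (map_graph G \<H> \<Phi>)" using v by (auto simp: map_graph_def induced_subgraph_def \<H>_def)
      show ?thesis
      proof (cases "\<phi> v")
        case True
        then have "\<Phi> v \<in> rich \<H> ` verts G" using P[OF v] v by (auto simp: \<H>_def)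
        then show ?thesis using c vm True by (simp add: cover_coloring_def)
      next
        case False
        then have "\<Phi> v \<in> poor \<H> ` verts G" using P[OF v] v by (auto simp: \<H>_def)
        then show ?thesis using c vm False by (simp add: cover_coloring_def)
      qed
    qed
    finally show ?thesis .
  qed
  then show ?thesis unfolding plain_colorable by blast
qed

theorem critical_edges:
  fixes G :: "'a graph"
  assumes ij: "i = 1 \<or> i = 2" "2 * i \<le> j" and crit: "critical i j G"
  shows "(2 * int i + 1) * int (card (verts G)) + int j - int i + 1 \<le> (int i + 1) * int (card (edges G))"
proof -
  have G: "simple_graph G" "\<not> colorable i j G"
    and sub: "\<And>G'. subgraph G' G \<Longrightarrow> G' \<noteq> G \<Longrightarrow> colorable i j G'"
    using crit unfolding critical_def by blast+
  obtain sg where nc: "\<not> conf_colorable (plain i j (verts G) (edges G) sg)" using noncolorable_plain[OF G] .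
  define C where "C = plain i j (verts G) (edges G) sg"
  have wf: "conf_wf i j C" unfolding C_def by (rule plain_wf[OF G(1)])
  have fV: "finite (verts G)" using G(1) by (simp add: simple_graph_def)
  have "\<not> sparse i j C" using sparse_colorable[OF ij wf] nc unfolding C_def by blast
  then obtain A where A: "A \<subseteq> verts G" "A \<noteq> {}" "pot i j C A < int i - int j"
    unfolding sparse_def by (auto simp: C_def not_le)
  define \<S> where "\<S> = {A. A \<subseteq> verts G \<and> A \<noteq> {}}"
  have fS: "finite \<S>" using fV by (auto simp: \<S>_def intro: finite_subset[of _ "Pow (verts G)"])
  have AS: "A \<in> \<S>" using A by (simp add: \<S>_def)
  define S where "S = arg_min_on (pot i j C) \<S>"
  have S: "S \<in> \<S>" unfolding S_def using arg_min_if_finite(1)[OF fS] AS by blast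
  have min: "pot i j C S \<le> pot i j C B" if "B \<in> \<S>" for B
    unfolding S_def using arg_min_least[OF fS _ that] that by blast
  have SV: "S \<subseteq> verts G" "S \<noteq> {}" using S by (auto simp: \<S>_def)
  have "S = verts G"
  proof (rule ccontr)
    assume ne: "S \<noteq> verts G"
    let ?H = "Graph S {e \<in> edges G. e \<subseteq> S}"
    have "simple_graph ?H" using G(1) SV fV by (auto simp: simple_graph_def intro: finite_subset)
    moreover from this have "subgraph ?H G" using G(1) SV by (auto simp: subgraph_def)
    moreover have "?H \<noteq> G" using ne by (metis graph.sel(1))
    ultimately have "conf_colorable (plain i j (verts ?H) (edges ?H) sg)" using sub colorable_plain by blast
    then have "conf_colorable (restr C S)" unfolding C_def plain_restr by simp
    then obtain U where U: "U \<subseteq> cvs C - S" "pot i j C (S \<union> U) < pot i j C S"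
      using contract_step[of i j C S] wf ij SV nc wf_contract[of i j C S] sparse_colorable[OF ij]
      unfolding C_def by (metis le_add1 le_trans mult_2 plain_simps(1))
    have "S \<union> U \<in> \<S>" using U(1) SV by (auto simp: \<S>_def C_def)
    then show False using min U(2) by fastforce
  qed
  \<comment> \<open>By integrality the potential is at most \<open>i - j - 1\<close>, which produces
    the constant \<open>j - i + 1\<close> of the bound.\<close>
  then have "pot i j C (verts G) < int i - int j" using min[OF AS] A(3) by simp
  moreover have "{e \<in> edges G. e \<subseteq> verts G} = edges G" using G(1) by (auto simp: simple_graph_def)
  ultimately show ?thesis unfolding C_def plain_pot by simp
qed

section \<open>Sharpness\<close>

locale tower =
  fixes i j N :: nat
  assumes i12: "i = 1 \<or> i = 2" and ji: "2 * i \<le> j"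
begin

text \<open>The root carries \<open>j + 1\<close> parallel and \<open>i + 1\<close> crossing blocks,
  in each case one more than the respective node tolerates. Block \<open>R\<close>, the last
  crossing one, starts the chain, whose length \<open>N\<close> makes the graph arbitrarily
  large.\<close>

definition R :: nat where "R = j + i + 2"
definition M :: nat where "M = R + N"
text \<open>With \<open>i + 1\<close> leaves an all-poor block overloads its centre. A chain block
  with a successor has one leaf less; the missing clash has to come from the next block.\<close>

definition m :: "nat \<Rightarrow> nat" where "m b = (if R \<le> b \<and> b < M then i else i + 1)"
definition ver :: "nat \<Rightarrow> nat \<Rightarrow> nat" where "ver b l = prod_encode (b, l)"
definition hub :: "nat \<Rightarrow> nat" where "hub b = (if b \<le> R then ver 0 0 else ver (b - 1) 0)"
definition blk :: "nat \<Rightarrow> nat set" where "blk b = ver b ` {0..m b}"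
definition hubs :: "nat \<Rightarrow> nat set set" where "hubs b = (\<lambda>x. {hub b, x}) ` blk b"
definition spokes :: "nat \<Rightarrow> nat set set" where "spokes b = (\<lambda>l. {ver b 0, ver b l}) ` {1..m b}"
definition V :: "nat set" where "V = insert (ver 0 0) (\<Union>b\<in>{1..M}. blk b)"
definition E :: "nat set set" where "E = (\<Union>b\<in>{1..M}. hubs b \<union> spokes b)"
definition sg :: "nat set \<Rightarrow> bool" where "sg e \<longleftrightarrow> (\<forall>b\<in>{j + 2..M}. e \<notin> hubs b)"

lemma ver_eq [simp]: "ver b l = ver b' l' \<longleftrightarrow> b = b' \<and> l = l'"
  by (simp add: ver_def)

lemma RM: "1 \<le> R" "R \<le> M" "j + 1 < R"
  using i12 by (auto simp: R_def M_def)

lemma hub_new: "1 \<le> b \<Longrightarrow> b \<le> b' \<Longrightarrow> hub b \<noteq> ver b' l"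
  by (auto simp: hub_def)

lemma blkE:
  assumes "x \<in> blk b"
  obtains l where "x = ver b l" "l \<le> m b"
  using assms by (auto simp: blk_def)

lemma blk_center: "ver b 0 \<in> blk b"
  by (auto simp: blk_def)

lemma hub_V:
  assumes "b \<in> {1..M}"
  shows "hub b \<in> V"
proof (cases "b \<le> R")
  case True then show ?thesis by (simp add: hub_def V_def)
next
  case False
  then have "b - 1 \<in> {1..M}" "hub b = ver (b - 1) 0" using assms RM(1) by (auto simp: hub_def)
  then show ?thesis using blk_center[of "b - 1"] unfolding V_def by auto
qed

lemma simple: "simple_graph (Graph V E)"
  unfolding simple_graph_def graph.sel
proof (intro conjI[OF _ ballI])
  show "finite V" by (simp add: V_def blk_def)
  fix e assume "e \<in> E"
  then obtain b where b: "b \<in> {1..M}" "e \<in> hubs b \<or> e \<in> spokes b" by (auto simp: E_def)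
  have bV: "blk b \<subseteq> V" using b(1) by (auto simp: V_def)
  show "e \<subseteq> V \<and> card e = 2"
    using b(2)
  proof
    assume "e \<in> hubs b"
    then obtain x where x: "x \<in> blk b" "e = {hub b, x}" by (auto simp: hubs_def)
    then obtain l where "x = ver b l" by (auto elim: blkE)
    then have "hub b \<noteq> x" using hub_new[of b b l] b(1) by simp
    then show ?thesis using x bV hub_V[OF b(1)] by auto
  next
    assume "e \<in> spokes b"
    then obtain l where l: "l \<in> {1..m b}" "e = {ver b 0, ver b l}" by (auto simp: spokes_def)
    then have "ver b l \<in> blk b" by (auto simp: blk_def)
    then show ?thesis using l bV blk_center[of b] by auto
  qed
qed

lemma finE: "finite E" "finite V"
  by (simp_all add: E_def hubs_def spokes_def V_def blk_def)

lemma sg_hub: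
  assumes b: "b \<in> {1..M}" and x: "x \<in> blk b"
  shows "sg {hub b, x} \<longleftrightarrow> b \<le> j + 1"
proof
  assume s: "sg {hub b, x}"
  show "b \<le> j + 1"
  proof (rule ccontr)
    assume "\<not> b \<le> j + 1"
    then have "b \<in> {j + 2..M}" using b by auto
    then show False using s x by (auto simp: sg_def hubs_def)
  qed
next
  assume le: "b \<le> j + 1"
  obtain l where l: "x = ver b l" using x by (rule blkE)
  show "sg {hub b, x}"
    unfolding sg_def
  proof (intro ballI notI)
    fix b' assume b': "b' \<in> {j + 2..M}" "{hub b, x} \<in> hubs b'"
    then obtain y where y: "y \<in> blk b'" "{hub b, x} = {hub b', y}" by (auto simp: hubs_def)
    obtain l' where l': "y = ver b' l'" using y(1) by (rule blkE)
    have "y = x \<or> y = hub b" using y(2) by (auto simp: doubleton_eq_iff)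
    moreover have "y \<noteq> x" using l l' b'(1) le by auto
    moreover have "y \<noteq> hub b" using hub_new[of b b' l'] l' b b'(1) le by auto
    ultimately show False by blast
  qed
qed

lemma sg_spoke: "sg {ver b 0, ver b l}"
  unfolding sg_def
proof (intro ballI notI)
  fix b' assume b': "b' \<in> {j + 2..M}" "{ver b 0, ver b l} \<in> hubs b'"
  then obtain y where y: "y \<in> blk b'" "{ver b 0, ver b l} = {hub b', y}" by (auto simp: hubs_def)
  obtain l' where l': "y = ver b' l'" using y(1) by (rule blkE)
  have "y \<in> {ver b 0, ver b l}" "hub b' \<in> {ver b 0, ver b l}" using y(2) by auto
  then have "b' = b" "\<exists>l. hub b' = ver b l" using l' by auto
  then show False using hub_new[of b' b'] b'(1) by auto
qed

text \<open>If the root is rich, each of the \<open>j + 1\<close> parallel blocks at the root clashes with it. If it is poor,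
  then \<open>i\<close> crossing blocks clash with it, and no spare clash is left along the chain of the
  remaining blocks: all of them are poor, which overloads the last one.\<close>

lemma not_plain_colorable: "\<not> conf_colorable (plain i j V E sg)"
proof
  assume "conf_colorable (plain i j V E sg)"
  then obtain \<phi> where \<phi>: "\<And>v. v \<in> V \<Longrightarrow> card {e \<in> E. v \<in> e \<and> clash \<phi> (sg e) e} \<le> (if \<phi> v then j else i)"
    unfolding plain_colorable by blast
  define K where "K v = {e \<in> E. v \<in> e \<and> clash \<phi> (sg e) e}" for v
  have finK: "finite (K v)" for v using finE by (simp add: K_def)
  define hit where "hit b \<longleftrightarrow> (\<exists>x\<in>blk b. clash \<phi> (sg {hub b, x}) {hub b, x})" for b
  have hitK: "{hub b, x} \<in> K (hub b)" if "b \<in> {1..M}" "x \<in> blk b" "clash \<phi> (sg {hub b, x}) {hub b, x}" for b x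
    using that by (auto simp: K_def E_def hubs_def)
  \<comment> \<open>A rich hub with parallel edges and a poor hub with crossing edges have the same
    effect: a block without a clash at its hub is entirely poor.\<close>
  have poor: "\<forall>x\<in>blk b. \<not> \<phi> x" if b: "b \<in> {1..M}" and nh: "\<not> hit b" and h: "\<phi> (hub b) \<longleftrightarrow> b \<le> j + 1" for b
  proof
    fix x assume x: "x \<in> blk b"
    then obtain l where "x = ver b l" by (auto elim: blkE)
    then have ne: "hub b \<noteq> x" using hub_new[of b b l] b by simp
    have "\<not> clash \<phi> (sg {hub b, x}) {hub b, x}" using nh x unfolding hit_def by blast
    then have "(\<phi> (hub b) = \<phi> x) \<noteq> sg {hub b, x}" unfolding clash_insert[OF ne] .
    then show "\<not> \<phi> x" unfolding sg_hub[OF b x] using h by (cases "b \<le> j + 1") simp_all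
  qed
  have load: "card (spokes b \<union> F) \<le> i"
    if b: "b \<in> {1..M}" and p: "\<forall>x\<in>blk b. \<not> \<phi> x" and F: "F \<subseteq> K (ver b 0)" for b F
  proof -
    have "spokes b \<subseteq> K (ver b 0)"
    proof
      fix e assume "e \<in> spokes b"
      then obtain l where l: "l \<in> {1..m b}" "e = {ver b 0, ver b l}" by (auto simp: spokes_def)
      have "ver b l \<in> blk b" using l(1) by (auto simp: blk_def)
      then have "\<not> \<phi> (ver b l)" "\<not> \<phi> (ver b 0)" using p blk_center[of b] by auto
      then have "clash \<phi> (sg e) e" using sg_spoke[of b l] by (auto simp: l(2) clash_def)
      moreover have "e \<in> E" using b \<open>e \<in> spokes b\<close> by (auto simp: E_def)
      ultimately show "e \<in> K (ver b 0)" by (simp add: K_def l(2))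
    qed
    then have "card (spokes b \<union> F) \<le> card (K (ver b 0))" using F finK by (intro card_mono) auto
    moreover have "ver b 0 \<in> V" using b blk_center[of b] unfolding V_def by blast
    moreover have "\<not> \<phi> (ver b 0)" using p blk_center[of b] by blast
    ultimately show ?thesis using \<phi>[of "ver b 0"] unfolding K_def by simp
  qed
  have csp: "card (spokes b) = m b" for b
  proof -
    have "inj_on (\<lambda>l. {ver b 0, ver b l}) {1..m b}" by (rule inj_onI) (auto simp: doubleton_eq_iff)
    then show ?thesis by (simp add: spokes_def card_image)
  qed
  have big: "\<not> (\<forall>x\<in>blk b. \<not> \<phi> x)" if "b \<in> {1..M}" "m b = i + 1" for b
    using load[OF that(1), of "{}"] csp[of b] that(2) by auto
  have root: "card B \<le> (if \<phi> (ver 0 0) then j else i)" if B: "B \<subseteq> {1..R}" "\<And>b. b \<in> B \<Longrightarrow> hit b" for B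
  proof -
    have "\<forall>b\<in>B. \<exists>x. x \<in> blk b \<and> clash \<phi> (sg {hub b, x}) {hub b, x}" using B(2) unfolding hit_def by blast
    then obtain g where g: "\<And>b. b \<in> B \<Longrightarrow> g b \<in> blk b \<and> clash \<phi> (sg {hub b, g b}) {hub b, g b}" by metis
    have hb: "hub b = ver 0 0" if "b \<in> B" for b using B(1) that by (auto simp: hub_def)
    have "inj_on (\<lambda>b. {ver 0 0, g b}) B"
    proof (rule inj_onI)
      fix b c assume bc: "b \<in> B" "c \<in> B" "{ver 0 0, g b} = {ver 0 0, g c}"
      obtain l where l: "g b = ver b l" using g[OF bc(1)] by (auto elim: blkE)
      obtain k where k: "g c = ver c k" using g[OF bc(2)] by (auto elim: blkE)
      have "1 \<le> b" "1 \<le> c" using B(1) bc by auto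
      then show "b = c" using bc(3) l k by (auto simp: doubleton_eq_iff)
    qed
    moreover have "(\<lambda>b. {ver 0 0, g b}) ` B \<subseteq> K (ver 0 0)"
    proof (rule image_subsetI)
      fix b assume b: "b \<in> B"
      then have "b \<in> {1..M}" using B(1) RM(2) by auto
      then show "{ver 0 0, g b} \<in> K (ver 0 0)" using hitK[of b "g b"] g[OF b] hb[OF b] by auto
    qed
    ultimately have "card B \<le> card (K (ver 0 0))" using finK card_inj_on_le by blast
    then show ?thesis using \<phi>[of "ver 0 0"] unfolding K_def by (simp add: V_def)
  qed
  show False
  proof (cases "\<phi> (ver 0 0)")
    case True
    have "hit b" if b: "b \<in> {1..j + 1}" for b
    proof (rule ccontr)
      assume nh: "\<not> hit b"
      have bM: "b \<in> {1..M}" "m b = i + 1" "hub b = ver 0 0" using b RM by (auto simp: m_def hub_def)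
      show False using poor[OF bM(1) nh] big[OF bM(1,2)] True b bM(3) by auto
    qed
    then show False using root[of "{1..j + 1}"] RM True by auto
  next
    case False
    have h: "hit b" if b: "b \<in> {j + 2..<R}" for b
    proof (rule ccontr)
      assume nh: "\<not> hit b"
      have bM: "b \<in> {1..M}" "m b = i + 1" "hub b = ver 0 0" using b RM by (auto simp: m_def hub_def)
      show False using poor[OF bM(1) nh] big[OF bM(1,2)] False b bM(3) by auto
    qed
    have chain: "\<forall>x\<in>blk (R + k). \<not> \<phi> x" if "k \<le> N" for k
      using that
    proof (induction k)
      case 0
      have bM: "R \<in> {1..M}" "hub R = ver 0 0" using RM by (auto simp: hub_def)
      have "\<not> hit R"
      proof
        assume hR: "hit R"
        have "hit b" if "b \<in> {j + 2..R}" for b using h[of b] hR that by (cases "b = R") auto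
        moreover have "card {j + 2..R} = i + 1" by (simp add: R_def)
        ultimately show False using root[of "{j + 2..R}"] False by auto
      qed
      then show ?case using poor[OF bM(1)] False bM(2) RM(3) by simp
    next
      case (Suc k)
      let ?b = "R + k"
      have p: "\<forall>x\<in>blk ?b. \<not> \<phi> x" using Suc by simp
      have bM: "?b \<in> {1..M}" "Suc ?b \<in> {1..M}" "hub (Suc ?b) = ver ?b 0" "m ?b = i"
        using Suc.prems RM by (auto simp: hub_def m_def M_def)
      have "\<not> hit (Suc ?b)"
      proof
        assume "hit (Suc ?b)"
        then obtain x where x: "x \<in> blk (Suc ?b)" "clash \<phi> (sg {hub (Suc ?b), x}) {hub (Suc ?b), x}"
          unfolding hit_def by blast
        have e: "{ver ?b 0, x} \<in> K (ver ?b 0)" using hitK[OF bM(2) x] bM(3) by simp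
        obtain l where l: "x = ver (Suc ?b) l" using x(1) by (rule blkE)
        have "{ver ?b 0, x} \<notin> spokes ?b" by (auto simp: spokes_def doubleton_eq_iff l)
        moreover have "finite (spokes ?b)" by (simp add: spokes_def)
        ultimately have "card (spokes ?b \<union> {{ver ?b 0, x}}) = i + 1" using csp[of ?b] bM(4) by simp
        then show False using load[OF bM(1) p, of "{{ver ?b 0, x}}"] e by simp
      qed
      moreover have "\<not> \<phi> (hub (Suc ?b))" using p blk_center[of ?b] bM(3) by simp
      ultimately show ?case using poor[OF bM(2)] RM(3) by simp
    qed
    have "m M = i + 1" "M \<in> {1..M}" using RM by (auto simp: m_def)
    then show False using chain[of N] big[of M] by (simp add: M_def)
  qed
qed

section \<open>The potential of the towers\<close>

definition val :: "nat set \<Rightarrow> int" where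
  "val A = (2 * int i + 1) * int (card A) - (int i + 1) * int (card {e \<in> E. e \<subseteq> A})"

definition leaves :: "nat set \<Rightarrow> nat \<Rightarrow> nat" where
  "leaves A b = card {l \<in> {1..m b}. ver b l \<in> A}"

text \<open>The contribution of block \<open>b\<close> to the potential of \<open>A\<close> when the
  edges to its hub are counted with the block.\<close>

definition share :: "nat set \<Rightarrow> nat \<Rightarrow> int" where
  "share A b = (2 * int i + 1) * (int (leaves A b) + of_bool (ver b 0 \<in> A)) -
     (int i + 1) * (of_bool (hub b \<in> A) * (int (leaves A b) + of_bool (ver b 0 \<in> A)) + of_bool (ver b 0 \<in> A) * int (leaves A b))"

lemma card_blk: "int (card (A \<inter> blk b)) = int (leaves A b) + of_bool (ver b 0 \<in> A)"
proof -
  have inj: "inj_on (ver b) X" for X by (rule inj_onI) simp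
  have "A \<inter> blk b = ver b ` {l \<in> {0..m b}. ver b l \<in> A}" by (auto simp: blk_def)
  then have "card (A \<inter> blk b) = card {l \<in> {0..m b}. ver b l \<in> A}" by (simp add: card_image[OF inj])
  also have "{l \<in> {0..m b}. ver b l \<in> A} = (if ver b 0 \<in> A then {0} else {}) \<union> {l \<in> {1..m b}. ver b l \<in> A}"
    by (auto simp: not_less_eq_eq elim: le_SucE) (metis One_nat_def Suc_leI neq0_conv)+
  also have "card \<dots> = of_bool (ver b 0 \<in> A) + leaves A b"
    by (subst card_Un_disjoint) (auto simp: leaves_def)
  finally show ?thesis by simp
qed

lemma card_total:
  assumes "A \<subseteq> V"
  shows "int (card A) = of_bool (ver 0 0 \<in> A) + (\<Sum>b\<in>{1..M}. int (leaves A b) + of_bool (ver b 0 \<in> A))"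
proof -
  have eq: "A = (A \<inter> {ver 0 0}) \<union> (\<Union>b\<in>{1..M}. A \<inter> blk b)" using assms by (auto simp: V_def)
  have dj: "(A \<inter> {ver 0 0}) \<inter> (\<Union>b\<in>{1..M}. A \<inter> blk b) = {}" by (auto simp: blk_def)
  have "card A = card ((A \<inter> {ver 0 0}) \<union> (\<Union>b\<in>{1..M}. A \<inter> blk b))" using eq by (rule arg_cong)
  also have "\<dots> = card (A \<inter> {ver 0 0}) + card (\<Union>b\<in>{1..M}. A \<inter> blk b)"
    by (rule card_Un_disjoint[OF _ _ dj]) (auto simp: blk_def)
  also have "card (\<Union>b\<in>{1..M}. A \<inter> blk b) = (\<Sum>b\<in>{1..M}. card (A \<inter> blk b))"
    by (rule card_UN_disjoint) (auto simp: blk_def)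
  also have "card (A \<inter> {ver 0 0}) = of_bool (ver 0 0 \<in> A)" by auto
  finally show ?thesis by (simp add: card_blk)
qed

lemma edge_total:
  "int (card {e \<in> E. e \<subseteq> A}) \<le>
    (\<Sum>b\<in>{1..M}. of_bool (hub b \<in> A) * (int (leaves A b) + of_bool (ver b 0 \<in> A)) + of_bool (ver b 0 \<in> A) * int (leaves A b))"
proof -
  have one: "int (card {e \<in> hubs b \<union> spokes b. e \<subseteq> A}) \<le>
      of_bool (hub b \<in> A) * (int (leaves A b) + of_bool (ver b 0 \<in> A)) + of_bool (ver b 0 \<in> A) * int (leaves A b)" for b
  proof -
    have eq: "{e \<in> hubs b \<union> spokes b. e \<subseteq> A} = {e \<in> hubs b. e \<subseteq> A} \<union> {e \<in> spokes b. e \<subseteq> A}" by auto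
    have "card {e \<in> hubs b \<union> spokes b. e \<subseteq> A} \<le> card {e \<in> hubs b. e \<subseteq> A} + card {e \<in> spokes b. e \<subseteq> A}"
      unfolding eq by (rule card_Un_le)
    moreover have "int (card {e \<in> hubs b. e \<subseteq> A}) \<le> of_bool (hub b \<in> A) * (int (leaves A b) + of_bool (ver b 0 \<in> A))"
    proof (cases "hub b \<in> A")
      case True
      have "{e \<in> hubs b. e \<subseteq> A} \<subseteq> (\<lambda>x. {hub b, x}) ` (A \<inter> blk b)" by (auto simp: hubs_def)
      then have "card {e \<in> hubs b. e \<subseteq> A} \<le> card (A \<inter> blk b)" by (rule surj_card_le[rotated]) (simp add: blk_def)
      then show ?thesis using True card_blk[of A b] by simp
    next
      case False
      then have none: "{e \<in> hubs b. e \<subseteq> A} = {}" by (auto simp: hubs_def)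
      show ?thesis unfolding none by simp
    qed
    moreover have "int (card {e \<in> spokes b. e \<subseteq> A}) \<le> of_bool (ver b 0 \<in> A) * int (leaves A b)"
    proof (cases "ver b 0 \<in> A")
      case True
      have "{e \<in> spokes b. e \<subseteq> A} \<subseteq> (\<lambda>l. {ver b 0, ver b l}) ` {l \<in> {1..m b}. ver b l \<in> A}" by (auto simp: spokes_def)
      then have "card {e \<in> spokes b. e \<subseteq> A} \<le> card {l \<in> {1..m b}. ver b l \<in> A}" by (rule surj_card_le[rotated]) simp
      then show ?thesis using True by (simp add: leaves_def)
    next
      case False
      then have none: "{e \<in> spokes b. e \<subseteq> A} = {}" by (auto simp: spokes_def)
      show ?thesis unfolding none by simp
    qed
    ultimately show ?thesis by linarith
  qed
  have "{e \<in> E. e \<subseteq> A} = (\<Union>b\<in>{1..M}. {e \<in> hubs b \<union> spokes b. e \<subseteq> A})" by (auto simp: E_def)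
  then have "card {e \<in> E. e \<subseteq> A} \<le> (\<Sum>b\<in>{1..M}. card {e \<in> hubs b \<union> spokes b. e \<subseteq> A})"
    using card_UN_le[of "{1..M}" "\<lambda>b. {e \<in> hubs b \<union> spokes b. e \<subseteq> A}"] by simp
  then have "int (card {e \<in> E. e \<subseteq> A}) \<le> int (\<Sum>b\<in>{1..M}. card {e \<in> hubs b \<union> spokes b. e \<subseteq> A})"
    by (simp only: of_nat_le_iff)
  also have "\<dots> = (\<Sum>b\<in>{1..M}. int (card {e \<in> hubs b \<union> spokes b. e \<subseteq> A}))" by (rule of_nat_sum)
  also have "\<dots> \<le> (\<Sum>b\<in>{1..M}. of_bool (hub b \<in> A) * (int (leaves A b) + of_bool (ver b 0 \<in> A)) + of_bool (ver b 0 \<in> A) * int (leaves A b))"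
    by (rule sum_mono) (rule one)
  finally show ?thesis .
qed

lemma val_share:
  assumes "A \<subseteq> V"
  shows "(2 * int i + 1) * of_bool (ver 0 0 \<in> A) + (\<Sum>b\<in>{1..M}. share A b) \<le> val A"
proof -
  have "(int i + 1) * int (card {e \<in> E. e \<subseteq> A}) \<le> (int i + 1) *
    (\<Sum>b\<in>{1..M}. of_bool (hub b \<in> A) * (int (leaves A b) + of_bool (ver b 0 \<in> A)) + of_bool (ver b 0 \<in> A) * int (leaves A b))"
    using edge_total[of A] by (intro mult_left_mono) auto
  then show ?thesis
    unfolding val_def card_total[OF assms] share_def sum_subtractf sum_distrib_left[symmetric]
    by (simp add: distrib_left)
qed

lemma leaves_le: "leaves A b \<le> m b"
proof -
  have "leaves A b \<le> card {1..m b}" unfolding leaves_def by (rule card_mono) auto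
  then show ?thesis by simp
qed

text \<open>If \<open>A\<close> contains hub and centre, the centre contributes \<open>i\<close> and
  every leaf \<open>-1\<close>, because its two edges cost one more than its weight. Otherwise every
  vertex has at most one edge to pay for, or the leaves have only the centre, and nothing is
  negative.\<close>

lemma share_cases:
  "0 \<le> share A b \<or> share A b = - 1 \<and> hub b \<in> A \<and> ver b 0 \<in> A \<and> leaves A b = m b \<and> m b = i + 1"
proof -
  have k: "leaves A b \<le> m b" "m b \<le> i + 1" using leaves_le[of A b] by (auto simp: m_def)
  have s11: "share A b = int i - int (leaves A b)" if "hub b \<in> A" "ver b 0 \<in> A"
    using that by (simp add: share_def algebra_simps)
  have "0 \<le> share A b" if "\<not> (hub b \<in> A \<and> ver b 0 \<in> A)"
    using that by (cases "hub b \<in> A"; cases "ver b 0 \<in> A") (simp_all add: share_def algebra_simps)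
  then show ?thesis using s11 k by (cases "hub b \<in> A \<and> ver b 0 \<in> A") auto
qed

lemma share_zero:
  assumes "share A b = 0" "ver b 0 \<in> A" "m b = i"
  shows "hub b \<in> A \<and> leaves A b = m b"
proof (cases "hub b \<in> A")
  case True
  then have "share A b = int i - int (leaves A b)" using assms(2) by (simp add: share_def algebra_simps)
  then show ?thesis using True assms by simp
next
  case False
  then have "share A b = int i * int (leaves A b) + 2 * int i + 1" using assms(2) by (simp add: share_def algebra_simps)
  moreover have "0 \<le> int i * int (leaves A b)" by simp
  ultimately show ?thesis using assms(1) by linarith
qed

lemma full_blk:
  assumes "leaves A b = m b" "ver b 0 \<in> A"
  shows "blk b \<subseteq> A"
proof -
  have all: "{l \<in> {1..m b}. ver b l \<in> A} = {1..m b}"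
    using assms(1) by (intro card_subset_eq) (auto simp: leaves_def)
  have "ver b l \<in> A" if l: "l \<le> m b" for l
  proof (cases "l = 0")
    case True then show ?thesis using assms(2) by simp
  next
    case False
    then have "l \<in> {l \<in> {1..m b}. ver b l \<in> A}" unfolding all using l by simp
    then show ?thesis by simp
  qed
  then show ?thesis by (auto simp: blk_def)
qed

text \<open>Only the \<open>R\<close> blocks with \<open>i + 1\<close> leaves can contribute
  \<open>-1\<close>, and the root contributes \<open>2 * i + 1\<close>, so the minimum is
  \<open>i - j - 1\<close>. Equality forces all these blocks into \<open>A\<close> and share 0 for
  the chain blocks; going down the chain from \<open>M\<close>, the hub of each block is the centre
  of the preceding one, which by \<open>share_zero\<close> is then complete as well.\<close>

lemma val_ge:
  assumes A: "A \<subseteq> V"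
  shows "int i - int j - 1 \<le> val A" and "A \<noteq> V \<Longrightarrow> int i - int j \<le> val A"
proof -
  define Z where "Z = {b \<in> {1..M}. share A b < 0}"
  define Sp where "Sp = insert M {1..<R}"
  have Z: "share A b = - 1 \<and> hub b \<in> A \<and> ver b 0 \<in> A \<and> leaves A b = m b \<and> m b = i + 1" if "b \<in> Z" for b
    using share_cases[of A b] that by (auto simp: Z_def)
  have ZS: "Z \<subseteq> Sp"
  proof
    fix b assume b: "b \<in> Z"
    then have "m b = i + 1" "b \<in> {1..M}" using Z[OF b] by (auto simp: Z_def)
    then show "b \<in> Sp" by (auto simp: m_def Sp_def split: if_splits)
  qed
  have cS: "card Sp = R" "finite Sp" using RM by (auto simp: Sp_def)
  have cZ: "card Z \<le> R" using card_mono[OF cS(2) ZS] cS(1) by simp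
  let ?rest = "\<Sum>b\<in>{1..M} - Z. share A b"
  have "(\<Sum>b\<in>{1..M}. share A b) = (\<Sum>b\<in>Z. share A b) + ?rest"
    by (subst sum.subset_diff[of Z]) (auto simp: Z_def)
  also have "(\<Sum>b\<in>Z. share A b) = - int (card Z)" using Z by simp
  finally have v: "(2 * int i + 1) * of_bool (ver 0 0 \<in> A) - int (card Z) + ?rest \<le> val A" using val_share[OF A] by linarith
  have rest: "0 \<le> ?rest" by (rule sum_nonneg) (auto simp: Z_def)
  have "int i - int j - 1 \<le> val A \<and> (val A < int i - int j \<longrightarrow> A = V)"
  proof (cases "ver 0 0 \<in> A")
    case False
    have "Z \<subseteq> {M}"
    proof
      fix b assume b: "b \<in> Z"
      have "hub b \<noteq> ver 0 0" using Z[OF b] False by auto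
      then have "R < b" by (auto simp: hub_def split: if_splits)
      then show "b \<in> {M}" using ZS b by (auto simp: Sp_def)
    qed
    then have "card Z \<le> 1" using card_mono[of "{M}" Z] by simp
    then show ?thesis using v rest False ji i12 by auto
  next
    case True
    have "A = V" if lt: "val A < int i - int j"
    proof -
      have "int R \<le> int (card Z)" "?rest \<le> 0" using v rest lt True cZ by (simp_all add: R_def)
      then have ZSp: "Z = Sp" and r0: "?rest = 0" using card_subset_eq[OF cS(2) ZS] cS(1) cZ rest by auto
      have zero: "share A b = 0" if b: "b \<in> {1..M}" "b \<notin> Z" for b
      proof -
        have nn: "0 \<le> share A b" if "b \<in> {1..M} - Z" for b using that by (auto simp: Z_def)
        have "\<forall>b\<in>{1..M} - Z. share A b = 0"
          by (rule iffD1[OF sum_nonneg_eq_0_iff r0]) (simp, rule nn)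
        then show ?thesis using b by blast
      qed
      have sp: "hub b \<in> A \<and> blk b \<subseteq> A" if "b \<in> Sp" for b
        using Z[of b] full_blk[of A b] that ZSp by blast
      have ch: "hub b \<in> A \<and> blk b \<subseteq> A" if b: "R \<le> b" "b \<le> M" for b
        using b(2) b(1)
      proof (induction rule: inc_induct)
        case base show ?case by (rule sp) (simp add: Sp_def)
      next
        case (step n)
        have nM: "n \<in> {1..M}" "n \<notin> Z" "m n = i" using step RM ZSp by (auto simp: Sp_def m_def)
        have "hub (Suc n) = ver n 0" using step by (simp add: hub_def)
        then have "ver n 0 \<in> A" using step by simp
        then show ?case using share_zero[OF zero[OF nM(1,2)] _ nM(3)] full_blk[of A n] by blast
      qed
      have "blk b \<subseteq> A" if "b \<in> {1..M}" for b
        using sp[of b] ch[of b] that by (cases "R \<le> b") (auto simp: Sp_def)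
      then have "V \<subseteq> A" using True unfolding V_def by blast
      then show "A = V" using A by blast
    qed
    moreover have "int i - int j - 1 \<le> val A" using v rest True cZ by (simp add: R_def)
    ultimately show ?thesis by blast
  qed
  then show "int i - int j - 1 \<le> val A" and "A \<noteq> V \<Longrightarrow> int i - int j \<le> val A" by (auto simp: not_less)
qed

text \<open>Sparseness does not depend on the signs. A proper subgraph misses a vertex or an edge,
  and either raises the minimum potential to at least \<open>i - j\<close>, so every signing of it
  is colourable.\<close>

lemma tower_critical: "critical i j (Graph V E)"
  unfolding critical_def
proof (intro conjI allI impI)
  show "simple_graph (Graph V E)" by (rule simple)
  show "\<not> colorable i j (Graph V E)"
    using colorable_plain[OF simple, of i j sg] not_plain_colorable by auto
  fix G' assume G': "subgraph G' (Graph V E) \<and> G' \<noteq> Graph V E"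
  then have s: "simple_graph G'" "verts G' \<subseteq> V" "edges G' \<subseteq> E" by (auto simp: subgraph_def)
  show "colorable i j G'"
  proof (rule ccontr)
    assume "\<not> colorable i j G'"
    then obtain sg' where nc: "\<not> conf_colorable (plain i j (verts G') (edges G') sg')"
      using noncolorable_plain[OF s(1)] by blast
    then have "\<not> sparse i j (plain i j (verts G') (edges G') sg')"
      using sparse_colorable[OF i12 ji plain_wf[OF s(1)], of sg'] by blast
    then obtain A where A: "A \<subseteq> verts G'" "A \<noteq> {}" "pot i j (plain i j (verts G') (edges G') sg') A < int i - int j"
      unfolding sparse_def by (auto simp: not_le)
    let ?c = "card {e \<in> edges G'. e \<subseteq> A}" and ?d = "card {e \<in> E. e \<subseteq> A}"
    have lt: "(2 * int i + 1) * int (card A) - (int i + 1) * int ?c < int i - int j" using A(3) by (simp add: plain_pot)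
    have cd: "?c \<le> ?d" using s(3) finE(1) by (intro card_mono) auto
    show False
    proof (cases "A = V")
      case False
      have "(int i + 1) * int ?c \<le> (int i + 1) * int ?d" using cd by (intro mult_left_mono) auto
      moreover have "int i - int j \<le> val A" using val_ge(2)[OF _ False] A(1) s(2) by blast
      ultimately show False using lt unfolding val_def by linarith
    next
      case True
      then have "verts G' = V" using A(1) s(2) by blast
      then have "edges G' \<noteq> E" using G' by (metis graph.exhaust_sel)
      then have ps: "edges G' \<subset> E" using s(3) by blast
      have "{e \<in> edges G'. e \<subseteq> A} = edges G'" using s(1) True \<open>verts G' = V\<close> by (auto simp: simple_graph_def)
      moreover have "{e \<in> E. e \<subseteq> A} = E" using simple True by (auto simp: simple_graph_def)
      ultimately have "?c + 1 \<le> ?d" using psubset_card_mono[OF finE(1) ps] by simp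
      then have "(int i + 1) * (int ?c + 1) \<le> (int i + 1) * int ?d" by (intro mult_left_mono) auto
      moreover have "int i - int j - 1 \<le> val A" using val_ge(1) True by blast
      ultimately show False using lt unfolding val_def by (simp add: distrib_left)
    qed
  qed
qed

text \<open>The lower bound \<open>val_ge\<close> on the potential and the edge bound for critical
  graphs meet.\<close>

lemma tower_edges: "(int i + 1) * int (card E) = (2 * int i + 1) * int (card V) + int j - int i + 1"
proof -
  have "{e \<in> E. e \<subseteq> V} = E" using simple by (auto simp: simple_graph_def)
  then have "int i - int j - 1 \<le> (2 * int i + 1) * int (card V) - (int i + 1) * int (card E)"
    using val_ge(1)[of V] by (simp add: val_def)
  moreover have "(2 * int i + 1) * int (card V) + int j - int i + 1 \<le> (int i + 1) * int (card E)"
    using critical_edges[OF i12 ji tower_critical] by simp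
  ultimately show ?thesis by linarith
qed

lemma tower_size: "N < card V"
proof -
  have "inj_on (\<lambda>b. ver b 0) {1..M}" by (rule inj_onI) simp
  moreover have "(\<lambda>b. ver b 0) ` {1..M} \<subseteq> V" using blk_center by (auto simp: V_def)
  ultimately have "card {1..M} \<le> card V" using finE(2) card_inj_on_le by blast
  then show ?thesis using RM(1) by (simp add: M_def)
qed

end

section \<open>From integer inequalities to the statement over the reals\<close>

lemma edge_bound_iff:
  "edge_bound i j n \<le> real k \<longleftrightarrow> (2 * int i + 1) * int n + int j - int i + 1 \<le> (int i + 1) * int k"
proof -
  have "edge_bound i j n \<le> real k \<longleftrightarrow> (2 * real i + 1) * real n + real j - real i + 1 \<le> real k * (real i + 1)"
    unfolding edge_bound_def by (simp add: pos_divide_le_eq)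
  also have "\<dots> \<longleftrightarrow> real_of_int ((2 * int i + 1) * int n + int j - int i + 1) \<le> real_of_int ((int i + 1) * int k)"
    by (simp add: mult.commute)
  finally show ?thesis by (simp only: of_int_le_iff)
qed

lemma edge_bound_eq:
  assumes "(int i + 1) * int k = (2 * int i + 1) * int n + int j - int i + 1"
  shows "real k = edge_bound i j n"
proof -
  have "real_of_int ((int i + 1) * int k) = real_of_int ((2 * int i + 1) * int n + int j - int i + 1)"
    using assms by simp
  then show ?thesis unfolding edge_bound_def by (simp add: field_simps)
qed

theorem theorem2p1:
  fixes i j :: nat
  assumes "i \<in> {1, 2}" and "j \<ge> 2 * i"
  shows "(\<forall>n. ereal_of_enat (g_DP i j n) \<ge> ereal (edge_bound i j n)) \<and>
    (\<forall>G :: 'a graph. critical i j G \<longrightarrow>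
       real (card (edges G)) \<ge> edge_bound i j (card (verts G))) \<and>
    infinite {n. n > 0 \<and> ereal_of_enat (g_DP i j n) = ereal (edge_bound i j n) \<and>
      (\<exists>G :: nat graph. critical i j G \<and> card (verts G) = n \<and>
         real (card (edges G)) = edge_bound i j n)}"
proof (intro conjI allI impI)
  have ij: "i = 1 \<or> i = 2" "2 * i \<le> j" using assms by auto
  show "edge_bound i j (card (verts G)) \<le> real (card (edges G))" if "critical i j G" for G :: "'a graph"
    using critical_edges[OF ij that] by (simp add: edge_bound_iff)
  show ge: "ereal (edge_bound i j n) \<le> ereal_of_enat (g_DP i j n)" for n
  proof (cases "{G :: nat graph. critical i j G \<and> card (verts G) = n} = {}")
    case True
    then have "g_DP i j n = \<infinity>" unfolding g_DP_def by (simp only: image_empty Inf_empty top_enat_def)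
    then show ?thesis by simp
  next
    case False
    let ?X = "(\<lambda>G :: nat graph. enat (card (edges G))) ` {G. critical i j G \<and> card (verts G) = n}"
    have "Inf ?X \<in> ?X" using False unfolding Inf_enat_def by (auto intro: LeastI)
    then obtain G :: "nat graph" where G: "critical i j G" "card (verts G) = n" "g_DP i j n = enat (card (edges G))"
      unfolding g_DP_def by auto
    then show ?thesis using critical_edges[OF ij G(1)] by (simp add: edge_bound_iff)
  qed
  show "infinite {n. n > 0 \<and> ereal_of_enat (g_DP i j n) = ereal (edge_bound i j n) \<and>
      (\<exists>G :: nat graph. critical i j G \<and> card (verts G) = n \<and> real (card (edges G)) = edge_bound i j n)}"
    unfolding infinite_nat_iff_unbounded
  proof
    fix N
    interpret tower i j N by unfold_locales (use ij in auto)
    let ?n = "card V"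
    have c: "critical i j (Graph V E)" by (rule tower_critical)
    have e: "real (card E) = edge_bound i j ?n" by (rule edge_bound_eq[OF tower_edges])
    have "g_DP i j ?n \<le> enat (card E)" unfolding g_DP_def by (rule INF_lower2[of "Graph V E"]) (use c in auto)
    then have "ereal_of_enat (g_DP i j ?n) \<le> ereal (real (card E))" by (metis ereal_of_enat_le_iff ereal_of_enat_simps(1))
    then have "ereal_of_enat (g_DP i j ?n) = ereal (edge_bound i j ?n)" using ge[of ?n] e by (simp add: antisym)
    then show "\<exists>n>N. n \<in> {n. n > 0 \<and> ereal_of_enat (g_DP i j n) = ereal (edge_bound i j n) \<and>
      (\<exists>G :: nat graph. critical i j G \<and> card (verts G) = n \<and> real (card (edges G)) = edge_bound i j n)}"
      using tower_size c e by (intro exI[of _ ?n]) auto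
  qed
qed

end
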